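(* Let $(J,\lesssim)$, $(K,\trianglelefteq)$ be finite posets and $L\subset K$ an f-set in $(K,\trianglelefteq)$, with $J\cap(K\setminus L)=\emptyset$. Let $\psi:J\to L$ be a surjective map with $\psi(i)\trianglelefteq\psi(j)$ whenever $i,j\in J$ with $i\lesssim j$. Let $I=J\cup(K\setminus L)$, with the partial order $\preceq$ and the surjective map $\phi:I\to K$ defined in the context. Let $\mathcal A$ be an abelian or exact category, $(\sigma',\iota',\pi')$ a $(J,\lesssim)$-configuration in $\mathcal A$, and $(\tilde\sigma,\tilde\iota,\tilde\pi)$ a $(K,\trianglelefteq)$-configuration in $\mathcal A$. Let $(\hat\sigma,\hat\iota,\hat\pi)$ be the quotient $(L,\trianglelefteq)$-configuration from $(\sigma',\iota',\pi')$ and $\psi$, and $(\check\sigma,\check\iota,\check\pi)$ the $(L,\trianglelefteq)$-subconfiguration of $(\tilde\sigma,\tilde\iota,\tilde\pi)$. (1) Suppose $(\hat\sigma,\hat\iota,\hat\pi)=(\check\sigma,\check\iota,\check\pi)$. Then there exists an $(I,\preceq)$-configuration $(\sigma,\iota,\pi)$ in $\mathcal A$, unique up to canonical isomorphism, such that $(\sigma',\iota',\pi')$ is its $(J,\lesssim)$-subconfiguration and $(\tilde\sigma,\tilde\iota,\tilde\pi)$ is its quotient $(K,\trianglelefteq)$-configuration from $\phi$. (2) More generally, given an isomorphism $\alpha:(\check\sigma,\check\iota,\check\pi)\to(\hat\sigma,\hat\iota,\hat\pi)$ of $(L,\trianglelefteq)$-configurations, there is an $(I,\preceq)$-configuration $(\sigma,\iota,\pi)$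 in $\mathcal A$, unique up to canonical isomorphism, together with an isomorphism $\beta$ from its $(J,\lesssim)$-subconfiguration to $(\sigma',\iota',\pi')$ and an isomorphism $\gamma$ from its quotient $(K,\trianglelefteq)$-configuration from $\phi$ to $(\tilde\sigma,\tilde\iota,\tilde\pi)$, such that $\alpha\circ\gamma_L=\beta_L$, where $\beta_L$, $\gamma_L$ are the induced isomorphisms to $(\hat\sigma,\hat\iota,\hat\pi)$ and to $(\check\sigma,\check\iota,\check\pi)$ respectively from the $(L,\trianglelefteq)$-configuration which is at once the quotient (via $\psi$) of the $(J,\lesssim)$-subconfiguration of $(\sigma,\iota,\pi)$ and the $(L,\trianglelefteq)$-subconfiguration of the quotient $(K,\trianglelefteq)$-configuration of $(\sigma,\iota,\pi)$ (these two being equal).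
   Context: The relation $\preceq$ on $I$: for $i,j\in I$, $i\preceq j$ if and only if one of: $i,j\in J$ and $i\lesssim j$; $i,j\in K\setminus L$ and $i\trianglelefteq j$; $i\in J$, $j\in K\setminus L$ and $\psi(i)\trianglelefteq j$; $i\in K\setminus L$, $j\in J$ and $i\trianglelefteq\psi(j)$. This is a partial order, $J$ is an f-set in $(I,\preceq)$, and $\preceq|_J=\lesssim$. The map $\phi:I\to K$ is $\phi(i)=\psi(i)$ for $i\in J$, $\phi(i)=i$ for $i\in K\setminus L$; it is surjective and $i\preceq j$ implies $\phi(i)\trianglelefteq\phi(j)$. An exact category is a full additive subcategory $\mathcal A$ of an abelian category $\hat{\mathcal A}$, closed under extensions; its exact sequences are the short exact sequences of $\hat{\mathcal A}$ with all terms in $\mathcal A$. For a finite poset $(I,\preceq)$, $J\subseteq I$ is an f-set if $i\in I$, $h,j\in J$, $h\preceq i\preceq j$ imply $i\in J$. $\mathcal F_{(I,\preceq)}$ is the set of f-sets of $I$; $\mathcal G_{(I,\preceq)}$ is the set of pairs $(J,K)$ of f-sets with $J\subseteq K$ such that $j\in J$, $k\in K$, $k\preceq j$ imply $k\in J$; $\mathcal H_{(I,\preceq)}$ is the set of pairs $(J,K)$ of f-sets with $K\subseteq J$ such that $j\in J$, $k\in K$, $k\preceq j$ imply $j\in K$. An $(I,\preceq)$-configuration $(\sigma,\iota,\pi)$ in an abelian or exact category $\mathcal A$ consists of objects $\sigma(J)$ for $J\in\mathcal F_{(I,\preceq)}$ with $\sigma(\emptyset)=0$; injective morphisms $\iota(J,K):\sigma(J)\to\sigma(K)$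 for $(J,K)\in\mathcal G_{(I,\preceq)}$ with $\iota(J,J)=\mathrm{id}_{\sigma(J)}$; and surjective morphisms $\pi(J,K):\sigma(J)\to\sigma(K)$ for $(J,K)\in\mathcal H_{(I,\preceq)}$ with $\pi(J,J)=\mathrm{id}_{\sigma(J)}$, such that: (A) if $(J,K)\in\mathcal G_{(I,\preceq)}$ and $L=K\setminus J$ then $0\to\sigma(J)\xrightarrow{\iota(J,K)}\sigma(K)\xrightarrow{\pi(K,L)}\sigma(L)\to0$ is exact; (B) if $(J,K),(K,L)\in\mathcal G_{(I,\preceq)}$ then $\iota(J,L)=\iota(K,L)\circ\iota(J,K)$; (C) if $(J,K),(K,L)\in\mathcal H_{(I,\preceq)}$ then $\pi(J,L)=\pi(K,L)\circ\pi(J,K)$; (D) if $(J,K)\in\mathcal G_{(I,\preceq)}$ and $(K,L)\in\mathcal H_{(I,\preceq)}$ then $\pi(K,L)\circ\iota(J,K)=\iota(J\cap L,L)\circ\pi(J,J\cap L)$. Morphisms $\alpha$ of configurations are collections $\alpha(J):\sigma(J)\to\sigma'(J)$, $J\in\mathcal F_{(I,\preceq)}$, commuting with all $\iota$'s and $\pi$'s; $\alpha$ is an isomorphism if all $\alpha(J)$ are. If $J\in\mathcal F_{(I,\preceq)}$, the $(J,\preceq)$-subconfiguration of $(\sigma,\iota,\pi)$ is $(\sigma|_{\mathcal F_{(J,\preceq)}},\iota|_{\mathcal G_{(J,\preceq)}},\pi|_{\mathcal H_{(J,\preceq)}})$. If $\phi:I\to K$ is surjective and $i\preceq j$ implies $\phi(i)\trianglelefteq\phi(j)$,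 the quotient $(K,\trianglelefteq)$-configuration of $(\sigma,\iota,\pi)$ from $\phi$ is $(\tilde\sigma,\tilde\iota,\tilde\pi)$ with $\tilde\sigma(A)=\sigma(\phi^{-1}(A))$, $\tilde\iota(A,B)=\iota(\phi^{-1}(A),\phi^{-1}(B))$, $\tilde\pi(A,B)=\pi(\phi^{-1}(A),\phi^{-1}(B))$. "Unique up to canonical isomorphism" means that any two solutions are related by a unique isomorphism of $(I,\preceq)$-configurations compatible with the prescribed data: in (1) inducing the identity on $(\sigma',\iota',\pi')$ and on $(\tilde\sigma,\tilde\iota,\tilde\pi)$, in (2) compatible with $\beta$ and $\gamma$. *)

theory Defs
  imports "HOL-Algebra.Group"
begin

section \<open>Abelian and exact categories\<close>

text \<open>A category whose hom-sets carry an addition, with a distinguished object \<open>null\<close> (the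
  object \<open>0\<close>). \<open>Comp C g f\<close>, written \<open>g \<cdot> f\<close>, is "g after f". Values outside the objects and arrows
  (or on non-composable, non-parallel arrows) are irrelevant.\<close>

record ('o, 'm) cat =
  Obj :: "'o set"
  Arr :: "'m set"
  Dom :: "'m \<Rightarrow> 'o"
  Cod :: "'m \<Rightarrow> 'o"
  Ident :: "'o \<Rightarrow> 'm"
  Comp :: "'m \<Rightarrow> 'm \<Rightarrow> 'm"  (infixr "\<cdot>\<index>" 70)
  Plus :: "'m \<Rightarrow> 'm \<Rightarrow> 'm"
  Zero :: "'o \<Rightarrow> 'o \<Rightarrow> 'm"
  null :: "'o"

definition Hom :: "('o, 'm) cat \<Rightarrow> 'o \<Rightarrow> 'o \<Rightarrow> 'm set" where
  "Hom C X Y = {f \<in> Arr C. Dom C f = X \<and> Cod C f = Y}"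

definition Hom_group :: "('o, 'm) cat \<Rightarrow> 'o \<Rightarrow> 'o \<Rightarrow> 'm monoid" where
  "Hom_group C X Y = \<lparr>carrier = Hom C X Y, mult = Plus C, one = Zero C X Y\<rparr>"

locale category =
  fixes C :: "('o, 'm) cat" (structure)
  assumes Dom_Obj: "f \<in> Arr C \<Longrightarrow> Dom C f \<in> Obj C"
    and Cod_Obj: "f \<in> Arr C \<Longrightarrow> Cod C f \<in> Obj C"
    and Id_Hom: "X \<in> Obj C \<Longrightarrow> Ident C X \<in> Hom C X X"
    and Comp_Hom: "f \<in> Hom C X Y \<Longrightarrow> g \<in> Hom C Y Z \<Longrightarrow> g \<cdot> f \<in> Hom C X Z"
    and Comp_Id: "f \<in> Hom C X Y \<Longrightarrow> f \<cdot> Ident C X = f"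
    and Id_Comp: "f \<in> Hom C X Y \<Longrightarrow> Ident C Y \<cdot> f = f"
    and Comp_assoc: "f \<in> Hom C W X \<Longrightarrow> g \<in> Hom C X Y \<Longrightarrow> h \<in> Hom C Y Z \<Longrightarrow>
      (h \<cdot> g) \<cdot> f = h \<cdot> (g \<cdot> f)"

definition mono_arr :: "('o, 'm) cat \<Rightarrow> 'm \<Rightarrow> bool" where
  "mono_arr C f \<longleftrightarrow> f \<in> Arr C \<and>
     (\<forall>W. \<forall>g \<in> Hom C W (Dom C f). \<forall>h \<in> Hom C W (Dom C f).
        f \<cdot>\<^bsub>C\<^esub> g = f \<cdot>\<^bsub>C\<^esub> h \<longrightarrow> g = h)"

definition epi_arr :: "('o, 'm) cat \<Rightarrow> 'm \<Rightarrow> bool" where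
  "epi_arr C f \<longleftrightarrow> f \<in> Arr C \<and>
     (\<forall>Z. \<forall>g \<in> Hom C (Cod C f) Z. \<forall>h \<in> Hom C (Cod C f) Z.
        g \<cdot>\<^bsub>C\<^esub> f = h \<cdot>\<^bsub>C\<^esub> f \<longrightarrow> g = h)"

definition iso_arr :: "('o, 'm) cat \<Rightarrow> 'm \<Rightarrow> bool" where
  "iso_arr C f \<longleftrightarrow> f \<in> Arr C \<and>
     (\<exists>g \<in> Hom C (Cod C f) (Dom C f).
        g \<cdot>\<^bsub>C\<^esub> f = Ident C (Dom C f) \<and> f \<cdot>\<^bsub>C\<^esub> g = Ident C (Cod C f))"

definition zero_object :: "('o, 'm) cat \<Rightarrow> 'o \<Rightarrow> bool" where
  "zero_object C Z \<longleftrightarrow> Z \<in> Obj C \<and>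
     (\<forall>X \<in> Obj C. (\<exists>!f. f \<in> Hom C X Z) \<and> (\<exists>!f. f \<in> Hom C Z X))"

definition direct_sum :: "('o, 'm) cat \<Rightarrow> 'o \<Rightarrow> 'o \<Rightarrow> 'o \<Rightarrow> bool" where
  "direct_sum C X Y Z \<longleftrightarrow> Z \<in> Obj C \<and>
     (\<exists>i \<in> Hom C X Z. \<exists>j \<in> Hom C Y Z. \<exists>p \<in> Hom C Z X. \<exists>q \<in> Hom C Z Y.
        p \<cdot>\<^bsub>C\<^esub> i = Ident C X \<and> q \<cdot>\<^bsub>C\<^esub> j = Ident C Y \<and>
        p \<cdot>\<^bsub>C\<^esub> j = Zero C Y X \<and> q \<cdot>\<^bsub>C\<^esub> i = Zero C X Y \<and>
        Plus C (i \<cdot>\<^bsub>C\<^esub> p) (j \<cdot>\<^bsub>C\<^esub> q) = Ident C Z)"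

definition is_kernel :: "('o, 'm) cat \<Rightarrow> 'm \<Rightarrow> 'm \<Rightarrow> bool" where
  "is_kernel C k f \<longleftrightarrow> f \<in> Arr C \<and> k \<in> Arr C \<and> Cod C k = Dom C f \<and>
     f \<cdot>\<^bsub>C\<^esub> k = Zero C (Dom C k) (Cod C f) \<and>
     (\<forall>W. \<forall>g \<in> Hom C W (Dom C f). f \<cdot>\<^bsub>C\<^esub> g = Zero C W (Cod C f) \<longrightarrow>
        (\<exists>!h. h \<in> Hom C W (Dom C k) \<and> k \<cdot>\<^bsub>C\<^esub> h = g))"

definition is_cokernel :: "('o, 'm) cat \<Rightarrow> 'm \<Rightarrow> 'm \<Rightarrow> bool" where
  "is_cokernel C c f \<longleftrightarrow> f \<in> Arr C \<and> c \<in> Arr C \<and> Dom C c = Cod C f \<and>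
     c \<cdot>\<^bsub>C\<^esub> f = Zero C (Dom C f) (Cod C c) \<and>
     (\<forall>Z. \<forall>g \<in> Hom C (Cod C f) Z. g \<cdot>\<^bsub>C\<^esub> f = Zero C (Dom C f) Z \<longrightarrow>
        (\<exists>!h. h \<in> Hom C (Cod C c) Z \<and> h \<cdot>\<^bsub>C\<^esub> c = g))"

locale additive_category = category +
  assumes Hom_comm_group: "X \<in> Obj C \<Longrightarrow> Y \<in> Obj C \<Longrightarrow> comm_group (Hom_group C X Y)"
    and Comp_Plus_left: "f \<in> Hom C X Y \<Longrightarrow> g \<in> Hom C Y Z \<Longrightarrow> h \<in> Hom C Y Z \<Longrightarrow>
      Plus C g h \<cdot> f = Plus C (g \<cdot> f) (h \<cdot> f)"
    and Comp_Plus_right: "f \<in> Hom C X Y \<Longrightarrow> g \<in> Hom C X Y \<Longrightarrow> h \<in> Hom C Y Z \<Longrightarrow>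
      h \<cdot> Plus C f g = Plus C (h \<cdot> f) (h \<cdot> g)"
    and zero_object_null: "zero_object C (null C)"
    and ex_direct_sum: "X \<in> Obj C \<Longrightarrow> Y \<in> Obj C \<Longrightarrow> \<exists>Z. direct_sum C X Y Z"

locale abelian_category = additive_category +
  assumes ex_kernel: "f \<in> Arr C \<Longrightarrow> \<exists>k. is_kernel C k f"
    and ex_cokernel: "f \<in> Arr C \<Longrightarrow> \<exists>c. is_cokernel C c f"
    and mono_is_kernel: "mono_arr C f \<Longrightarrow> \<exists>g. is_kernel C f g"
    and epi_is_cokernel: "epi_arr C f \<Longrightarrow> \<exists>g. is_cokernel C f g"

text \<open>Exactness of \<open>0 \<rightarrow> X \<rightarrow> Y \<rightarrow> Z \<rightarrow> 0\<close>, with \<open>f : X \<rightarrow> Y\<close> and \<open>g : Y \<rightarrow> Z\<close>, in an abelian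
  category.\<close>

definition short_exact :: "('o, 'm) cat \<Rightarrow> 'm \<Rightarrow> 'm \<Rightarrow> bool" where
  "short_exact C f g \<longleftrightarrow> is_kernel C f g \<and> is_cokernel C g f"

text \<open>An exact category is given by its ambient abelian category \<open>C\<close> and its set of objects
  \<open>S\<close>; being full, it is determined by these. The object \<open>0\<close> of \<open>C\<close> is taken in \<open>S\<close>, which is no
  restriction as any zero object may be the distinguished one. An abelian category is the case
  \<open>S = Obj C\<close>.\<close>

locale exact_category = abelian_category +
  fixes S :: "'a set"
  assumes S_Obj: "S \<subseteq> Obj C"
    and S_null: "null C \<in> S"
    and S_direct_sum: "X \<in> S \<Longrightarrow> Y \<in> S \<Longrightarrow> \<exists>Z \<in> S. direct_sum C X Y Z"
    and S_extension: "short_exact C f g \<Longrightarrow> Dom C f \<in> S \<Longrightarrow> Cod C g \<in> S \<Longrightarrow> Cod C f \<in> S"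

lemma (in abelian_category) exact_category_Obj: "exact_category C (Obj C)"
proof unfold_locales
  show "null C \<in> Obj C"
    using zero_object_null by (simp add: zero_object_def)
  show "\<exists>Z\<in>Obj C. direct_sum C X Y Z" if "X \<in> Obj C" "Y \<in> Obj C" for X Y
    using ex_direct_sum[OF that] unfolding direct_sum_def by blast
  show "Cod C f \<in> Obj C" if "short_exact C f g" for f g
    using that unfolding short_exact_def is_kernel_def by (intro Cod_Obj) blast
qed simp

definition exact_sequence_in :: "('o, 'm) cat \<Rightarrow> 'o set \<Rightarrow> 'm \<Rightarrow> 'm \<Rightarrow> bool" where
  "exact_sequence_in C S f g \<longleftrightarrow>
     short_exact C f g \<and> Dom C f \<in> S \<and> Cod C f \<in> S \<and> Cod C g \<in> S"


section \<open>Families of subsets of a poset\<close>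

text \<open>A poset is a carrier \<open>I\<close> with a relation \<open>r\<close>. The definitions below use \<open>r\<close> on \<open>I\<close> only, so a
  subset \<open>J\<close> with the induced order is given by \<open>J\<close> and the same \<open>r\<close>.\<close>

definition fsets :: "'a set \<Rightarrow> 'a rel \<Rightarrow> 'a set set" where
  "fsets I r = {J. J \<subseteq> I \<and> (\<forall>i \<in> I. \<forall>h \<in> J. \<forall>j \<in> J. (h, i) \<in> r \<and> (i, j) \<in> r \<longrightarrow> i \<in> J)}"

definition Gpairs :: "'a set \<Rightarrow> 'a rel \<Rightarrow> ('a set \<times> 'a set) set" where
  "Gpairs I r = {(J, K). J \<in> fsets I r \<and> K \<in> fsets I r \<and> J \<subseteq> K \<and>
     (\<forall>j \<in> J. \<forall>k \<in> K. (k, j) \<in> r \<longrightarrow> k \<in> J)}"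

definition Hpairs :: "'a set \<Rightarrow> 'a rel \<Rightarrow> ('a set \<times> 'a set) set" where
  "Hpairs I r = {(J, K). J \<in> fsets I r \<and> K \<in> fsets I r \<and> K \<subseteq> J \<and>
     (\<forall>j \<in> J. \<forall>k \<in> K. (k, j) \<in> r \<longrightarrow> j \<in> K)}"


section \<open>Configurations\<close>

record ('a, 'o, 'm) config =
  cobj :: "'a set \<Rightarrow> 'o"
  cinj :: "'a set \<times> 'a set \<Rightarrow> 'm"
  csurj :: "'a set \<times> 'a set \<Rightarrow> 'm"

text \<open>The components \<open>\<sigma>\<close>, \<open>\<iota>\<close>, \<open>\<pi>\<close> are required to be extensional, i.e. \<open>undefined\<close> outside
  \<open>fsets\<close>, \<open>Gpairs\<close>, \<open>Hpairs\<close>; thus equality of configurations (and of their morphisms) is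
  equality in HOL. Injectivity and surjectivity refer to the ambient abelian category;
  by axiom (A) they are automatic, in \<open>S\<close> as well as in \<open>C\<close>.\<close>

definition configuration ::
    "('o, 'm) cat \<Rightarrow> 'o set \<Rightarrow> 'a set \<Rightarrow> 'a rel \<Rightarrow> ('a, 'o, 'm) config \<Rightarrow> bool" where
  "configuration C S I r c \<longleftrightarrow>
     cobj c \<in> fsets I r \<rightarrow>\<^sub>E S \<and>
     cobj c {} = null C \<and>
     cinj c \<in> extensional (Gpairs I r) \<and>
     (\<forall>(J, K) \<in> Gpairs I r. cinj c (J, K) \<in> Hom C (cobj c J) (cobj c K) \<and>
        mono_arr C (cinj c (J, K))) \<and>
     (\<forall>J \<in> fsets I r. cinj c (J, J) = Ident C (cobj c J)) \<and>
     csurj c \<in> extensional (Hpairs I r) \<and>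
     (\<forall>(J, K) \<in> Hpairs I r. csurj c (J, K) \<in> Hom C (cobj c J) (cobj c K) \<and>
        epi_arr C (csurj c (J, K))) \<and>
     (\<forall>J \<in> fsets I r. csurj c (J, J) = Ident C (cobj c J)) \<and>
     \<comment> \<open>(A)\<close>
     (\<forall>(J, K) \<in> Gpairs I r. exact_sequence_in C S (cinj c (J, K)) (csurj c (K, K - J))) \<and>
     \<comment> \<open>(B)\<close>
     (\<forall>J K L. (J, K) \<in> Gpairs I r \<and> (K, L) \<in> Gpairs I r \<longrightarrow>
        cinj c (J, L) = cinj c (K, L) \<cdot>\<^bsub>C\<^esub> cinj c (J, K)) \<and>
     \<comment> \<open>(C)\<close>
     (\<forall>J K L. (J, K) \<in> Hpairs I r \<and> (K, L) \<in> Hpairs I r \<longrightarrow>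
        csurj c (J, L) = csurj c (K, L) \<cdot>\<^bsub>C\<^esub> csurj c (J, K)) \<and>
     \<comment> \<open>(D)\<close>
     (\<forall>J K L. (J, K) \<in> Gpairs I r \<and> (K, L) \<in> Hpairs I r \<longrightarrow>
        csurj c (K, L) \<cdot>\<^bsub>C\<^esub> cinj c (J, K) = cinj c (J \<inter> L, L) \<cdot>\<^bsub>C\<^esub> csurj c (J, J \<inter> L))"

definition config_morphism :: "('o, 'm) cat \<Rightarrow> 'a set \<Rightarrow> 'a rel \<Rightarrow>
    ('a, 'o, 'm) config \<Rightarrow> ('a, 'o, 'm) config \<Rightarrow> ('a set \<Rightarrow> 'm) \<Rightarrow> bool" where
  "config_morphism C I r c c' \<alpha> \<longleftrightarrow>
     \<alpha> \<in> extensional (fsets I r) \<and>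
     (\<forall>J \<in> fsets I r. \<alpha> J \<in> Hom C (cobj c J) (cobj c' J)) \<and>
     (\<forall>(J, K) \<in> Gpairs I r. \<alpha> K \<cdot>\<^bsub>C\<^esub> cinj c (J, K) = cinj c' (J, K) \<cdot>\<^bsub>C\<^esub> \<alpha> J) \<and>
     (\<forall>(J, K) \<in> Hpairs I r. \<alpha> K \<cdot>\<^bsub>C\<^esub> csurj c (J, K) = csurj c' (J, K) \<cdot>\<^bsub>C\<^esub> \<alpha> J)"

definition config_iso :: "('o, 'm) cat \<Rightarrow> 'a set \<Rightarrow> 'a rel \<Rightarrow>
    ('a, 'o, 'm) config \<Rightarrow> ('a, 'o, 'm) config \<Rightarrow> ('a set \<Rightarrow> 'm) \<Rightarrow> bool" where
  "config_iso C I r c c' \<alpha> \<longleftrightarrow>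
     config_morphism C I r c c' \<alpha> \<and> (\<forall>J \<in> fsets I r. iso_arr C (\<alpha> J))"

definition config_Id ::
    "('o, 'm) cat \<Rightarrow> 'a set \<Rightarrow> 'a rel \<Rightarrow> ('a, 'o, 'm) config \<Rightarrow> 'a set \<Rightarrow> 'm" where
  "config_Id C I r c = (\<lambda>J \<in> fsets I r. Ident C (cobj c J))"

definition config_Comp :: "('o, 'm) cat \<Rightarrow> 'a set \<Rightarrow> 'a rel \<Rightarrow>
    ('a set \<Rightarrow> 'm) \<Rightarrow> ('a set \<Rightarrow> 'm) \<Rightarrow> 'a set \<Rightarrow> 'm" where
  "config_Comp C I r \<beta> \<alpha> = (\<lambda>J \<in> fsets I r. \<beta> J \<cdot>\<^bsub>C\<^esub> \<alpha> J)"

definition subconfig :: "'a set \<Rightarrow> 'a rel \<Rightarrow> ('a, 'o, 'm) config \<Rightarrow> ('a, 'o, 'm) config" where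
  "subconfig J r c =
     \<lparr>cobj = restrict (cobj c) (fsets J r),
      cinj = restrict (cinj c) (Gpairs J r),
      csurj = restrict (csurj c) (Hpairs J r)\<rparr>"

definition subconfig_map :: "'a set \<Rightarrow> 'a rel \<Rightarrow> ('a set \<Rightarrow> 'm) \<Rightarrow> 'a set \<Rightarrow> 'm" where
  "subconfig_map J r \<alpha> = restrict \<alpha> (fsets J r)"

text \<open>In the following two definitions \<open>\<phi>\<close> is a map \<open>I \<rightarrow> K\<close>, so that \<open>\<phi>\<^sup>-\<^sup>1(A)\<close> is
  \<open>\<phi> -` A \<inter> I\<close>, and \<open>r\<close> is the order of \<open>K\<close>.\<close>

definition quotconfig ::
    "'a set \<Rightarrow> ('a \<Rightarrow> 'b) \<Rightarrow> 'b set \<Rightarrow> 'b rel \<Rightarrow> ('a, 'o, 'm) config \<Rightarrow> ('b, 'o, 'm) config" where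
  "quotconfig I \<phi> K r c =
     \<lparr>cobj = (\<lambda>A \<in> fsets K r. cobj c (\<phi> -` A \<inter> I)),
      cinj = (\<lambda>(A, B) \<in> Gpairs K r. cinj c (\<phi> -` A \<inter> I, \<phi> -` B \<inter> I)),
      csurj = (\<lambda>(A, B) \<in> Hpairs K r. csurj c (\<phi> -` A \<inter> I, \<phi> -` B \<inter> I))\<rparr>"

definition quotconfig_map ::
    "'a set \<Rightarrow> ('a \<Rightarrow> 'b) \<Rightarrow> 'b set \<Rightarrow> 'b rel \<Rightarrow> ('a set \<Rightarrow> 'm) \<Rightarrow> 'b set \<Rightarrow> 'm" where
  "quotconfig_map I \<phi> K r \<alpha> = (\<lambda>A \<in> fsets K r. \<alpha> (\<phi> -` A \<inter> I))"


section \<open>Substituting a poset into another\<close>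

definition subst_le ::
    "'a set \<Rightarrow> 'a rel \<Rightarrow> 'a set \<Rightarrow> 'a rel \<Rightarrow> 'a set \<Rightarrow> ('a \<Rightarrow> 'a) \<Rightarrow> 'a rel" where
  "subst_le J leJ K leK L \<psi> = {(i, j).
     i \<in> J \<and> j \<in> J \<and> (i, j) \<in> leJ \<or>
     i \<in> K - L \<and> j \<in> K - L \<and> (i, j) \<in> leK \<or>
     i \<in> J \<and> j \<in> K - L \<and> (\<psi> i, j) \<in> leK \<or>
     i \<in> K - L \<and> j \<in> J \<and> (i, \<psi> j) \<in> leK}"

definition subst_map :: "'a set \<Rightarrow> ('a \<Rightarrow> 'a) \<Rightarrow> 'a \<Rightarrow> 'a" where
  "subst_map J \<psi> i = (if i \<in> J then \<psi> i else i)"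

context
  fixes J K L :: "'a set" and leJ leK :: "'a rel" and \<psi> :: "'a \<Rightarrow> 'a"
  assumes leJ: "partial_order_on J leJ" and leK: "partial_order_on K leK"
    and L: "L \<in> fsets K leK" and disj: "J \<inter> (K - L) = {}" and surj: "\<psi> ` J = L"
    and mono: "\<And>i j. i \<in> J \<Longrightarrow> j \<in> J \<Longrightarrow> (i, j) \<in> leJ \<Longrightarrow> (\<psi> i, \<psi> j) \<in> leK"
begin

lemma partial_order_on_subst_le: "partial_order_on (J \<union> (K - L)) (subst_le J leJ K leK L \<psi>)"
proof -
  note J = partial_order_onD[OF leJ] and K = partial_order_onD[OF leK]
  have LK: "L \<subseteq> K" and \<psi>L: "\<And>i. i \<in> J \<Longrightarrow> \<psi> i \<in> L"
    using L surj by (auto simp: fsets_def)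
  have conv: "k \<in> L" if "h \<in> L" "j \<in> L" "(h, k) \<in> leK" "(k, j) \<in> leK" for h j k
    using L K(4) that unfolding fsets_def by blast
  let ?r = "subst_le J leJ K leK L \<psi>"
  have "?r \<subseteq> (J \<union> (K - L)) \<times> (J \<union> (K - L))"
    by (auto simp: subst_le_def)
  moreover have "refl_on (J \<union> (K - L)) ?r"
    using J(1) K(1) by (auto simp: subst_le_def refl_on_def)
  moreover have "trans ?r"
  proof (rule transI)
    fix x y z assume xy: "(x, y) \<in> ?r" and yz: "(y, z) \<in> ?r"
    have tJ: "\<And>a b c. (a, b) \<in> leJ \<Longrightarrow> (b, c) \<in> leJ \<Longrightarrow> (a, c) \<in> leJ"
      using J(2) by (meson transD)
    have tK: "\<And>a b c. (a, b) \<in> leK \<Longrightarrow> (b, c) \<in> leK \<Longrightarrow> (a, c) \<in> leK"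
      using K(2) by (meson transD)
    have d: "\<And>x. x \<in> J \<Longrightarrow> x \<in> K - L \<Longrightarrow> False" using disj by blast
    show "(x, z) \<in> ?r"
      using xy yz unfolding subst_le_def mem_Collect_eq case_prod_conv
      by (metis tJ tK d mono \<psi>L conv DiffE)
  qed
  moreover have "antisym ?r"
  proof (rule antisymI)
    fix x y assume xy: "(x, y) \<in> ?r" and yx: "(y, x) \<in> ?r"
    have aJ: "\<And>a b. (a, b) \<in> leJ \<Longrightarrow> (b, a) \<in> leJ \<Longrightarrow> a = b"
      using J(3) by (meson antisymD)
    have aK: "\<And>a b. (a, b) \<in> leK \<Longrightarrow> (b, a) \<in> leK \<Longrightarrow> a = b"
      using K(3) by (meson antisymD)
    have d: "\<And>x. x \<in> J \<Longrightarrow> x \<in> K - L \<Longrightarrow> False" using disj by blast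
    show "x = y"
      using xy yx unfolding subst_le_def mem_Collect_eq case_prod_conv
      by (metis aJ aK d \<psi>L DiffE)
  qed
  ultimately show ?thesis
    unfolding partial_order_on_def preorder_on_def by blast
qed

lemma fset_subst_le: "J \<in> fsets (J \<union> (K - L)) (subst_le J leJ K leK L \<psi>)"
proof -
  have "k \<in> L" if "h \<in> L" "j \<in> L" "(h, k) \<in> leK" "(k, j) \<in> leK" for h j k
    using L partial_order_onD(4)[OF leK] that unfolding fsets_def by blast
  then show ?thesis
    using disj surj unfolding fsets_def subst_le_def by blast
qed

lemma subst_le_restrict: "subst_le J leJ K leK L \<psi> \<inter> J \<times> J = leJ"
  using partial_order_onD(4)[OF leJ] disj unfolding subst_le_def by blast

lemma subst_map_surj: "subst_map J \<psi> ` (J \<union> (K - L)) = K"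
proof -
  have "subst_map J \<psi> ` J = \<psi> ` J" by (auto simp: subst_map_def)
  moreover have "subst_map J \<psi> ` (K - L) = K - L"
    using disj by (auto simp: subst_map_def image_iff)
  moreover have "L \<subseteq> K" using L by (simp add: fsets_def)
  ultimately show ?thesis using surj by (auto simp: image_Un)
qed

lemma subst_map_mono:
  "(i, j) \<in> subst_le J leJ K leK L \<psi> \<Longrightarrow> (subst_map J \<psi> i, subst_map J \<psi> j) \<in> leK"
  using disj mono by (auto simp: subst_le_def subst_map_def)

end

end

theory Submission
  imports Defs
begin

text \<open>Why the theorem holds. The elements of \<open>K - L\<close> are substituted for one at a time: there is a
  chain of f-sets from \<open>L\<close> to \<open>K\<close>, each with one element \<open>k\<close> more than the one before, such that
  \<open>k\<close> is maximal or minimal in the larger one (\<open>ex_next_fset\<close>). Solutions compose along the chain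
  (\<open>has_substitution_trans\<close>). Passing to the opposite category and the opposite orders exchanges
  \<open>\<iota>\<close> and \<open>\<pi>\<close>, and maximal and minimal elements (\<open>has_substitution_dual\<close>), so only the addition of
  a maximal element has to be understood.

  Let \<open>k\<close> be maximal in a poset \<open>I\<close>, let \<open>J = I - {k}\<close>, let \<open>N\<close> be the set of elements strictly
  below \<open>k\<close> and \<open>M = N \<union> {k}\<close>. If an f-set \<open>F\<close> contains \<open>k\<close>, then in every configuration on \<open>I\<close> the
  object \<open>\<sigma>(F)\<close> is the pushout of \<open>\<iota>(N, M) : \<sigma>(N) \<rightarrow> \<sigma>(M)\<close> along the composite
  \<open>\<sigma>(N) \<rightarrow> \<sigma>(N \<inter> F) \<rightarrow> \<sigma>(F - {k})\<close>, because \<open>\<sigma>(M)\<close> and \<open>\<sigma>(F)\<close> are extensions of the same object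
  \<open>\<sigma>({k})\<close> (\<open>inc_leg_pushout\<close>). So a configuration on \<open>I\<close> is the same as a configuration on \<open>J\<close>
  together with one extension of an object by \<open>\<sigma>(N)\<close>. For morphisms this is
  \<open>ex1_extend_morphism\<close>, for the configurations themselves \<open>ex_point_extension\<close>. Almost everything
  there is formal from the universal property of pushouts; abelian categories enter through the
  facts that pushouts of injective maps are injective and that injective maps are kernels of their
  cokernels.

  In the situation of the theorem \<open>N\<close> and \<open>M\<close> are preimages under \<open>\<phi>\<close> of the corresponding subsets
  of \<open>K\<close>, so the configuration on \<open>K\<close> prescribes the extension. The quotient of the resulting
  configuration and the prescribed one both arise from the same configuration on \<open>L\<close> and the same
  extension; hence they are isomorphic, and transport along the isomorphism makes them equal
  (\<open>substitute_config\<close>). Uniqueness takes the form that a morphism of subconfigurations and a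
  morphism of quotient configurations that agree on \<open>L\<close> have exactly one common extension; this
  gives the canonical isomorphisms (\<open>ex1_canonical_iso\<close>). The second part of the theorem follows
  from the first by transport of the configuration on \<open>K\<close> along \<open>\<alpha>\<close>.\<close>

section \<open>Abelian categories\<close>

lemma HomD:
  assumes "f \<in> Hom C X Y"
  shows "f \<in> Arr C" "Dom C f = X" "Cod C f = Y"
  using assms by (auto simp: Hom_def)

lemma mono_Arr: "mono_arr C f \<Longrightarrow> f \<in> Arr C"
  by (simp add: mono_arr_def)

lemma epi_Arr: "epi_arr C f \<Longrightarrow> f \<in> Arr C"
  by (simp add: epi_arr_def)

context category
begin

text \<open>Composability is expressed through \<open>Dom\<close> and \<open>Cod\<close>, which the simplifier can compute and
  compare. Membership in \<open>Hom C X Y\<close> would leave it to guess the objects.\<close>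

lemma Comp_Arr [simp]:
  assumes "f \<in> Arr C" "g \<in> Arr C" "Cod C f = Dom C g"
  shows "g \<cdot> f \<in> Arr C" "Dom C (g \<cdot> f) = Dom C f" "Cod C (g \<cdot> f) = Cod C g"
proof -
  have "g \<cdot> f \<in> Hom C (Dom C f) (Cod C g)"
    using assms by (intro Comp_Hom[of _ _ "Cod C f"]) (auto simp: Hom_def)
  then show "g \<cdot> f \<in> Arr C" "Dom C (g \<cdot> f) = Dom C f" "Cod C (g \<cdot> f) = Cod C g"
    by (auto simp: Hom_def)
qed

lemma assoc [simp]:
  "f \<in> Arr C \<Longrightarrow> g \<in> Arr C \<Longrightarrow> h \<in> Arr C \<Longrightarrow> Cod C f = Dom C g \<Longrightarrow> Cod C g = Dom C h \<Longrightarrow>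
    (h \<cdot> g) \<cdot> f = h \<cdot> g \<cdot> f"
  by (rule Comp_assoc) (auto simp: Hom_def)

lemma Obj_Dom_Cod [simp]: "f \<in> Arr C \<Longrightarrow> Dom C f \<in> Obj C" "f \<in> Arr C \<Longrightarrow> Cod C f \<in> Obj C"
  by (auto intro: Dom_Obj Cod_Obj)

lemma Hom_Obj: "f \<in> Hom C X Y \<Longrightarrow> X \<in> Obj C" "f \<in> Hom C X Y \<Longrightarrow> Y \<in> Obj C"
  by (auto simp: Hom_def)

lemma Ident_Arr [simp]:
  "X \<in> Obj C \<Longrightarrow> Ident C X \<in> Arr C" "X \<in> Obj C \<Longrightarrow> Dom C (Ident C X) = X"
  "X \<in> Obj C \<Longrightarrow> Cod C (Ident C X) = X"
  using Id_Hom by (auto simp: Hom_def)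

lemma Comp_Ident [simp]: "f \<in> Arr C \<Longrightarrow> Dom C f = X \<Longrightarrow> f \<cdot> Ident C X = f"
  by (auto intro: Comp_Id simp: Hom_def)

lemma Ident_Comp [simp]: "f \<in> Arr C \<Longrightarrow> Cod C f = X \<Longrightarrow> Ident C X \<cdot> f = f"
  by (auto intro: Id_Comp simp: Hom_def)

lemma mono_arrD:
  "mono_arr C f \<Longrightarrow> g \<in> Arr C \<Longrightarrow> h \<in> Arr C \<Longrightarrow> Cod C g = Dom C f \<Longrightarrow> Cod C h = Dom C f \<Longrightarrow>
    Dom C g = Dom C h \<Longrightarrow> f \<cdot> g = f \<cdot> h \<Longrightarrow> g = h"
  unfolding mono_arr_def Hom_def by blast

lemma epi_arrD:
  "epi_arr C f \<Longrightarrow> g \<in> Arr C \<Longrightarrow> h \<in> Arr C \<Longrightarrow> Dom C g = Cod C f \<Longrightarrow> Dom C h = Cod C f \<Longrightarrow>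
    Cod C g = Cod C h \<Longrightarrow> g \<cdot> f = h \<cdot> f \<Longrightarrow> g = h"
  unfolding epi_arr_def Hom_def by blast

lemma mono_Comp:
  assumes "mono_arr C f" "mono_arr C g" "Cod C f = Dom C g"
  shows "mono_arr C (g \<cdot> f)"
proof -
  have A: "f \<in> Arr C" "g \<in> Arr C" using assms by (auto intro: mono_Arr)
  show ?thesis
    unfolding mono_arr_def
  proof (intro conjI allI ballI impI)
    fix W a b assume ab: "a \<in> Hom C W (Dom C (g \<cdot> f))" "b \<in> Hom C W (Dom C (g \<cdot> f))"
      and e: "(g \<cdot> f) \<cdot> a = (g \<cdot> f) \<cdot> b"
    note * = HomD[OF ab(1)] HomD[OF ab(2)]
    have "g \<cdot> f \<cdot> a = g \<cdot> f \<cdot> b" using e A assms(3) * by simp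
    then have "f \<cdot> a = f \<cdot> b" by - (rule mono_arrD[OF assms(2)]; use A assms(3) * in auto)
    then show "a = b" by - (rule mono_arrD[OF assms(1)]; use A assms(3) * in auto)
  qed (use A assms(3) in auto)
qed

lemma iso_arrE:
  assumes "iso_arr C f"
  obtains g where "f \<in> Arr C" "g \<in> Arr C" "Dom C g = Cod C f" "Cod C g = Dom C f"
    "g \<cdot> f = Ident C (Dom C f)" "f \<cdot> g = Ident C (Cod C f)"
  using assms unfolding iso_arr_def Hom_def by blast

lemma iso_arrI:
  "f \<in> Arr C \<Longrightarrow> g \<in> Arr C \<Longrightarrow> Dom C g = Cod C f \<Longrightarrow> Cod C g = Dom C f \<Longrightarrow>
    g \<cdot> f = Ident C (Dom C f) \<Longrightarrow> f \<cdot> g = Ident C (Cod C f) \<Longrightarrow> iso_arr C f"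
  unfolding iso_arr_def Hom_def by blast

definition inv_arr :: "'m \<Rightarrow> 'm" where
  "inv_arr f = (SOME g. g \<in> Arr C \<and> Dom C g = Cod C f \<and> Cod C g = Dom C f \<and>
     g \<cdot> f = Ident C (Dom C f) \<and> f \<cdot> g = Ident C (Cod C f))"

lemma inv_arr [simp]:
  assumes "iso_arr C f"
  shows "inv_arr f \<in> Arr C" "Dom C (inv_arr f) = Cod C f" "Cod C (inv_arr f) = Dom C f"
    "inv_arr f \<cdot> f = Ident C (Dom C f)" "f \<cdot> inv_arr f = Ident C (Cod C f)"
proof -
  obtain g where "g \<in> Arr C \<and> Dom C g = Cod C f \<and> Cod C g = Dom C f \<and>
      g \<cdot> f = Ident C (Dom C f) \<and> f \<cdot> g = Ident C (Cod C f)"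
    using assms by (rule iso_arrE) blast
  from someI[where P = "\<lambda>g. g \<in> Arr C \<and> Dom C g = Cod C f \<and> Cod C g = Dom C f \<and>
      g \<cdot> f = Ident C (Dom C f) \<and> f \<cdot> g = Ident C (Cod C f)", OF this]
  show "inv_arr f \<in> Arr C" "Dom C (inv_arr f) = Cod C f" "Cod C (inv_arr f) = Dom C f"
    "inv_arr f \<cdot> f = Ident C (Dom C f)" "f \<cdot> inv_arr f = Ident C (Cod C f)"
    unfolding inv_arr_def by auto
qed

lemma iso_Arr: "iso_arr C f \<Longrightarrow> f \<in> Arr C"
  by (simp add: iso_arr_def)

lemma inv_arr_Comp [simp]:
  assumes "iso_arr C f" "g \<in> Arr C"
  shows "Cod C g = Dom C f \<Longrightarrow> inv_arr f \<cdot> f \<cdot> g = g"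
    and "Cod C g = Cod C f \<Longrightarrow> f \<cdot> inv_arr f \<cdot> g = g"
proof -
  have f: "f \<in> Arr C" by (rule iso_Arr[OF assms(1)])
  show "inv_arr f \<cdot> f \<cdot> g = g" if "Cod C g = Dom C f"
    using assms f that by (subst assoc[symmetric]) auto
  show "f \<cdot> inv_arr f \<cdot> g = g" if "Cod C g = Cod C f"
    using assms f that by (subst assoc[symmetric]) auto
qed

lemma iso_mono: assumes "iso_arr C f" shows "mono_arr C f"
  unfolding mono_arr_def
proof (intro conjI allI ballI impI iso_Arr[OF assms])
  fix W a b assume ab: "a \<in> Hom C W (Dom C f)" "b \<in> Hom C W (Dom C f)" "f \<cdot> a = f \<cdot> b"
  then have "inv_arr f \<cdot> f \<cdot> a = inv_arr f \<cdot> f \<cdot> b" by simp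
  then show "a = b" using HomD[OF ab(1)] HomD[OF ab(2)] assms by simp
qed

lemma iso_epi: assumes "iso_arr C f" shows "epi_arr C f"
  unfolding epi_arr_def
proof (intro conjI allI ballI impI iso_Arr[OF assms])
  fix W a b assume ab: "a \<in> Hom C (Cod C f) W" "b \<in> Hom C (Cod C f) W" "a \<cdot> f = b \<cdot> f"
  then have "(a \<cdot> f) \<cdot> inv_arr f = (b \<cdot> f) \<cdot> inv_arr f" by simp
  then show "a = b" using HomD[OF ab(1)] HomD[OF ab(2)] assms iso_Arr[OF assms] by simp
qed

lemma iso_inv_arr: "iso_arr C f \<Longrightarrow> iso_arr C (inv_arr f)"
  by (rule iso_arrI[where g = f]) (auto simp: iso_Arr)

lemma iso_Ident: "X \<in> Obj C \<Longrightarrow> iso_arr C (Ident C X)"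
  by (rule iso_arrI[where g = "Ident C X"]) auto

lemma iso_Comp:
  assumes "iso_arr C f" "iso_arr C g" "Cod C f = Dom C g"
  shows "iso_arr C (g \<cdot> f)"
  using assms iso_Arr[OF assms(1)] iso_Arr[OF assms(2)]
  by (intro iso_arrI[where g = "inv_arr f \<cdot> inv_arr g"]) auto

lemma square_paste:
  assumes "b \<cdot> f = f' \<cdot> a" "c \<cdot> g = g' \<cdot> b"
    "f \<in> Arr C" "g \<in> Arr C" "f' \<in> Arr C" "g' \<in> Arr C" "a \<in> Arr C" "b \<in> Arr C" "c \<in> Arr C"
    "Cod C f = Dom C g" "Cod C f' = Dom C g'" "Dom C a = Dom C f" "Cod C a = Dom C f'"
    "Dom C b = Cod C f" "Cod C b = Cod C f'" "Dom C c = Cod C g" "Cod C c = Cod C g'"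
  shows "c \<cdot> g \<cdot> f = (g' \<cdot> f') \<cdot> a"
proof -
  have "c \<cdot> g \<cdot> f = (c \<cdot> g) \<cdot> f" using assms(3-) by simp
  also have "\<dots> = g' \<cdot> b \<cdot> f" unfolding assms(2) using assms(3-) by simp
  also have "\<dots> = (g' \<cdot> f') \<cdot> a" unfolding assms(1) using assms(3-) by simp
  finally show ?thesis .
qed

text \<open>Composites are normalised to the right, so an equation \<open>g \<cdot> f = h\<close> does not rewrite
  \<open>g \<cdot> f \<cdot> x\<close>; this is the form that does.\<close>

lemma Comp_eq:
  assumes "g \<cdot> f = h" "f \<in> Arr C" "g \<in> Arr C" "x \<in> Arr C" "Cod C f = Dom C g" "Cod C x = Dom C f"
  shows "g \<cdot> f \<cdot> x = h \<cdot> x"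
  using assms(2-) by (simp flip: assms(1))

end

context additive_category
begin

lemma Plus_Hom: "f \<in> Hom C X Y \<Longrightarrow> g \<in> Hom C X Y \<Longrightarrow> Plus C f g \<in> Hom C X Y"
  using comm_groupE(1)[OF Hom_comm_group[of X Y]] Hom_Obj[of f X Y] by (simp add: Hom_group_def)

lemma Plus_assoc: "f \<in> Hom C X Y \<Longrightarrow> g \<in> Hom C X Y \<Longrightarrow> h \<in> Hom C X Y \<Longrightarrow>
    Plus C (Plus C f g) h = Plus C f (Plus C g h)"
  using comm_groupE(3)[OF Hom_comm_group[of X Y]] Hom_Obj[of f X Y] by (simp add: Hom_group_def)

lemma Plus_comm: "f \<in> Hom C X Y \<Longrightarrow> g \<in> Hom C X Y \<Longrightarrow> Plus C f g = Plus C g f"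
  using comm_groupE(4)[OF Hom_comm_group[of X Y]] Hom_Obj[of f X Y] by (simp add: Hom_group_def)

lemma Zero_Hom: "X \<in> Obj C \<Longrightarrow> Y \<in> Obj C \<Longrightarrow> Zero C X Y \<in> Hom C X Y"
  using comm_groupE(2)[OF Hom_comm_group[of X Y]] by (simp add: Hom_group_def)

lemma Zero_Plus: "f \<in> Hom C X Y \<Longrightarrow> Plus C (Zero C X Y) f = f"
  using comm_groupE(5)[OF Hom_comm_group[of X Y]] Hom_Obj[of f X Y] by (simp add: Hom_group_def)

lemma ex_neg: "f \<in> Hom C X Y \<Longrightarrow> \<exists>g \<in> Hom C X Y. Plus C g f = Zero C X Y"
  using comm_groupE(6)[OF Hom_comm_group[of X Y]] Hom_Obj[of f X Y] by (simp add: Hom_group_def)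

lemma Plus_cancel:
  assumes "f \<in> Hom C X Y" "g \<in> Hom C X Y" "h \<in> Hom C X Y" "Plus C f g = Plus C f h"
  shows "g = h"
proof -
  obtain n where n: "n \<in> Hom C X Y" "Plus C n f = Zero C X Y" using ex_neg[OF assms(1)] by blast
  have "Plus C (Plus C n f) g = Plus C (Plus C n f) h"
    using assms n(1) by (simp add: Plus_assoc[of n X Y])
  then show ?thesis using n assms by (simp add: Zero_Plus)
qed

lemma Zero_Arr [simp]:
  assumes "X \<in> Obj C" "Y \<in> Obj C"
  shows "Zero C X Y \<in> Arr C" "Dom C (Zero C X Y) = X" "Cod C (Zero C X Y) = Y"
  using Zero_Hom[OF assms] by (auto simp: Hom_def)

lemma Plus_idem: "f \<in> Hom C X Y \<Longrightarrow> Plus C f f = f \<Longrightarrow> f = Zero C X Y"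
  using Plus_cancel[of f X Y f "Zero C X Y"] Zero_Plus[of f X Y] Zero_Hom[of X Y] Hom_Obj[of f X Y]
    Plus_comm[of f X Y "Zero C X Y"] by simp

lemma Comp_Zero [simp]:
  assumes "f \<in> Arr C" "Dom C f = Y" "X \<in> Obj C"
  shows "f \<cdot> Zero C X Y = Zero C X (Cod C f)"
proof -
  have Y: "Y \<in> Obj C" using assms by auto
  note Z = Zero_Hom[OF assms(3) Y]
  have "f \<cdot> Plus C (Zero C X Y) (Zero C X Y) = Plus C (f \<cdot> Zero C X Y) (f \<cdot> Zero C X Y)"
    using assms by (intro Comp_Plus_right[OF Z Z]) (auto simp: Hom_def)
  then show ?thesis
    using assms Y by (intro Plus_idem) (auto simp: Zero_Plus[OF Z] Hom_def)
qed

lemma Zero_Comp [simp]: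
  assumes "f \<in> Arr C" "Cod C f = X" "Y \<in> Obj C"
  shows "Zero C X Y \<cdot> f = Zero C (Dom C f) Y"
proof -
  have X: "X \<in> Obj C" using assms by auto
  note Z = Zero_Hom[OF X assms(3)]
  have "Plus C (Zero C X Y) (Zero C X Y) \<cdot> f = Plus C (Zero C X Y \<cdot> f) (Zero C X Y \<cdot> f)"
    using assms by (intro Comp_Plus_left[OF _ Z Z]) (auto simp: Hom_def)
  then show ?thesis
    using assms X by (intro Plus_idem) (auto simp: Zero_Plus[OF Z] Hom_def)
qed

lemma null_Obj [simp]: "null C \<in> Obj C"
  using zero_object_null by (simp add: zero_object_def)

lemma to_null: "f \<in> Arr C \<Longrightarrow> Cod C f = null C \<Longrightarrow> f = Zero C (Dom C f) (null C)"
  using zero_object_null Zero_Hom[of "Dom C f" "null C"]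
  unfolding zero_object_def Hom_def by (metis (mono_tags, lifting) Obj_Dom_Cod(1) mem_Collect_eq)

lemma mono_arrI:
  assumes f: "f \<in> Arr C"
    and "\<And>w. w \<in> Arr C \<Longrightarrow> Cod C w = Dom C f \<Longrightarrow> f \<cdot> w = Zero C (Dom C w) (Cod C f) \<Longrightarrow>
      w = Zero C (Dom C w) (Cod C w)"
  shows "mono_arr C f"
  unfolding mono_arr_def
proof (intro conjI allI ballI impI f)
  fix W g h assume g: "g \<in> Hom C W (Dom C f)" and h: "h \<in> Hom C W (Dom C f)" and e: "f \<cdot> g = f \<cdot> h"
  obtain n where n: "n \<in> Hom C W (Dom C f)" "Plus C n g = Zero C W (Dom C f)"
    using ex_neg[OF g] by blast
  have ff: "f \<in> Hom C (Dom C f) (Cod C f)" using f by (simp add: Hom_def)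
  have "f \<cdot> Plus C n h = f \<cdot> Plus C n g"
    using e by (simp add: Comp_Plus_right[OF n(1) h ff] Comp_Plus_right[OF n(1) g ff])
  also have "\<dots> = Zero C W (Cod C f)" using n f HomD[OF n(1)] by auto
  finally have "Plus C n h = Zero C W (Dom C f)"
    using assms(2)[of "Plus C n h"] HomD[OF Plus_Hom[OF n(1) h]] by auto
  then show "g = h" using n Plus_cancel[OF n(1) g h] by simp
qed

end

subsection \<open>Kernels, cokernels and pushouts\<close>

lemma kernel_factor:
  assumes "is_kernel C k f" "g \<in> Arr C" "Cod C g = Dom C f"
    "f \<cdot>\<^bsub>C\<^esub> g = Zero C (Dom C g) (Cod C f)"
  obtains h where "h \<in> Arr C" "Dom C h = Dom C g" "Cod C h = Dom C k" "k \<cdot>\<^bsub>C\<^esub> h = g"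
  using assms unfolding is_kernel_def Hom_def by blast

lemma cokernel_factor:
  assumes "is_cokernel C c f" "g \<in> Arr C" "Dom C g = Cod C f"
    "g \<cdot>\<^bsub>C\<^esub> f = Zero C (Dom C f) (Cod C g)"
  obtains h where "h \<in> Arr C" "Dom C h = Cod C c" "Cod C h = Cod C g" "h \<cdot>\<^bsub>C\<^esub> c = g"
  using assms unfolding is_cokernel_def Hom_def by blast

context additive_category
begin

lemma kernel_mono: assumes "is_kernel C k f" shows "mono_arr C k"
proof -
  have k: "f \<in> Arr C" "k \<in> Arr C" "Cod C k = Dom C f" "f \<cdot> k = Zero C (Dom C k) (Cod C f)"
    using assms by (auto simp: is_kernel_def)
  show ?thesis
  proof (rule mono_arrI[OF k(2)])
    fix w assume w: "w \<in> Arr C" "Cod C w = Dom C k" "k \<cdot> w = Zero C (Dom C w) (Cod C k)"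
    have "\<exists>!h. h \<in> Hom C (Dom C w) (Dom C k) \<and> k \<cdot> h = Zero C (Dom C w) (Dom C f)"
      using assms w k unfolding is_kernel_def
      by (metis Comp_Zero Obj_Dom_Cod(1) Zero_Hom)
    moreover have "w \<in> Hom C (Dom C w) (Dom C k) \<and> k \<cdot> w = Zero C (Dom C w) (Dom C f)"
      using w k by (simp add: Hom_def)
    moreover have "Zero C (Dom C w) (Dom C k) \<in> Hom C (Dom C w) (Dom C k) \<and>
        k \<cdot> Zero C (Dom C w) (Dom C k) = Zero C (Dom C w) (Dom C f)"
      using w k by (simp add: Hom_def)
    ultimately show "w = Zero C (Dom C w) (Cod C w)" using w by auto
  qed
qed

lemma cokernel_epi: assumes "is_cokernel C c f" shows "epi_arr C c"
proof -
  have k: "f \<in> Arr C" "c \<in> Arr C" "Dom C c = Cod C f" "c \<cdot> f = Zero C (Dom C f) (Cod C c)"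
    using assms by (auto simp: is_cokernel_def)
  show ?thesis
    unfolding epi_arr_def
  proof (intro conjI allI ballI impI)
    fix Z g h assume g: "g \<in> Hom C (Cod C c) Z" and h: "h \<in> Hom C (Cod C c) Z" and e: "g \<cdot> c = h \<cdot> c"
    have Z: "Z \<in> Obj C" using Hom_Obj[OF g] by simp
    have "g \<cdot> c \<in> Hom C (Cod C f) Z" "(g \<cdot> c) \<cdot> f = Zero C (Dom C f) Z"
      using HomD[OF g] k Z by (auto simp: Hom_def)
    then have "\<exists>!x. x \<in> Hom C (Cod C c) Z \<and> x \<cdot> c = g \<cdot> c"
      using assms unfolding is_cokernel_def by blast
    then show "g = h" using g h e by metis
  qed (rule k(2))
qed

lemma is_kernelI:
  assumes "f \<in> Arr C" "mono_arr C k" "Cod C k = Dom C f" "f \<cdot> k = Zero C (Dom C k) (Cod C f)"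
    and "\<And>g. g \<in> Arr C \<Longrightarrow> Cod C g = Dom C f \<Longrightarrow> f \<cdot> g = Zero C (Dom C g) (Cod C f) \<Longrightarrow>
      \<exists>h. h \<in> Arr C \<and> Dom C h = Dom C g \<and> Cod C h = Dom C k \<and> k \<cdot> h = g"
  shows "is_kernel C k f"
  unfolding is_kernel_def
proof (intro conjI allI ballI impI)
  fix W g assume g: "g \<in> Hom C W (Dom C f)" "f \<cdot> g = Zero C W (Cod C f)"
  have "\<exists>h. h \<in> Arr C \<and> Dom C h = Dom C g \<and> Cod C h = Dom C k \<and> k \<cdot> h = g"
    using HomD[OF g(1)] g(2) by (intro assms(5)) auto
  then obtain h where "h \<in> Hom C W (Dom C k)" "k \<cdot> h = g"
    using HomD[OF g(1)] unfolding Hom_def by blast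
  moreover have "h' = h''" if "h' \<in> Hom C W (Dom C k) \<and> k \<cdot> h' = g" "h'' \<in> Hom C W (Dom C k) \<and> k \<cdot> h'' = g"
    for h' h''
    by - (rule mono_arrD[OF assms(2)]; use that in \<open>auto simp: Hom_def\<close>)
  ultimately show "\<exists>!h. h \<in> Hom C W (Dom C k) \<and> k \<cdot> h = g"
    by blast
qed (use assms(1,3,4) mono_Arr[OF assms(2)] in auto)

lemma is_cokernelI:
  assumes "f \<in> Arr C" "epi_arr C c" "Dom C c = Cod C f" "c \<cdot> f = Zero C (Dom C f) (Cod C c)"
    and "\<And>g. g \<in> Arr C \<Longrightarrow> Dom C g = Cod C f \<Longrightarrow> g \<cdot> f = Zero C (Dom C f) (Cod C g) \<Longrightarrow>
      \<exists>h. h \<in> Arr C \<and> Dom C h = Cod C c \<and> Cod C h = Cod C g \<and> h \<cdot> c = g"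
  shows "is_cokernel C c f"
  unfolding is_cokernel_def
proof (intro conjI allI ballI impI)
  fix Z g assume g: "g \<in> Hom C (Cod C f) Z" "g \<cdot> f = Zero C (Dom C f) Z"
  have "\<exists>h. h \<in> Arr C \<and> Dom C h = Cod C c \<and> Cod C h = Cod C g \<and> h \<cdot> c = g"
    using HomD[OF g(1)] g(2) by (intro assms(5)) auto
  then obtain h where "h \<in> Hom C (Cod C c) Z" "h \<cdot> c = g"
    using HomD[OF g(1)] unfolding Hom_def by blast
  moreover have "h' = h''" if "h' \<in> Hom C (Cod C c) Z \<and> h' \<cdot> c = g" "h'' \<in> Hom C (Cod C c) Z \<and> h'' \<cdot> c = g"
    for h' h''
    by - (rule epi_arrD[OF assms(2)]; use that in \<open>auto simp: Hom_def\<close>)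
  ultimately show "\<exists>!h. h \<in> Hom C (Cod C c) Z \<and> h \<cdot> c = g"
    by blast
qed (use assms(1,3,4) epi_Arr[OF assms(2)] in auto)

lemma short_exactD:
  assumes "short_exact C f g"
  shows "f \<in> Arr C" "g \<in> Arr C" "Dom C g = Cod C f" "g \<cdot> f = Zero C (Dom C f) (Cod C g)"
    "mono_arr C f" "epi_arr C g" "is_kernel C f g" "is_cokernel C g f"
proof -
  have k: "is_kernel C f g" and c: "is_cokernel C g f" using assms by (simp_all add: short_exact_def)
  show "f \<in> Arr C" "g \<in> Arr C" "Dom C g = Cod C f" "g \<cdot> f = Zero C (Dom C f) (Cod C g)"
    using c unfolding is_cokernel_def by blast+
  show "mono_arr C f" "epi_arr C g" "is_kernel C f g" "is_cokernel C g f"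
    using kernel_mono[OF k] cokernel_epi[OF c] k c by blast+
qed

end

text \<open>Arguments are in the order \<open>f : X \<rightarrow> Y\<close>, \<open>v : X \<rightarrow> X'\<close>, \<open>i : X' \<rightarrow> P\<close>, \<open>u : Y \<rightarrow> P\<close>; so \<open>i\<close> is opposite to \<open>f\<close>.\<close>

definition pushout :: "('o, 'm) cat \<Rightarrow> 'm \<Rightarrow> 'm \<Rightarrow> 'm \<Rightarrow> 'm \<Rightarrow> bool" where
  "pushout C f v i u \<longleftrightarrow> {f, v, i, u} \<subseteq> Arr C \<and> Dom C f = Dom C v \<and> Dom C u = Cod C f \<and>
     Dom C i = Cod C v \<and> Cod C i = Cod C u \<and> i \<cdot>\<^bsub>C\<^esub> v = u \<cdot>\<^bsub>C\<^esub> f \<and>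
     (\<forall>T. \<forall>s \<in> Hom C (Cod C v) T. \<forall>t \<in> Hom C (Cod C f) T. s \<cdot>\<^bsub>C\<^esub> v = t \<cdot>\<^bsub>C\<^esub> f \<longrightarrow>
        (\<exists>!h. h \<in> Hom C (Cod C i) T \<and> h \<cdot>\<^bsub>C\<^esub> i = s \<and> h \<cdot>\<^bsub>C\<^esub> u = t))"

lemma pushoutD:
  assumes "pushout C f v i u"
  shows "f \<in> Arr C" "v \<in> Arr C" "i \<in> Arr C" "u \<in> Arr C" "Dom C f = Dom C v" "Dom C u = Cod C f"
    "Dom C i = Cod C v" "Cod C u = Cod C i" "i \<cdot>\<^bsub>C\<^esub> v = u \<cdot>\<^bsub>C\<^esub> f"
  using assms by (auto simp: pushout_def)

lemma pushout_ex1: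
  assumes "pushout C f v i u" "s \<in> Hom C (Cod C v) T" "t \<in> Hom C (Cod C f) T"
    "s \<cdot>\<^bsub>C\<^esub> v = t \<cdot>\<^bsub>C\<^esub> f"
  shows "\<exists>!h. h \<in> Hom C (Cod C i) T \<and> h \<cdot>\<^bsub>C\<^esub> i = s \<and> h \<cdot>\<^bsub>C\<^esub> u = t"
  using assms(1)[unfolded pushout_def, THEN conjunct2, THEN conjunct2, THEN conjunct2,
      THEN conjunct2, THEN conjunct2, THEN conjunct2, THEN spec, THEN bspec, OF assms(2),
      THEN bspec, OF assms(3), THEN mp, OF assms(4)] .

lemma pushout_factor:
  assumes "pushout C f v i u" "s \<in> Arr C" "t \<in> Arr C" "Dom C s = Cod C v" "Dom C t = Cod C f"
    "Cod C s = Cod C t" "s \<cdot>\<^bsub>C\<^esub> v = t \<cdot>\<^bsub>C\<^esub> f"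
  obtains h where "h \<in> Arr C" "Dom C h = Cod C i" "Cod C h = Cod C s" "h \<cdot>\<^bsub>C\<^esub> i = s" "h \<cdot>\<^bsub>C\<^esub> u = t"
proof -
  have "s \<in> Hom C (Cod C v) (Cod C s)" "t \<in> Hom C (Cod C f) (Cod C s)"
    using assms(2-6) by (auto simp: Hom_def)
  then have "\<exists>!h. h \<in> Hom C (Cod C i) (Cod C s) \<and> h \<cdot>\<^bsub>C\<^esub> i = s \<and> h \<cdot>\<^bsub>C\<^esub> u = t"
    by (rule pushout_ex1[OF assms(1) _ _ assms(7)])
  then show ?thesis using that by (auto simp: Hom_def)
qed

lemma (in category) pushout_joint_epi:
  assumes "pushout C f v i u" "h \<in> Arr C" "h' \<in> Arr C" "Dom C h = Cod C i" "Dom C h' = Cod C i"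
    "Cod C h = Cod C h'" "h \<cdot> i = h' \<cdot> i" "h \<cdot> u = h' \<cdot> u"
  shows "h = h'"
proof -
  note p = pushoutD[OF assms(1)]
  have "h \<cdot> i \<in> Hom C (Cod C v) (Cod C h)" "h \<cdot> u \<in> Hom C (Cod C f) (Cod C h)"
    using assms(2,4) p by (auto simp: Hom_def)
  moreover have "(h \<cdot> i) \<cdot> v = (h \<cdot> u) \<cdot> f" using assms(2,4) p by simp
  ultimately have "\<exists>!x. x \<in> Hom C (Cod C i) (Cod C h) \<and> x \<cdot> i = h \<cdot> i \<and> x \<cdot> u = h \<cdot> u"
    by (rule pushout_ex1[OF assms(1)])
  moreover have "h \<in> Hom C (Cod C i) (Cod C h)" "h' \<in> Hom C (Cod C i) (Cod C h)"
    using assms by (auto simp: Hom_def)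
  ultimately show ?thesis using assms(7,8) by metis
qed

lemma (in category) pushoutI:
  assumes "f \<in> Arr C" "v \<in> Arr C" "i \<in> Arr C" "u \<in> Arr C" "Dom C f = Dom C v" "Dom C u = Cod C f"
    "Dom C i = Cod C v" "Cod C u = Cod C i" "i \<cdot> v = u \<cdot> f"
    and "\<And>s t. s \<in> Arr C \<Longrightarrow> t \<in> Arr C \<Longrightarrow> Dom C s = Cod C v \<Longrightarrow> Dom C t = Cod C f \<Longrightarrow>
      Cod C s = Cod C t \<Longrightarrow> s \<cdot> v = t \<cdot> f \<Longrightarrow>
      \<exists>h. h \<in> Arr C \<and> Dom C h = Cod C i \<and> Cod C h = Cod C t \<and> h \<cdot> i = s \<and> h \<cdot> u = t"
    and "\<And>h h'. h \<in> Arr C \<Longrightarrow> h' \<in> Arr C \<Longrightarrow> Dom C h = Cod C i \<Longrightarrow> Dom C h' = Cod C i \<Longrightarrow>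
      Cod C h = Cod C h' \<Longrightarrow> h \<cdot> i = h' \<cdot> i \<Longrightarrow> h \<cdot> u = h' \<cdot> u \<Longrightarrow> h = h'"
  shows "pushout C f v i u"
  unfolding pushout_def
proof (intro conjI allI ballI impI)
  fix T s t assume st: "s \<in> Hom C (Cod C v) T" "t \<in> Hom C (Cod C f) T" "s \<cdot> v = t \<cdot> f"
  have "\<exists>h. h \<in> Arr C \<and> Dom C h = Cod C i \<and> Cod C h = Cod C t \<and> h \<cdot> i = s \<and> h \<cdot> u = t"
    using HomD[OF st(1)] HomD[OF st(2)] st(3) by (intro assms(10)) auto
  then obtain h where "h \<in> Hom C (Cod C i) T" "h \<cdot> i = s" "h \<cdot> u = t"
    using HomD[OF st(2)] unfolding Hom_def by blast
  moreover have "h' = h''" if "h' \<in> Hom C (Cod C i) T \<and> h' \<cdot> i = s \<and> h' \<cdot> u = t"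
    "h'' \<in> Hom C (Cod C i) T \<and> h'' \<cdot> i = s \<and> h'' \<cdot> u = t" for h' h''
    by - (rule assms(11); use that in \<open>auto simp: Hom_def\<close>)
  ultimately show "\<exists>!h. h \<in> Hom C (Cod C i) T \<and> h \<cdot> i = s \<and> h \<cdot> u = t" by blast
qed (use assms(1-9) in auto)

context abelian_category
begin

text \<open>If \<open>f\<close> is the kernel of \<open>g\<close>, then \<open>g\<close> factors through the cokernel of \<open>f\<close>. So whatever the
  cokernel kills is killed by \<open>g\<close> and factors through \<open>f\<close>.\<close>

lemma mono_kernel_of_cokernel:
  assumes "mono_arr C f" "is_cokernel C c f"
  shows "is_kernel C f c"
proof -
  obtain g where g: "is_kernel C f g" using mono_is_kernel[OF assms(1)] by blast
  have f: "g \<in> Arr C" "f \<in> Arr C" "Cod C f = Dom C g" "g \<cdot> f = Zero C (Dom C f) (Cod C g)"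
    using g by (auto simp: is_kernel_def)
  have c: "c \<in> Arr C" "Dom C c = Cod C f" "c \<cdot> f = Zero C (Dom C f) (Cod C c)"
    using assms by (auto simp: is_cokernel_def)
  obtain h where h: "h \<in> Arr C" "Dom C h = Cod C c" "Cod C h = Cod C g" "h \<cdot> c = g"
    by (rule cokernel_factor[OF assms(2) f(1) f(3)[symmetric] f(4)])
  show ?thesis
  proof (rule is_kernelI[OF c(1) assms(1) c(2)[symmetric] c(3)])
    fix w assume w: "w \<in> Arr C" "Cod C w = Dom C c" "c \<cdot> w = Zero C (Dom C w) (Cod C c)"
    have "g \<cdot> w = h \<cdot> c \<cdot> w" unfolding h(4)[symmetric] using w h(1-3) c by simp
    also have "\<dots> = Zero C (Dom C w) (Cod C g)" using w h c by simp
    finally show "\<exists>t. t \<in> Arr C \<and> Dom C t = Dom C w \<and> Cod C t = Dom C f \<and> f \<cdot> t = w"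
      using kernel_factor[OF g w(1)] w(2) c f(3) by metis
  qed
qed

lemma short_exactI: "mono_arr C f \<Longrightarrow> is_cokernel C c f \<Longrightarrow> short_exact C f c"
  by (simp add: short_exact_def mono_kernel_of_cokernel)

text \<open>If \<open>f\<close> is the kernel of \<open>g\<close>, then \<open>g = 0\<close> as \<open>f\<close> is epi; so the identity is killed by \<open>g\<close> and
  factors through \<open>f\<close>.\<close>

lemma mono_epi_iso:
  assumes "mono_arr C f" "epi_arr C f"
  shows "iso_arr C f"
proof -
  obtain g where g: "is_kernel C f g" using mono_is_kernel[OF assms(1)] by blast
  have f: "g \<in> Arr C" "f \<in> Arr C" "Cod C f = Dom C g" "g \<cdot> f = Zero C (Dom C f) (Cod C g)"
    using g by (auto simp: is_kernel_def)
  have "g = Zero C (Cod C f) (Cod C g)"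
    by - (rule epi_arrD[OF assms(2)]; use f in auto)
  then have "g \<cdot> Ident C (Cod C f) = Zero C (Dom C (Ident C (Cod C f))) (Cod C g)"
    using f by simp
  then obtain h where h: "h \<in> Arr C" "Dom C h = Cod C f" "Cod C h = Dom C f"
      "f \<cdot> h = Ident C (Cod C f)"
    using kernel_factor[OF g, of "Ident C (Cod C f)"] f by auto
  have "f \<cdot> h \<cdot> f = (f \<cdot> h) \<cdot> f" using h(1-3) f(1-3) by simp
  then have "f \<cdot> h \<cdot> f = f \<cdot> Ident C (Dom C f)" using h(4) f by simp
  then have "h \<cdot> f = Ident C (Dom C f)"
    by - (rule mono_arrD[OF assms(1)]; use h f in auto)
  then show ?thesis using iso_arrI[OF f(2) h(1)] h by simp
qed

text \<open>The pushout is the cokernel of \<open>(f, -v) : X \<rightarrow> Y \<oplus> X'\<close>. As \<open>f\<close> is injective this map is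
  the kernel of its cokernel, so any \<open>w\<close> killed by \<open>i\<close>, that is, a \<open>(0, w)\<close> killed by the cokernel,
  comes from some \<open>t\<close> with \<open>f \<cdot> t = 0\<close>; hence \<open>i\<close> is injective.\<close>

lemma ex_pushout_mono:
  assumes f: "mono_arr C f" and v: "v \<in> Arr C" and fv: "Dom C f = Dom C v"
  shows "\<exists>i u. pushout C f v i u \<and> mono_arr C i"
proof -
  let ?X = "Dom C f" and ?Y = "Cod C f" and ?X' = "Cod C v"
  have fA: "f \<in> Arr C" by (rule mono_Arr[OF f])
  obtain Z i1 i2 p1 p2 where Z: "Z \<in> Obj C" and H: "i1 \<in> Hom C ?Y Z" "i2 \<in> Hom C ?X' Z"
      "p1 \<in> Hom C Z ?Y" "p2 \<in> Hom C Z ?X'"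
    and e: "p1 \<cdot> i1 = Ident C ?Y" "p2 \<cdot> i2 = Ident C ?X'" "p1 \<cdot> i2 = Zero C ?X' ?Y"
      "p2 \<cdot> i1 = Zero C ?Y ?X'" "Plus C (i1 \<cdot> p1) (i2 \<cdot> p2) = Ident C Z"
    using ex_direct_sum[of ?Y ?X'] fA v unfolding direct_sum_def by auto
  note A = HomD[OF H(1)] HomD[OF H(2)] HomD[OF H(3)] HomD[OF H(4)]
  have vH: "v \<in> Hom C ?X ?X'" and fH: "f \<in> Hom C ?X ?Y" using v fv fA by (auto simp: Hom_def)
  obtain n where n: "n \<in> Hom C ?X ?X'" "Plus C n v = Zero C ?X ?X'" using ex_neg[OF vH] by blast
  note nA = HomD[OF n(1)]
  define d where "d = Plus C (i1 \<cdot> f) (i2 \<cdot> n)"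
  have ifH: "i1 \<cdot> f \<in> Hom C ?X Z" and inH: "i2 \<cdot> n \<in> Hom C ?X Z"
    using A nA fA by (auto simp: Hom_def)
  have dH: "d \<in> Hom C ?X Z" unfolding d_def by (rule Plus_Hom[OF ifH inH])
  note dA = HomD[OF dH]
  have p1d: "p1 \<cdot> d = f"
  proof -
    have "p1 \<cdot> d = Plus C (p1 \<cdot> i1 \<cdot> f) (p1 \<cdot> i2 \<cdot> n)"
      unfolding d_def by (rule Comp_Plus_right[OF ifH inH H(3)])
    also have "p1 \<cdot> i1 \<cdot> f = f" using A fA e(1) by (subst assoc[symmetric]) auto
    also have "p1 \<cdot> i2 \<cdot> n = Zero C ?X ?Y" using A fA nA e(3) by (subst assoc[symmetric]) auto
    finally show ?thesis using Plus_comm[OF fH Zero_Hom] Zero_Plus[OF fH] fA by simp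
  qed
  have p2d: "p2 \<cdot> d = n"
  proof -
    have "p2 \<cdot> d = Plus C (p2 \<cdot> i1 \<cdot> f) (p2 \<cdot> i2 \<cdot> n)"
      unfolding d_def by (rule Comp_Plus_right[OF ifH inH H(4)])
    also have "p2 \<cdot> i1 \<cdot> f = Zero C ?X ?X'" using A v fA e(4) by (subst assoc[symmetric]) auto
    also have "p2 \<cdot> i2 \<cdot> n = n" using A v nA e(2) by (subst assoc[symmetric]) auto
    finally show ?thesis using Zero_Plus[OF n(1)] by simp
  qed
  obtain c where c: "is_cokernel C c d" using ex_cokernel dA by blast
  have cA: "c \<in> Arr C" "Dom C c = Z" "c \<cdot> d = Zero C ?X (Cod C c)"
    using c dA by (auto simp: is_cokernel_def)
  define P where "P = Cod C c"
  have P: "P \<in> Obj C" and cP: "Cod C c = P" using cA by (auto simp: P_def)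
  have d_mono: "mono_arr C d"
  proof (rule mono_arrI[OF dA(1)])
    fix w assume w: "w \<in> Arr C" "Cod C w = Dom C d" "d \<cdot> w = Zero C (Dom C w) (Cod C d)"
    have "f \<cdot> w = p1 \<cdot> d \<cdot> w" using p1d A w dA by (metis assoc)
    also have "\<dots> = Zero C (Dom C w) ?Y" using w A dA by simp
    finally have "f \<cdot> w = f \<cdot> Zero C (Dom C w) ?X" using w fA dA by simp
    then show "w = Zero C (Dom C w) (Cod C w)"
      by - (rule mono_arrD[OF f]; use w fA dA in auto)
  qed
  have ker: "is_kernel C d c" by (rule mono_kernel_of_cokernel[OF d_mono c])
  have sq: "(c \<cdot> i2) \<cdot> v = (c \<cdot> i1) \<cdot> f"
  proof -
    have cH: "c \<in> Hom C Z P" using cA P_def by (simp add: Hom_def)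
    have H1: "c \<cdot> i2 \<cdot> n \<in> Hom C ?X P" "c \<cdot> i1 \<cdot> f \<in> Hom C ?X P" "c \<cdot> i2 \<cdot> v \<in> Hom C ?X P"
      using A nA fA v fv cA P_def by (auto simp: Hom_def)
    have "Plus C (c \<cdot> i2 \<cdot> n) (c \<cdot> i1 \<cdot> f) = c \<cdot> d"
      using Comp_Plus_right[OF ifH inH cH] Plus_comm[OF H1(1,2)] by (simp add: d_def)
    also have "\<dots> = (c \<cdot> i2) \<cdot> Plus C n v" using n(2) cA A P_def fA v by simp
    also have "\<dots> = Plus C ((c \<cdot> i2) \<cdot> n) ((c \<cdot> i2) \<cdot> v)"
      using A cA P_def by (intro Comp_Plus_right[OF n(1) vH, of _ P]) (auto simp: Hom_def)
    also have "\<dots> = Plus C (c \<cdot> i2 \<cdot> n) (c \<cdot> i2 \<cdot> v)" using A nA cA v by simp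
    finally have "c \<cdot> i1 \<cdot> f = c \<cdot> i2 \<cdot> v" by (rule Plus_cancel[OF H1(1,2,3)])
    then show ?thesis using A cA v fA by simp
  qed
  have "pushout C f v (c \<cdot> i2) (c \<cdot> i1)"
  proof (rule pushoutI)
    fix s t assume st: "s \<in> Arr C" "t \<in> Arr C" "Dom C s = ?X'" "Dom C t = ?Y" "Cod C s = Cod C t"
      "s \<cdot> v = t \<cdot> f"
    have tH: "t \<cdot> p1 \<in> Hom C Z (Cod C t)" and sH: "s \<cdot> p2 \<in> Hom C Z (Cod C t)"
      using st A by (auto simp: Hom_def)
    define h0 where "h0 = Plus C (t \<cdot> p1) (s \<cdot> p2)"
    note h0H = Plus_Hom[OF tH sH, folded h0_def]
    have "h0 \<cdot> d = Plus C ((t \<cdot> p1) \<cdot> d) ((s \<cdot> p2) \<cdot> d)"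
      unfolding h0_def by (rule Comp_Plus_left[OF dH tH sH])
    also have "(t \<cdot> p1) \<cdot> d = s \<cdot> v" using st A dA p1d by simp
    also have "(s \<cdot> p2) \<cdot> d = s \<cdot> n" using st A dA p2d by simp
    also have "Plus C (s \<cdot> v) (s \<cdot> n) = s \<cdot> Plus C n v"
      using st Comp_Plus_right[OF vH n(1), of s "Cod C s"] Plus_comm[OF vH n(1)] by (simp add: Hom_def)
    also have "\<dots> = Zero C ?X (Cod C t)" using n(2) st fA by simp
    finally obtain h where h: "h \<in> Arr C" "Dom C h = Cod C c" "Cod C h = Cod C t" "h \<cdot> c = h0"
      using cokernel_factor[OF c, of h0] HomD[OF h0H] dA by auto
    have "h \<cdot> c \<cdot> i2 = s"
    proof -
      have "h \<cdot> c \<cdot> i2 = h0 \<cdot> i2" using h A cA by (metis assoc)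
      also have "\<dots> = Plus C ((t \<cdot> p1) \<cdot> i2) ((s \<cdot> p2) \<cdot> i2)"
        unfolding h0_def by (rule Comp_Plus_left[OF H(2) tH sH])
      also have "\<dots> = Plus C (Zero C ?X' (Cod C t)) s" using st A e v by simp
      finally show ?thesis using st by (simp add: Zero_Plus Hom_def)
    qed
    moreover have "h \<cdot> c \<cdot> i1 = t"
    proof -
      have "h \<cdot> c \<cdot> i1 = h0 \<cdot> i1" using h A cA by (metis assoc)
      also have "\<dots> = Plus C ((t \<cdot> p1) \<cdot> i1) ((s \<cdot> p2) \<cdot> i1)"
        unfolding h0_def by (rule Comp_Plus_left[OF H(1) tH sH])
      also have "\<dots> = Plus C t (Zero C ?Y (Cod C t))" using st A e fA by simp
      also have "\<dots> = Plus C (Zero C ?Y (Cod C t)) t"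
        using st fA by (intro Plus_comm[where X = ?Y and Y = "Cod C t"]) (auto simp: Hom_def)
      finally show ?thesis using st by (simp add: Zero_Plus Hom_def)
    qed
    ultimately show "\<exists>h. h \<in> Arr C \<and> Dom C h = Cod C (c \<cdot> i2) \<and> Cod C h = Cod C t \<and>
        h \<cdot> c \<cdot> i2 = s \<and> h \<cdot> c \<cdot> i1 = t"
      using h A cA by auto
  next
    fix h h' assume h: "h \<in> Arr C" "h' \<in> Arr C" "Dom C h = Cod C (c \<cdot> i2)" "Dom C h' = Cod C (c \<cdot> i2)"
      "Cod C h = Cod C h'" "h \<cdot> c \<cdot> i2 = h' \<cdot> c \<cdot> i2" "h \<cdot> c \<cdot> i1 = h' \<cdot> c \<cdot> i1"
    have dec: "x \<cdot> c = Plus C ((x \<cdot> c \<cdot> i1) \<cdot> p1) ((x \<cdot> c \<cdot> i2) \<cdot> p2)"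
      if "x \<in> Arr C" "Dom C x = P" for x
    proof -
      have "(x \<cdot> c) \<cdot> Plus C (i1 \<cdot> p1) (i2 \<cdot> p2) = Plus C ((x \<cdot> c) \<cdot> i1 \<cdot> p1) ((x \<cdot> c) \<cdot> i2 \<cdot> p2)"
        using that A cA cP by (intro Comp_Plus_right[of _ Z Z _ _ "Cod C x"]) (auto simp: Hom_def)
      then show ?thesis using that A cA cP e(5) by simp
    qed
    have "Dom C h = P" "Dom C h' = P" using h A cA cP by auto
    then have "h \<cdot> c = h' \<cdot> c" using h dec[of h] dec[of h'] by simp
    then show "h = h'" by - (rule epi_arrD[OF cokernel_epi[OF c]]; use h A cA in auto)
  qed (use A cA fA v fv sq in auto)
  moreover have "mono_arr C (c \<cdot> i2)"
  proof (rule mono_arrI)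
    fix w assume w: "w \<in> Arr C" "Cod C w = Dom C (c \<cdot> i2)"
      "(c \<cdot> i2) \<cdot> w = Zero C (Dom C w) (Cod C (c \<cdot> i2))"
    have wd: "Cod C w = ?X'" using w A cA by simp
    have "c \<cdot> i2 \<cdot> w = Zero C (Dom C (i2 \<cdot> w)) (Cod C c)" using w wd A cA by simp
    then obtain t where t: "t \<in> Arr C" "Dom C t = Dom C w" "Cod C t = ?X" "d \<cdot> t = i2 \<cdot> w"
      using kernel_factor[OF ker, of "i2 \<cdot> w"] w wd A cA dA by auto
    have "f \<cdot> t = p1 \<cdot> d \<cdot> t" using p1d t A dA by (metis assoc)
    also have "\<dots> = (p1 \<cdot> i2) \<cdot> w" using t A w wd by simp
    also have "\<dots> = f \<cdot> Zero C (Dom C w) ?X" using e(3) w wd fA by simp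
    finally have t0: "t = Zero C (Dom C w) ?X" by - (rule mono_arrD[OF f]; use t w fA in auto)
    have "w = (p2 \<cdot> i2) \<cdot> w" using e(2) w wd by simp
    also have "\<dots> = p2 \<cdot> d \<cdot> t" using t A w wd by simp
    also have "\<dots> = Zero C (Dom C w) (Cod C w)" using t0 dA A w wd fA by simp
    finally show "w = Zero C (Dom C w) (Cod C w)" .
  qed (use A cA in auto)
  ultimately show ?thesis by blast
qed

text \<open>By the universal property, maps on the pushout that vanish on \<open>i\<close> correspond to maps on the
  target of \<open>f\<close> that vanish on \<open>f\<close>; therefore \<open>i\<close> and \<open>f\<close> have the same cokernel.\<close>

lemma ex_pushout_short_exact:
  assumes fg: "short_exact C f g" and v: "v \<in> Arr C" and fv: "Dom C f = Dom C v"
  shows "\<exists>i u p. pushout C f v i u \<and> short_exact C i p \<and> Cod C p = Cod C g \<and> p \<cdot> u = g"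
proof -
  note F = short_exactD[OF fg]
  obtain i u where po: "pushout C f v i u" and i: "mono_arr C i"
    using ex_pushout_mono[OF F(5) v fv] by blast
  note P = pushoutD[OF po]
  obtain p where p: "p \<in> Arr C" "Dom C p = Cod C i" "Cod C p = Cod C g"
      "p \<cdot> i = Zero C (Cod C v) (Cod C g)" "p \<cdot> u = g"
    using pushout_factor[OF po, of "Zero C (Cod C v) (Cod C g)" g] F P by auto
  have epi: "epi_arr C p"
    unfolding epi_arr_def
  proof (intro conjI allI ballI impI p(1))
    fix T h h' assume h: "h \<in> Hom C (Cod C p) T" "h' \<in> Hom C (Cod C p) T" "h \<cdot> p = h' \<cdot> p"
    have "(h \<cdot> p) \<cdot> u = (h' \<cdot> p) \<cdot> u" using h by simp
    then have "h \<cdot> g = h' \<cdot> g" using p P HomD[OF h(1)] HomD[OF h(2)] by simp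
    then show "h = h'" by - (rule epi_arrD[OF F(6)]; use F p HomD[OF h(1)] HomD[OF h(2)] in auto)
  qed
  have "is_cokernel C p i"
  proof (rule is_cokernelI[OF P(3) epi p(2)])
    fix w assume w: "w \<in> Arr C" "Dom C w = Cod C i" "w \<cdot> i = Zero C (Dom C i) (Cod C w)"
    have "(w \<cdot> u) \<cdot> f = w \<cdot> i \<cdot> v" using w P by simp
    also have "\<dots> = (w \<cdot> i) \<cdot> v" using w(1,2) P by simp
    finally have "(w \<cdot> u) \<cdot> f = Zero C (Dom C f) (Cod C (w \<cdot> u))"
      unfolding w(3) using w(1,2) P by simp
    then obtain h where h: "h \<in> Arr C" "Dom C h = Cod C g" "Cod C h = Cod C w" "h \<cdot> g = w \<cdot> u"
      using cokernel_factor[OF F(8), of "w \<cdot> u"] w P by auto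
    have "h \<cdot> p = w"
      by - (rule pushout_joint_epi[OF po]; use h p w P in auto)
    then show "\<exists>h. h \<in> Arr C \<and> Dom C h = Cod C p \<and> Cod C h = Cod C w \<and> h \<cdot> p = w"
      using h p by auto
  qed (use p P in auto)
  from short_exactI[OF i this] po p(3,5) show ?thesis by (intro exI[of _ i] exI[of _ u] exI[of _ p]) simp
qed

lemma pushout_iso:
  assumes po: "pushout C f v i u" and h: "iso_arr C h" and d: "Dom C h = Cod C i"
  shows "pushout C f v (h \<cdot> i) (h \<cdot> u)"
proof -
  note P = pushoutD[OF po] iso_Arr[OF h] d
  show ?thesis
  proof (rule pushoutI)
    fix s t assume st: "s \<in> Arr C" "t \<in> Arr C" "Dom C s = Cod C v" "Dom C t = Cod C f"
      "Cod C s = Cod C t" "s \<cdot> v = t \<cdot> f"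
    obtain k where k: "k \<in> Arr C" "Dom C k = Cod C i" "Cod C k = Cod C s" "k \<cdot> i = s" "k \<cdot> u = t"
      by (rule pushout_factor[OF po st])
    have "(k \<cdot> inv_arr h) \<cdot> h \<cdot> i = s" "(k \<cdot> inv_arr h) \<cdot> h \<cdot> u = t" using k P h by auto
    then show "\<exists>k. k \<in> Arr C \<and> Dom C k = Cod C (h \<cdot> i) \<and> Cod C k = Cod C t \<and>
        k \<cdot> h \<cdot> i = s \<and> k \<cdot> h \<cdot> u = t"
      using k h P st by (intro exI[of _ "k \<cdot> inv_arr h"]) auto
  next
    fix k k' assume k: "k \<in> Arr C" "k' \<in> Arr C" "Dom C k = Cod C (h \<cdot> i)" "Dom C k' = Cod C (h \<cdot> i)"
      "Cod C k = Cod C k'" "k \<cdot> h \<cdot> i = k' \<cdot> h \<cdot> i" "k \<cdot> h \<cdot> u = k' \<cdot> h \<cdot> u"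
    have "k \<cdot> h = k' \<cdot> h" by - (rule pushout_joint_epi[OF po]; use k P in auto)
    then show "k = k'" by - (rule epi_arrD[OF iso_epi[OF h]]; use k P in auto)
  qed (use P in auto)
qed

text \<open>Compare with the pushout of \<open>f\<close> along \<open>v\<close>, which is an extension of the same cokernel;
  the comparison map is injective and surjective, hence invertible.\<close>

lemma pushout_of_same_cokernel:
  assumes fg: "short_exact C f g" and iq: "short_exact C i q" and v: "v \<in> Arr C" and u: "u \<in> Arr C"
    and d: "Dom C f = Dom C v" "Dom C i = Cod C v" "Dom C u = Cod C f" "Cod C u = Cod C i"
    and sq: "i \<cdot> v = u \<cdot> f" and qu: "q \<cdot> u = g"
  shows "pushout C f v i u"
proof -
  note F = short_exactD[OF fg] and Q = short_exactD[OF iq]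
  obtain j w p where po: "pushout C f v j w" and jp: "short_exact C j p" and pw: "p \<cdot> w = g"
    and pg: "Cod C p = Cod C g"
    using ex_pushout_short_exact[OF fg v d(1)] by blast
  note P = pushoutD[OF po] and J = short_exactD[OF jp]
  obtain h where h: "h \<in> Arr C" "Dom C h = Cod C j" "Cod C h = Cod C i" "h \<cdot> j = i" "h \<cdot> w = u"
    using pushout_factor[OF po, of i u] Q u d sq by auto
  have gq: "Cod C g = Cod C q" using qu Q u d by auto
  have qh: "q \<cdot> h = p"
    by - (rule pushout_joint_epi[OF po]; use h Q P J pw qu pg gq d in auto)
  have "mono_arr C h"
  proof (rule mono_arrI[OF h(1)])
    fix x assume x: "x \<in> Arr C" "Cod C x = Dom C h" "h \<cdot> x = Zero C (Dom C x) (Cod C h)"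
    have "p \<cdot> x = q \<cdot> h \<cdot> x" using qh[symmetric] x(1,2) h(1-3) Q(1-3) by simp
    also have "\<dots> = Zero C (Dom C x) (Cod C p)" using x h Q pg gq by simp
    finally obtain t where t: "t \<in> Arr C" "Dom C t = Dom C x" "Cod C t = Dom C j" "j \<cdot> t = x"
      using kernel_factor[OF J(7), of x] x h J by auto
    have "i \<cdot> t = (h \<cdot> j) \<cdot> t" using h by simp
    also have "\<dots> = i \<cdot> Zero C (Dom C x) (Dom C i)" using h(1-3) t x J Q by simp
    finally have "t = Zero C (Dom C x) (Dom C i)"
      by - (rule mono_arrD[OF Q(5)]; use t x Q P d in auto)
    then show "x = Zero C (Dom C x) (Cod C x)" using t J P d x h by auto
  qed
  moreover have "epi_arr C h"
    unfolding epi_arr_def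
  proof (intro conjI allI ballI impI h(1))
    fix T a b assume a: "a \<in> Hom C (Cod C h) T" and b: "b \<in> Hom C (Cod C h) T" and ab: "a \<cdot> h = b \<cdot> h"
    obtain n where n: "n \<in> Hom C (Cod C h) T" "Plus C n a = Zero C (Cod C h) T"
      using ex_neg[OF a] by blast
    define x where "x = Plus C n b"
    have xH: "x \<in> Hom C (Cod C h) T" unfolding x_def by (rule Plus_Hom[OF n(1) b])
    note xA = HomD[OF xH]
    have hH: "h \<in> Hom C (Dom C h) (Cod C h)" using h by (simp add: Hom_def)
    have "x \<cdot> h = Plus C n a \<cdot> h"
      using ab by (simp add: x_def Comp_Plus_left[OF hH n(1) b] Comp_Plus_left[OF hH n(1) a])
    then have xh: "x \<cdot> h = Zero C (Dom C h) T" using n h Hom_Obj[OF a] by simp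
    have "x \<cdot> i = (x \<cdot> h) \<cdot> j" using h xA J by (metis assoc)
    also have "\<dots> = Zero C (Dom C i) (Cod C x)" using xh h P d J xA Hom_Obj[OF a] by simp
    finally obtain s where s: "s \<in> Arr C" "Dom C s = Cod C q" "Cod C s = Cod C x" "s \<cdot> q = x"
      using cokernel_factor[OF Q(8), of x] xA h by auto
    have "s \<cdot> p = (s \<cdot> q) \<cdot> h" using qh[symmetric] s(1-3) h Q by simp
    also have "\<dots> = Zero C (Cod C q) T \<cdot> p" using s xh h J pg gq Hom_Obj[OF a] by simp
    finally have "s = Zero C (Cod C q) T"
      by - (rule epi_arrD[OF J(6)]; use s xA J pg gq Q Hom_Obj[OF a] in auto)
    then have "x = Zero C (Cod C h) T" using s Q h Hom_Obj[OF a] by auto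
    then show "a = b" using n Plus_cancel[OF n(1) a b] by (simp add: x_def)
  qed
  ultimately have "iso_arr C h" by (rule mono_epi_iso)
  then show ?thesis using pushout_iso[OF po _ h(2)] h by simp
qed

end

section \<open>Families of f-sets\<close>

lemma fsetsD:
  assumes "F \<in> fsets I r"
  shows "F \<subseteq> I" "\<And>h i j. h \<in> F \<Longrightarrow> j \<in> F \<Longrightarrow> i \<in> I \<Longrightarrow> (h, i) \<in> r \<Longrightarrow> (i, j) \<in> r \<Longrightarrow> i \<in> F"
  using assms unfolding fsets_def by blast+

lemma fsetsI:
  assumes "F \<subseteq> I" "\<And>h i j. h \<in> F \<Longrightarrow> j \<in> F \<Longrightarrow> i \<in> I \<Longrightarrow> (h, i) \<in> r \<Longrightarrow> (i, j) \<in> r \<Longrightarrow> i \<in> F"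
  shows "F \<in> fsets I r"
  using assms unfolding fsets_def by blast

lemma fsets_empty [simp]: "{} \<in> fsets I r"
  by (simp add: fsets_def)

lemma GpairsD:
  assumes "(J, K) \<in> Gpairs I r"
  shows "J \<in> fsets I r" "K \<in> fsets I r" "J \<subseteq> K"
    "\<And>j k. j \<in> J \<Longrightarrow> k \<in> K \<Longrightarrow> (k, j) \<in> r \<Longrightarrow> k \<in> J"
  using assms unfolding Gpairs_def by blast+

lemma GpairsI:
  assumes "J \<in> fsets I r" "K \<in> fsets I r" "J \<subseteq> K"
    "\<And>j k. j \<in> J \<Longrightarrow> k \<in> K \<Longrightarrow> (k, j) \<in> r \<Longrightarrow> k \<in> J"
  shows "(J, K) \<in> Gpairs I r"
  using assms unfolding Gpairs_def by blast

lemma HpairsD: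
  assumes "(J, K) \<in> Hpairs I r"
  shows "J \<in> fsets I r" "K \<in> fsets I r" "K \<subseteq> J"
    "\<And>j k. j \<in> J \<Longrightarrow> k \<in> K \<Longrightarrow> (k, j) \<in> r \<Longrightarrow> j \<in> K"
  using assms unfolding Hpairs_def by blast+

lemma HpairsI:
  assumes "J \<in> fsets I r" "K \<in> fsets I r" "K \<subseteq> J"
    "\<And>j k. j \<in> J \<Longrightarrow> k \<in> K \<Longrightarrow> (k, j) \<in> r \<Longrightarrow> j \<in> K"
  shows "(J, K) \<in> Hpairs I r"
  using assms unfolding Hpairs_def by blast

lemma Gpairs_refl: "J \<in> fsets I r \<Longrightarrow> (J, J) \<in> Gpairs I r"
  and Hpairs_refl: "J \<in> fsets I r \<Longrightarrow> (J, J) \<in> Hpairs I r"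
  by (auto intro: GpairsI HpairsI)

lemma Gpairs_trans: "(J, K) \<in> Gpairs I r \<Longrightarrow> (K, L) \<in> Gpairs I r \<Longrightarrow> (J, L) \<in> Gpairs I r"
  unfolding Gpairs_def by blast

lemma Hpairs_trans: "(J, K) \<in> Hpairs I r \<Longrightarrow> (K, L) \<in> Hpairs I r \<Longrightarrow> (J, L) \<in> Hpairs I r"
  unfolding Hpairs_def by blast

lemma fsets_Int: "J \<in> fsets I r \<Longrightarrow> K \<in> fsets I r \<Longrightarrow> J \<inter> K \<in> fsets I r"
  unfolding fsets_def by blast

lemma Gpairs_Diff:
  assumes "(J, K) \<in> Gpairs I r"
  shows "(K, K - J) \<in> Hpairs I r"
proof -
  note G = GpairsD[OF assms]
  have "K - J \<in> fsets I r"
  proof (rule fsetsI)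
    fix h i j assume h: "h \<in> K - J" "j \<in> K - J" "i \<in> I" "(h, i) \<in> r" "(i, j) \<in> r"
    then have "i \<in> K" using fsetsD(2)[OF G(2), of h j i] by blast
    moreover have "i \<notin> J" using G(4)[of i h] h by blast
    ultimately show "i \<in> K - J" by blast
  qed (use fsetsD(1)[OF G(2)] in blast)
  then show ?thesis using G(2,4) by (intro HpairsI) auto
qed

lemma Hpairs_Diff:
  assumes "(J, K) \<in> Hpairs I r"
  shows "(J - K, J) \<in> Gpairs I r"
proof -
  note H = HpairsD[OF assms]
  have "J - K \<in> fsets I r"
  proof (rule fsetsI)
    fix h i j assume h: "h \<in> J - K" "j \<in> J - K" "i \<in> I" "(h, i) \<in> r" "(i, j) \<in> r"
    then have "i \<in> J" using fsetsD(2)[OF H(1), of h j i] by blast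
    moreover have "i \<notin> K" using H(4)[of j i] h by blast
    ultimately show "i \<in> J - K" by blast
  qed (use fsetsD(1)[OF H(1)] in blast)
  then show ?thesis using H(1,4) by (intro GpairsI) auto
qed

lemma GHpairs_Int:
  assumes "(J, K) \<in> Gpairs I r" "(K, L) \<in> Hpairs I r"
  shows "(J \<inter> L, L) \<in> Gpairs I r" "(J, J \<inter> L) \<in> Hpairs I r"
  using GpairsD[OF assms(1)] HpairsD[OF assms(2)]
  by (auto intro!: GpairsI HpairsI fsets_Int)

lemma fsets_sub: "J \<in> fsets I r \<Longrightarrow> fsets J r = {F \<in> fsets I r. F \<subseteq> J}"
  unfolding fsets_def by blast

lemma Gpairs_sub: "J \<in> fsets I r \<Longrightarrow> Gpairs J r = {(A, B). (A, B) \<in> Gpairs I r \<and> B \<subseteq> J}"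
  unfolding Gpairs_def fsets_sub by auto

lemma Hpairs_sub: "J \<in> fsets I r \<Longrightarrow> Hpairs J r = {(A, B). (A, B) \<in> Hpairs I r \<and> A \<subseteq> J}"
  unfolding Hpairs_def fsets_sub by auto

lemma fsets_Restr: "fsets I (r \<inter> I \<times> I) = fsets I r"
  unfolding fsets_def by blast

lemma Gpairs_Restr: "Gpairs I (r \<inter> I \<times> I) = Gpairs I r"
  unfolding Gpairs_def fsets_Restr using fsetsD(1)[of _ I r] by (auto, meson subsetD)

lemma Hpairs_Restr: "Hpairs I (r \<inter> I \<times> I) = Hpairs I r"
  unfolding Hpairs_def fsets_Restr using fsetsD(1)[of _ I r] by (auto, meson subsetD)

lemma fsets_cong: "r \<inter> I \<times> I = s \<inter> I \<times> I \<Longrightarrow> fsets I r = fsets I s"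
  using fsets_Restr[of I r] fsets_Restr[of I s] by simp

lemma Gpairs_cong: "r \<inter> I \<times> I = s \<inter> I \<times> I \<Longrightarrow> Gpairs I r = Gpairs I s"
  using Gpairs_Restr[of I r] Gpairs_Restr[of I s] by simp

lemma Hpairs_cong: "r \<inter> I \<times> I = s \<inter> I \<times> I \<Longrightarrow> Hpairs I r = Hpairs I s"
  using Hpairs_Restr[of I r] Hpairs_Restr[of I s] by simp

text \<open>The maps on f-sets along which configurations are pulled back: the inclusion
  of the f-sets of an f-set, and preimages under a monotone map.\<close>

definition fset_map :: "('b set \<Rightarrow> 'a set) \<Rightarrow> 'b set \<Rightarrow> 'b rel \<Rightarrow> 'a set \<Rightarrow> 'a rel \<Rightarrow> bool" where
  "fset_map P K s I r \<longleftrightarrow> (\<forall>A \<in> fsets K s. P A \<in> fsets I r) \<and>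
     (\<forall>A B. (A, B) \<in> Gpairs K s \<longrightarrow> (P A, P B) \<in> Gpairs I r) \<and>
     (\<forall>A B. (A, B) \<in> Hpairs K s \<longrightarrow> (P A, P B) \<in> Hpairs I r) \<and>
     P {} = {} \<and> (\<forall>A B. P (A \<inter> B) = P A \<inter> P B) \<and> (\<forall>A B. P (A - B) = P A - P B)"

lemma fset_mapD:
  assumes "fset_map P K s I r"
  shows "A \<in> fsets K s \<Longrightarrow> P A \<in> fsets I r" "(A, B) \<in> Gpairs K s \<Longrightarrow> (P A, P B) \<in> Gpairs I r"
    "(A, B) \<in> Hpairs K s \<Longrightarrow> (P A, P B) \<in> Hpairs I r"
    "P {} = {}" "P (A \<inter> B) = P A \<inter> P B" "P (A - B) = P A - P B"
  using assms unfolding fset_map_def by auto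

lemma fset_map_sub: "J \<in> fsets I r \<Longrightarrow> fset_map (\<lambda>A. A) J r I r"
  unfolding fset_map_def by (auto simp: fsets_sub Gpairs_sub Hpairs_sub)

lemma fset_map_vimage:
  assumes "\<phi> ` I \<subseteq> K" and m: "\<And>i j. i \<in> I \<Longrightarrow> j \<in> I \<Longrightarrow> (i, j) \<in> r \<Longrightarrow> (\<phi> i, \<phi> j) \<in> s"
  shows "fset_map (\<lambda>A. \<phi> -` A \<inter> I) K s I r"
proof -
  have f: "\<phi> -` A \<inter> I \<in> fsets I r" if "A \<in> fsets K s" for A
    using fsetsD[OF that] assms by (intro fsetsI) blast+
  show ?thesis
    unfolding fset_map_def
  proof (intro conjI allI ballI impI)
    show "(\<phi> -` A \<inter> I, \<phi> -` B \<inter> I) \<in> Gpairs I r" if "(A, B) \<in> Gpairs K s" for A B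
      using GpairsD[OF that] m f by (intro GpairsI) blast+
    show "(\<phi> -` A \<inter> I, \<phi> -` B \<inter> I) \<in> Hpairs I r" if "(A, B) \<in> Hpairs K s" for A B
      using HpairsD[OF that] m f by (intro HpairsI) blast+
  qed (use f in auto)
qed


section \<open>Configurations and their morphisms\<close>

lemma configurationD:
  assumes "configuration C S I r c"
  shows "F \<in> fsets I r \<Longrightarrow> cobj c F \<in> S" "cobj c {} = null C"
    "(A, B) \<in> Gpairs I r \<Longrightarrow> cinj c (A, B) \<in> Arr C"
    "(A, B) \<in> Gpairs I r \<Longrightarrow> Dom C (cinj c (A, B)) = cobj c A"
    "(A, B) \<in> Gpairs I r \<Longrightarrow> Cod C (cinj c (A, B)) = cobj c B"
    "(A, B) \<in> Gpairs I r \<Longrightarrow> mono_arr C (cinj c (A, B))"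
    "F \<in> fsets I r \<Longrightarrow> cinj c (F, F) = Ident C (cobj c F)"
    "(A, B) \<in> Hpairs I r \<Longrightarrow> csurj c (A, B) \<in> Arr C"
    "(A, B) \<in> Hpairs I r \<Longrightarrow> Dom C (csurj c (A, B)) = cobj c A"
    "(A, B) \<in> Hpairs I r \<Longrightarrow> Cod C (csurj c (A, B)) = cobj c B"
    "(A, B) \<in> Hpairs I r \<Longrightarrow> epi_arr C (csurj c (A, B))"
    "F \<in> fsets I r \<Longrightarrow> csurj c (F, F) = Ident C (cobj c F)"
    "(A, B) \<in> Gpairs I r \<Longrightarrow> short_exact C (cinj c (A, B)) (csurj c (B, B - A))"
  using assms unfolding configuration_def exact_sequence_in_def Hom_def by blast+

lemma configuration_ext:
  assumes "configuration C S I r c"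
  shows "cobj c \<in> extensional (fsets I r)" "cinj c \<in> extensional (Gpairs I r)"
    "csurj c \<in> extensional (Hpairs I r)"
proof -
  have "cobj c \<in> fsets I r \<rightarrow>\<^sub>E S"
    using assms unfolding configuration_def by (elim conjE)
  then show "cobj c \<in> extensional (fsets I r)" by (simp add: PiE_def)
  show "cinj c \<in> extensional (Gpairs I r)"
    using assms unfolding configuration_def by (elim conjE)
  show "csurj c \<in> extensional (Hpairs I r)"
    using assms unfolding configuration_def by (elim conjE)
qed

lemma configurationB:
  assumes "configuration C S I r c" "(J, K) \<in> Gpairs I r" "(K, L) \<in> Gpairs I r"
  shows "cinj c (K, L) \<cdot>\<^bsub>C\<^esub> cinj c (J, K) = cinj c (J, L)"
proof -
  have "\<forall>J K L. (J, K) \<in> Gpairs I r \<and> (K, L) \<in> Gpairs I r \<longrightarrow>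
      cinj c (J, L) = cinj c (K, L) \<cdot>\<^bsub>C\<^esub> cinj c (J, K)"
    using assms(1) unfolding configuration_def by (elim conjE)
  from this[rule_format, OF conjI[OF assms(2,3)]] show ?thesis by (rule sym)
qed

lemma configurationC:
  assumes "configuration C S I r c" "(J, K) \<in> Hpairs I r" "(K, L) \<in> Hpairs I r"
  shows "csurj c (K, L) \<cdot>\<^bsub>C\<^esub> csurj c (J, K) = csurj c (J, L)"
proof -
  have "\<forall>J K L. (J, K) \<in> Hpairs I r \<and> (K, L) \<in> Hpairs I r \<longrightarrow>
      csurj c (J, L) = csurj c (K, L) \<cdot>\<^bsub>C\<^esub> csurj c (J, K)"
    using assms(1) unfolding configuration_def by (elim conjE)
  from this[rule_format, OF conjI[OF assms(2,3)]] show ?thesis by (rule sym)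
qed

lemma configurationD':
  assumes "configuration C S I r c" "(J, K) \<in> Gpairs I r" "(K, L) \<in> Hpairs I r"
  shows "csurj c (K, L) \<cdot>\<^bsub>C\<^esub> cinj c (J, K) = cinj c (J \<inter> L, L) \<cdot>\<^bsub>C\<^esub> csurj c (J, J \<inter> L)"
proof -
  have "\<forall>J K L. (J, K) \<in> Gpairs I r \<and> (K, L) \<in> Hpairs I r \<longrightarrow>
      csurj c (K, L) \<cdot>\<^bsub>C\<^esub> cinj c (J, K) = cinj c (J \<inter> L, L) \<cdot>\<^bsub>C\<^esub> csurj c (J, J \<inter> L)"
    using assms(1) unfolding configuration_def by (elim conjE)
  from this[rule_format, OF conjI[OF assms(2,3)]] show ?thesis .
qed

lemma configurationI:
  assumes "cobj c \<in> extensional (fsets I r)" "cinj c \<in> extensional (Gpairs I r)"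
    "csurj c \<in> extensional (Hpairs I r)"
    and "\<And>F. F \<in> fsets I r \<Longrightarrow> cobj c F \<in> S" "cobj c {} = null C"
    and "\<And>A B. (A, B) \<in> Gpairs I r \<Longrightarrow> cinj c (A, B) \<in> Hom C (cobj c A) (cobj c B)"
    and "\<And>A B. (A, B) \<in> Hpairs I r \<Longrightarrow> csurj c (A, B) \<in> Hom C (cobj c A) (cobj c B)"
    and "\<And>A B. (A, B) \<in> Gpairs I r \<Longrightarrow> mono_arr C (cinj c (A, B))"
    and "\<And>A B. (A, B) \<in> Hpairs I r \<Longrightarrow> epi_arr C (csurj c (A, B))"
    and "\<And>F. F \<in> fsets I r \<Longrightarrow> cinj c (F, F) = Ident C (cobj c F)"
    and "\<And>F. F \<in> fsets I r \<Longrightarrow> csurj c (F, F) = Ident C (cobj c F)"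
    and "\<And>A B. (A, B) \<in> Gpairs I r \<Longrightarrow> short_exact C (cinj c (A, B)) (csurj c (B, B - A))"
    and "\<And>J K L. (J, K) \<in> Gpairs I r \<Longrightarrow> (K, L) \<in> Gpairs I r \<Longrightarrow>
      cinj c (K, L) \<cdot>\<^bsub>C\<^esub> cinj c (J, K) = cinj c (J, L)"
    and "\<And>J K L. (J, K) \<in> Hpairs I r \<Longrightarrow> (K, L) \<in> Hpairs I r \<Longrightarrow>
      csurj c (K, L) \<cdot>\<^bsub>C\<^esub> csurj c (J, K) = csurj c (J, L)"
    and "\<And>J K L. (J, K) \<in> Gpairs I r \<Longrightarrow> (K, L) \<in> Hpairs I r \<Longrightarrow>
      csurj c (K, L) \<cdot>\<^bsub>C\<^esub> cinj c (J, K) = cinj c (J \<inter> L, L) \<cdot>\<^bsub>C\<^esub> csurj c (J, J \<inter> L)"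
  shows "configuration C S I r c"
proof -
  have "exact_sequence_in C S (cinj c (A, B)) (csurj c (B, B - A))" if g: "(A, B) \<in> Gpairs I r" for A B
    using assms(4)[OF GpairsD(1)[OF g]] assms(4)[OF GpairsD(2)[OF g]] assms(12)[OF g] HomD[OF assms(6)[OF g]]
      HomD[OF assms(7)[OF Gpairs_Diff[OF g]]] assms(4)[OF HpairsD(2)[OF Gpairs_Diff[OF g]]]
    unfolding exact_sequence_in_def by simp
  then show ?thesis
    unfolding configuration_def using assms by (simp add: PiE_def Pi_def Ball_def split_paired_All)
qed

lemma configuration_cong:
  "r \<inter> I \<times> I = s \<inter> I \<times> I \<Longrightarrow> configuration C S I r = configuration C S I s"
  unfolding configuration_def fun_eq_iff by (simp only: fsets_cong[of r I s] Gpairs_cong[of r I s] Hpairs_cong[of r I s] simp_thms)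

lemma config_morphismD:
  assumes "config_morphism C I r c c' \<alpha>"
  shows "\<alpha> \<in> extensional (fsets I r)" "F \<in> fsets I r \<Longrightarrow> \<alpha> F \<in> Arr C"
    "F \<in> fsets I r \<Longrightarrow> Dom C (\<alpha> F) = cobj c F" "F \<in> fsets I r \<Longrightarrow> Cod C (\<alpha> F) = cobj c' F"
    "(A, B) \<in> Gpairs I r \<Longrightarrow> \<alpha> B \<cdot>\<^bsub>C\<^esub> cinj c (A, B) = cinj c' (A, B) \<cdot>\<^bsub>C\<^esub> \<alpha> A"
    "(A, B) \<in> Hpairs I r \<Longrightarrow> \<alpha> B \<cdot>\<^bsub>C\<^esub> csurj c (A, B) = csurj c' (A, B) \<cdot>\<^bsub>C\<^esub> \<alpha> A"
  using assms unfolding config_morphism_def Hom_def by blast+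

lemma config_morphismI:
  assumes "\<alpha> \<in> extensional (fsets I r)" "\<And>F. F \<in> fsets I r \<Longrightarrow> \<alpha> F \<in> Hom C (cobj c F) (cobj c' F)"
    "\<And>A B. (A, B) \<in> Gpairs I r \<Longrightarrow> \<alpha> B \<cdot>\<^bsub>C\<^esub> cinj c (A, B) = cinj c' (A, B) \<cdot>\<^bsub>C\<^esub> \<alpha> A"
    "\<And>A B. (A, B) \<in> Hpairs I r \<Longrightarrow> \<alpha> B \<cdot>\<^bsub>C\<^esub> csurj c (A, B) = csurj c' (A, B) \<cdot>\<^bsub>C\<^esub> \<alpha> A"
  shows "config_morphism C I r c c' \<alpha>"
  using assms unfolding config_morphism_def by blast

lemma config_isoD:
  assumes "config_iso C I r c c' \<alpha>"
  shows "config_morphism C I r c c' \<alpha>" "F \<in> fsets I r \<Longrightarrow> iso_arr C (\<alpha> F)"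
  using assms unfolding config_iso_def by blast+

lemma config_iso_cong:
  "r \<inter> I \<times> I = s \<inter> I \<times> I \<Longrightarrow> config_iso C I r = config_iso C I s"
  unfolding config_iso_def config_morphism_def fun_eq_iff
  by (simp only: fsets_cong[of r I s] Gpairs_cong[of r I s] Hpairs_cong[of r I s] simp_thms)

text \<open>Subconfigurations and quotient configurations are both obtained by composition with a map
  of f-sets, so that their functoriality can be treated once.\<close>

definition reindex :: "('b set \<Rightarrow> 'a set) \<Rightarrow> 'b set \<Rightarrow> 'b rel \<Rightarrow> ('a, 'o, 'm) config \<Rightarrow>
    ('b, 'o, 'm) config" where
  "reindex P K s c =
     \<lparr>cobj = (\<lambda>A \<in> fsets K s. cobj c (P A)),
      cinj = (\<lambda>(A, B) \<in> Gpairs K s. cinj c (P A, P B)),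
      csurj = (\<lambda>(A, B) \<in> Hpairs K s. csurj c (P A, P B))\<rparr>"

definition reindex_map :: "('b set \<Rightarrow> 'a set) \<Rightarrow> 'b set \<Rightarrow> 'b rel \<Rightarrow> ('a set \<Rightarrow> 'm) \<Rightarrow> 'b set \<Rightarrow> 'm" where
  "reindex_map P K s \<alpha> = (\<lambda>A \<in> fsets K s. \<alpha> (P A))"

lemma subconfig_reindex: "subconfig J r = reindex (\<lambda>A. A) J r"
  by (auto simp: subconfig_def reindex_def fun_eq_iff restrict_def)

lemma quotconfig_reindex: "quotconfig I \<phi> K s = reindex (\<lambda>A. \<phi> -` A \<inter> I) K s"
  by (auto simp: quotconfig_def reindex_def fun_eq_iff)

lemma subconfig_map_reindex: "subconfig_map J r = reindex_map (\<lambda>A. A) J r"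
  by (auto simp: subconfig_map_def reindex_map_def fun_eq_iff)

lemma quotconfig_map_reindex: "quotconfig_map I \<phi> K s = reindex_map (\<lambda>A. \<phi> -` A \<inter> I) K s"
  by (auto simp: quotconfig_map_def reindex_map_def fun_eq_iff)

lemma reindex_simps [simp]:
  "A \<in> fsets K s \<Longrightarrow> cobj (reindex P K s c) A = cobj c (P A)"
  "(A, B) \<in> Gpairs K s \<Longrightarrow> cinj (reindex P K s c) (A, B) = cinj c (P A, P B)"
  "(A, B) \<in> Hpairs K s \<Longrightarrow> csurj (reindex P K s c) (A, B) = csurj c (P A, P B)"
  "A \<in> fsets K s \<Longrightarrow> reindex_map P K s \<alpha> A = \<alpha> (P A)"
  by (auto simp: reindex_def reindex_map_def)

lemma reindex_extensional [simp]:
  "cobj (reindex P K s c) \<in> extensional (fsets K s)" "cinj (reindex P K s c) \<in> extensional (Gpairs K s)"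
  "csurj (reindex P K s c) \<in> extensional (Hpairs K s)" "reindex_map P K s \<alpha> \<in> extensional (fsets K s)"
  by (simp_all add: reindex_def reindex_map_def)

lemma reindex_cong:
  assumes "\<And>A. A \<in> fsets K s \<Longrightarrow> P A = Q A"
  shows "reindex P K s = reindex Q K s" "reindex_map P K s = reindex_map Q K s"
proof -
  have 1: "P A = Q A \<and> P B = Q B" if "(A, B) \<in> Gpairs K s" for A B
    using assms GpairsD[OF that] by blast
  have 2: "P A = Q A \<and> P B = Q B" if "(A, B) \<in> Hpairs K s" for A B
    using assms HpairsD[OF that] by blast
  show "reindex P K s = reindex Q K s"
    unfolding reindex_def fun_eq_iff using assms 1 2 by (auto simp: fun_eq_iff restrict_def)
  show "reindex_map P K s = reindex_map Q K s"
    unfolding reindex_map_def fun_eq_iff using assms by (auto simp: restrict_def)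
qed

lemma reindex_rel_cong:
  assumes "s \<inter> K \<times> K = t \<inter> K \<times> K"
  shows "reindex P K s = reindex P K t" "reindex_map P K s = reindex_map P K t"
  unfolding reindex_def reindex_map_def fun_eq_iff
  by (simp_all only: fsets_cong[OF assms] Gpairs_cong[OF assms] Hpairs_cong[OF assms] simp_thms)

lemma reindex_reindex:
  assumes "fset_map P L t K s"
  shows "reindex P L t (reindex Q K s c) = reindex (\<lambda>A. Q (P A)) L t c"
    "reindex_map P L t (reindex_map Q K s \<alpha>) = reindex_map (\<lambda>A. Q (P A)) L t \<alpha>"
proof -
  show "reindex P L t (reindex Q K s c) = reindex (\<lambda>A. Q (P A)) L t c"
    unfolding reindex_def[of P] reindex_def[of "\<lambda>A. Q (P A)"]
    using fset_mapD[OF assms] by (auto simp: fun_eq_iff restrict_def)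
  show "reindex_map P L t (reindex_map Q K s \<alpha>) = reindex_map (\<lambda>A. Q (P A)) L t \<alpha>"
    unfolding reindex_map_def[of P] reindex_map_def[of "\<lambda>A. Q (P A)"]
    using fset_mapD[OF assms] by (auto simp: fun_eq_iff restrict_def)
qed

lemma configuration_reindex:
  assumes c: "configuration C S I r c" and P: "fset_map P K s I r"
  shows "configuration C S K s (reindex P K s c)"
proof (rule configurationI)
  show "cobj (reindex P K s c) {} = null C"
    using configurationD(2)[OF c] fset_mapD(4)[OF P] by simp
  show "cinj (reindex P K s c) (A, B) \<in> Hom C (cobj (reindex P K s c) A) (cobj (reindex P K s c) B)"
    "mono_arr C (cinj (reindex P K s c) (A, B))"
    "short_exact C (cinj (reindex P K s c) (A, B)) (csurj (reindex P K s c) (B, B - A))"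
    if "(A, B) \<in> Gpairs K s" for A B
    using GpairsD[OF that] fset_mapD[OF P] configurationD[OF c] that Gpairs_Diff[OF that]
    by (simp_all add: Hom_def)
  show "csurj (reindex P K s c) (A, B) \<in> Hom C (cobj (reindex P K s c) A) (cobj (reindex P K s c) B)"
    "epi_arr C (csurj (reindex P K s c) (A, B))"
    if "(A, B) \<in> Hpairs K s" for A B
    using HpairsD[OF that] fset_mapD[OF P] configurationD[OF c] that by (simp_all add: Hom_def)
  show "cobj (reindex P K s c) F \<in> S"
    "cinj (reindex P K s c) (F, F) = Ident C (cobj (reindex P K s c) F)"
    "csurj (reindex P K s c) (F, F) = Ident C (cobj (reindex P K s c) F)" if "F \<in> fsets K s" for F
    using that fset_mapD[OF P] configurationD[OF c] by (simp_all add: Gpairs_refl Hpairs_refl)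
  show "cinj (reindex P K s c) (B, D) \<cdot>\<^bsub>C\<^esub> cinj (reindex P K s c) (A, B) = cinj (reindex P K s c) (A, D)"
    if "(A, B) \<in> Gpairs K s" "(B, D) \<in> Gpairs K s" for A B D
    using that Gpairs_trans[OF that] fset_mapD[OF P] configurationB[OF c] by simp
  show "csurj (reindex P K s c) (B, D) \<cdot>\<^bsub>C\<^esub> csurj (reindex P K s c) (A, B) = csurj (reindex P K s c) (A, D)"
    if "(A, B) \<in> Hpairs K s" "(B, D) \<in> Hpairs K s" for A B D
    using that Hpairs_trans[OF that] fset_mapD[OF P] configurationC[OF c] by simp
  show "csurj (reindex P K s c) (B, D) \<cdot>\<^bsub>C\<^esub> cinj (reindex P K s c) (A, B) =
      cinj (reindex P K s c) (A \<inter> D, D) \<cdot>\<^bsub>C\<^esub> csurj (reindex P K s c) (A, A \<inter> D)"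
    if "(A, B) \<in> Gpairs K s" "(B, D) \<in> Hpairs K s" for A B D
    using that GHpairs_Int[OF that] fset_mapD[OF P] configurationD'[OF c, of "P A" "P B" "P D"] by simp
qed simp_all

lemma config_morphism_reindex:
  assumes \<alpha>: "config_morphism C I r c d \<alpha>" and P: "fset_map P K s I r"
  shows "config_morphism C K s (reindex P K s c) (reindex P K s d) (reindex_map P K s \<alpha>)"
proof (rule config_morphismI)
  show "reindex_map P K s \<alpha> F \<in> Hom C (cobj (reindex P K s c) F) (cobj (reindex P K s d) F)"
    if "F \<in> fsets K s" for F
    using that config_morphismD[OF \<alpha>] fset_mapD[OF P] by (simp add: Hom_def)
  show "reindex_map P K s \<alpha> B \<cdot>\<^bsub>C\<^esub> cinj (reindex P K s c) (A, B) =
      cinj (reindex P K s d) (A, B) \<cdot>\<^bsub>C\<^esub> reindex_map P K s \<alpha> A" if "(A, B) \<in> Gpairs K s" for A B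
    using that GpairsD[OF that] config_morphismD[OF \<alpha>] fset_mapD[OF P] by simp
  show "reindex_map P K s \<alpha> B \<cdot>\<^bsub>C\<^esub> csurj (reindex P K s c) (A, B) =
      csurj (reindex P K s d) (A, B) \<cdot>\<^bsub>C\<^esub> reindex_map P K s \<alpha> A" if "(A, B) \<in> Hpairs K s" for A B
    using that HpairsD[OF that] config_morphismD[OF \<alpha>] fset_mapD[OF P] by simp
qed simp

lemma config_iso_reindex:
  assumes \<alpha>: "config_iso C I r c d \<alpha>" and P: "fset_map P K s I r"
  shows "config_iso C K s (reindex P K s c) (reindex P K s d) (reindex_map P K s \<alpha>)"
  unfolding config_iso_def
  using config_morphism_reindex[OF config_isoD(1)[OF \<alpha>] P] config_isoD(2)[OF \<alpha>] fset_mapD[OF P] by simp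

lemma reindex_map_Comp:
  "fset_map P K s I r \<Longrightarrow> reindex_map P K s (config_Comp C I r \<beta> \<alpha>) =
    config_Comp C K s (reindex_map P K s \<beta>) (reindex_map P K s \<alpha>)"
  using fset_mapD(1)[of P K s I r]
  by (auto simp: fun_eq_iff reindex_map_def config_Comp_def restrict_def)

lemma reindex_map_Id:
  "fset_map P K s I r \<Longrightarrow> reindex_map P K s (config_Id C I r c) = config_Id C K s (reindex P K s c)"
  using fset_mapD(1)[of P K s I r]
  by (auto simp: fun_eq_iff reindex_map_def config_Id_def restrict_def reindex_def)

context exact_category
begin

lemma config_Obj [simp]: "configuration C S I r c \<Longrightarrow> F \<in> fsets I r \<Longrightarrow> cobj c F \<in> Obj C"
  using configurationD(1) S_Obj by blast

lemma config_morphism_Comp: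
  assumes c: "configuration C S I r c" "configuration C S I r d" "configuration C S I r e"
    and \<alpha>: "config_morphism C I r c d \<alpha>" and \<beta>: "config_morphism C I r d e \<beta>"
  shows "config_morphism C I r c e (config_Comp C I r \<beta> \<alpha>)"
proof (rule config_morphismI)
  note a = config_morphismD[OF \<alpha>] and b = config_morphismD[OF \<beta>]
  note c1 = configurationD[OF c(1)] and c2 = configurationD[OF c(2)] and c3 = configurationD[OF c(3)]
  show "config_Comp C I r \<beta> \<alpha> F \<in> Hom C (cobj c F) (cobj e F)" if "F \<in> fsets I r" for F
    using that a b by (simp add: config_Comp_def Hom_def)
  show "config_Comp C I r \<beta> \<alpha> B \<cdot> cinj c (A, B) = cinj e (A, B) \<cdot> config_Comp C I r \<beta> \<alpha> A"
    if AB: "(A, B) \<in> Gpairs I r" for A B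
  proof -
    note f = GpairsD(1,2)[OF AB]
    have "cinj e (A, B) \<cdot> \<beta> A \<cdot> \<alpha> A = (\<beta> B \<cdot> \<alpha> B) \<cdot> cinj c (A, B)"
      by (rule square_paste[OF a(5)[OF AB, symmetric] b(5)[OF AB, symmetric]]) (use AB f a(2-4) b(2-4) c1 c2 c3 in auto)
    then show ?thesis using f by (simp add: config_Comp_def)
  qed
  show "config_Comp C I r \<beta> \<alpha> B \<cdot> csurj c (A, B) = csurj e (A, B) \<cdot> config_Comp C I r \<beta> \<alpha> A"
    if AB: "(A, B) \<in> Hpairs I r" for A B
  proof -
    note f = HpairsD(1,2)[OF AB]
    have "csurj e (A, B) \<cdot> \<beta> A \<cdot> \<alpha> A = (\<beta> B \<cdot> \<alpha> B) \<cdot> csurj c (A, B)"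
      by (rule square_paste[OF a(6)[OF AB, symmetric] b(6)[OF AB, symmetric]]) (use AB f a(2-4) b(2-4) c1 c2 c3 in auto)
    then show ?thesis using f by (simp add: config_Comp_def)
  qed
qed (simp add: config_Comp_def)

lemma config_iso_Comp:
  assumes c: "configuration C S I r c" "configuration C S I r d" "configuration C S I r e"
    and \<alpha>: "config_iso C I r c d \<alpha>" and \<beta>: "config_iso C I r d e \<beta>"
  shows "config_iso C I r c e (config_Comp C I r \<beta> \<alpha>)"
  unfolding config_iso_def
proof (intro conjI ballI)
  note a = config_isoD[OF \<alpha>] and b = config_isoD[OF \<beta>]
  show "config_morphism C I r c e (config_Comp C I r \<beta> \<alpha>)" by (rule config_morphism_Comp[OF c a(1) b(1)])
  show "iso_arr C (config_Comp C I r \<beta> \<alpha> F)" if "F \<in> fsets I r" for F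
    using that a(2) b(2) iso_Comp[of "\<alpha> F" "\<beta> F"] config_morphismD[OF a(1)] config_morphismD[OF b(1)]
    by (simp add: config_Comp_def)
qed

lemma config_iso_Id:
  assumes c: "configuration C S I r c"
  shows "config_iso C I r c c (config_Id C I r c)"
proof -
  note d = configurationD[OF c]
  have "config_morphism C I r c c (config_Id C I r c)"
  proof (rule config_morphismI)
    show "config_Id C I r c F \<in> Hom C (cobj c F) (cobj c F)" if "F \<in> fsets I r" for F
      using that config_Obj[OF c] by (simp add: config_Id_def Hom_def)
    show "config_Id C I r c B \<cdot> cinj c (A, B) = cinj c (A, B) \<cdot> config_Id C I r c A"
      if "(A, B) \<in> Gpairs I r" for A B using that GpairsD[OF that] d by (simp add: config_Id_def)
    show "config_Id C I r c B \<cdot> csurj c (A, B) = csurj c (A, B) \<cdot> config_Id C I r c A"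
      if "(A, B) \<in> Hpairs I r" for A B using that HpairsD[OF that] d by (simp add: config_Id_def)
  qed (simp add: config_Id_def)
  then show ?thesis
    using iso_Ident config_Obj[OF c] by (simp add: config_iso_def config_Id_def)
qed

definition config_inv :: "'i set \<Rightarrow> 'i rel \<Rightarrow> ('i set \<Rightarrow> 'b) \<Rightarrow> 'i set \<Rightarrow> 'b" where
  "config_inv I r \<alpha> = (\<lambda>F \<in> fsets I r. inv_arr (\<alpha> F))"

lemma inv_arr_square:
  assumes "iso_arr C a" "iso_arr C b" "f \<in> Arr C" "g \<in> Arr C" "Dom C f = Dom C a" "Cod C f = Dom C b"
    "Dom C g = Cod C a" "Cod C g = Cod C b" "b \<cdot> f = g \<cdot> a"
  shows "inv_arr b \<cdot> g = f \<cdot> inv_arr a"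
proof -
  note A = iso_Arr[OF assms(1)] iso_Arr[OF assms(2)]
  have "inv_arr b \<cdot> g = inv_arr b \<cdot> g \<cdot> a \<cdot> inv_arr a" using A assms(1-8) by simp
  also have "\<dots> = inv_arr b \<cdot> (b \<cdot> f) \<cdot> inv_arr a" unfolding assms(9) using A assms(1-8) by simp
  also have "\<dots> = f \<cdot> inv_arr a" using A assms(1-8) by simp
  finally show ?thesis .
qed

lemma config_iso_inv:
  assumes c: "configuration C S I r c" "configuration C S I r d" and \<alpha>: "config_iso C I r c d \<alpha>"
  shows "config_iso C I r d c (config_inv I r \<alpha>)"
    "config_Comp C I r (config_inv I r \<alpha>) \<alpha> = config_Id C I r c"
    "config_Comp C I r \<alpha> (config_inv I r \<alpha>) = config_Id C I r d"
proof -
  note a = config_isoD(2)[OF \<alpha>] config_morphismD[OF config_isoD(1)[OF \<alpha>]]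
  note c1 = configurationD[OF c(1)] and c2 = configurationD[OF c(2)]
  have "config_morphism C I r d c (config_inv I r \<alpha>)"
  proof (rule config_morphismI)
    show "config_inv I r \<alpha> F \<in> Hom C (cobj d F) (cobj c F)" if "F \<in> fsets I r" for F
      using that a by (simp add: config_inv_def Hom_def)
    show "config_inv I r \<alpha> B \<cdot> cinj d (A, B) = cinj c (A, B) \<cdot> config_inv I r \<alpha> A"
      if AB: "(A, B) \<in> Gpairs I r" for A B
      using GpairsD[OF AB] AB a c1 c2 inv_arr_square[of "\<alpha> A" "\<alpha> B" "cinj c (A, B)" "cinj d (A, B)"]
      by (simp add: config_inv_def)
    show "config_inv I r \<alpha> B \<cdot> csurj d (A, B) = csurj c (A, B) \<cdot> config_inv I r \<alpha> A"
      if AB: "(A, B) \<in> Hpairs I r" for A B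
      using HpairsD[OF AB] AB a c1 c2 inv_arr_square[of "\<alpha> A" "\<alpha> B" "csurj c (A, B)" "csurj d (A, B)"]
      by (simp add: config_inv_def)
  qed (simp add: config_inv_def)
  then show "config_iso C I r d c (config_inv I r \<alpha>)"
    using a iso_inv_arr by (simp add: config_iso_def config_inv_def)
  show "config_Comp C I r (config_inv I r \<alpha>) \<alpha> = config_Id C I r c"
    "config_Comp C I r \<alpha> (config_inv I r \<alpha>) = config_Id C I r d"
    using a by (auto simp: config_Comp_def config_inv_def config_Id_def fun_eq_iff restrict_def)
qed

lemma config_Comp_assoc:
  assumes "config_morphism C I r c d \<alpha>" "config_morphism C I r d e \<beta>" "config_morphism C I r e f \<gamma>"
  shows "config_Comp C I r (config_Comp C I r \<gamma> \<beta>) \<alpha> = config_Comp C I r \<gamma> (config_Comp C I r \<beta> \<alpha>)"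
  using config_morphismD[OF assms(1)] config_morphismD[OF assms(2)] config_morphismD[OF assms(3)]
  by (auto simp: config_Comp_def fun_eq_iff restrict_def)

lemma config_Comp_Id:
  assumes "config_morphism C I r c d \<alpha>"
  shows "config_Comp C I r \<alpha> (config_Id C I r c) = \<alpha>" "config_Comp C I r (config_Id C I r d) \<alpha> = \<alpha>"
proof -
  note a = config_morphismD[OF assms]
  show "config_Comp C I r \<alpha> (config_Id C I r c) = \<alpha>" "config_Comp C I r (config_Id C I r d) \<alpha> = \<alpha>"
    using a(2-4) extensional_arb[OF a(1)] by (auto simp: config_Comp_def config_Id_def fun_eq_iff restrict_def)
qed

text \<open>A configuration isomorphic to \<open>c\<close> is determined by the isomorphism, because its
  \<open>\<iota>\<close> and \<open>\<pi>\<close> are the conjugates of those of \<open>c\<close>.\<close>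

lemma config_iso_target_unique:
  assumes d: "configuration C S I r d" "configuration C S I r d'"
    and i: "config_iso C I r c d \<theta>" "config_iso C I r c d' \<theta>"
  shows "d = d'"
proof -
  note m = config_morphismD[OF config_isoD(1)[OF i(1)]] and m' = config_morphismD[OF config_isoD(1)[OF i(2)]]
  note c1 = configurationD[OF d(1)] and c2 = configurationD[OF d(2)]
  note e = configuration_ext[OF d(1)] and e' = configuration_ext[OF d(2)]
  have o: "cobj d F = cobj d' F" if "F \<in> fsets I r" for F using m(4) m'(4) that by metis
  have "cobj d = cobj d'" by (rule extensionalityI[OF e(1) e'(1) o])
  moreover have "cinj d = cinj d'"
  proof (rule extensionalityI[OF e(2) e'(2)], safe)
    fix A B assume AB: "(A, B) \<in> Gpairs I r"
    note f = GpairsD(1,2)[OF AB]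
    have "cinj d (A, B) \<cdot> \<theta> A = cinj d' (A, B) \<cdot> \<theta> A" using m(5)[OF AB] m'(5)[OF AB] by simp
    then show "cinj d (A, B) = cinj d' (A, B)"
      by - (rule epi_arrD[OF iso_epi[OF config_isoD(2)[OF i(1) f(1)]]]; use AB f c1 c2 m o in simp)
  qed
  moreover have "csurj d = csurj d'"
  proof (rule extensionalityI[OF e(3) e'(3)], safe)
    fix A B assume AB: "(A, B) \<in> Hpairs I r"
    note f = HpairsD(1,2)[OF AB]
    have "csurj d (A, B) \<cdot> \<theta> A = csurj d' (A, B) \<cdot> \<theta> A" using m(6)[OF AB] m'(6)[OF AB] by simp
    then show "csurj d (A, B) = csurj d' (A, B)"
      by - (rule epi_arrD[OF iso_epi[OF config_isoD(2)[OF i(1) f(1)]]]; use AB f c1 c2 m o in simp)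
  qed
  ultimately show ?thesis by simp
qed

lemma short_exact_iso:
  assumes fg: "short_exact C f g" and a: "iso_arr C a" "iso_arr C b" "iso_arr C c"
    and d: "Dom C a = Dom C f" "Dom C b = Cod C f" "Dom C c = Cod C g"
  shows "short_exact C (b \<cdot> f \<cdot> inv_arr a) (c \<cdot> g \<cdot> inv_arr b)"
proof -
  note F = short_exactD[OF fg] and A = iso_Arr[OF a(1)] iso_Arr[OF a(2)] iso_Arr[OF a(3)]
  have mono: "mono_arr C (b \<cdot> f \<cdot> inv_arr a)"
    using F A d a mono_Comp[OF mono_Comp[OF iso_mono[OF iso_inv_arr[OF a(1)]] F(5)] iso_mono[OF a(2)]]
    by simp
  have epi: "epi_arr C (c \<cdot> g \<cdot> inv_arr b)"
    unfolding epi_arr_def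
  proof (intro conjI allI ballI impI)
    fix Z h k assume h: "h \<in> Hom C (Cod C (c \<cdot> g \<cdot> inv_arr b)) Z"
      and k: "k \<in> Hom C (Cod C (c \<cdot> g \<cdot> inv_arr b)) Z" and e: "h \<cdot> c \<cdot> g \<cdot> inv_arr b = k \<cdot> c \<cdot> g \<cdot> inv_arr b"
    note H = HomD[OF h] HomD[OF k]
    have "(h \<cdot> c \<cdot> g \<cdot> inv_arr b) \<cdot> b = (k \<cdot> c \<cdot> g \<cdot> inv_arr b) \<cdot> b" using e by simp
    then have "(h \<cdot> c) \<cdot> g = (k \<cdot> c) \<cdot> g" using H A F a d by simp
    then have "h \<cdot> c = k \<cdot> c" by - (rule epi_arrD[OF F(6)]; use H A F a d in simp)
    then show "h = k" by - (rule epi_arrD[OF iso_epi[OF a(3)]]; use H A F a d in simp)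
  qed (use F A d a in auto)
  have "is_cokernel C (c \<cdot> g \<cdot> inv_arr b) (b \<cdot> f \<cdot> inv_arr a)"
  proof (rule is_cokernelI[OF mono_Arr[OF mono] epi])
    have "(c \<cdot> g \<cdot> inv_arr b) \<cdot> (b \<cdot> f \<cdot> inv_arr a) = c \<cdot> (g \<cdot> f) \<cdot> inv_arr a"
      using F(1-3) A d a by simp
    then show "(c \<cdot> g \<cdot> inv_arr b) \<cdot> (b \<cdot> f \<cdot> inv_arr a) =
        Zero C (Dom C (b \<cdot> f \<cdot> inv_arr a)) (Cod C (c \<cdot> g \<cdot> inv_arr b))"
      using F A d a by simp
    fix w assume w: "w \<in> Arr C" "Dom C w = Cod C (b \<cdot> f \<cdot> inv_arr a)"
      "w \<cdot> b \<cdot> f \<cdot> inv_arr a = Zero C (Dom C (b \<cdot> f \<cdot> inv_arr a)) (Cod C w)"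
    have wd: "Dom C w = Cod C b" using w F A d a by simp
    have "(w \<cdot> b) \<cdot> f = (w \<cdot> b \<cdot> f \<cdot> inv_arr a) \<cdot> a" using w(1) wd F A d a by simp
    also have "\<dots> = Zero C (Dom C f) (Cod C (w \<cdot> b))" unfolding w(3) using w(1) wd F A d a by simp
    finally obtain h where h: "h \<in> Arr C" "Dom C h = Cod C g" "Cod C h = Cod C w" "h \<cdot> g = w \<cdot> b"
      using cokernel_factor[OF F(8), of "w \<cdot> b"] w(1) wd F A d a by auto
    have "(h \<cdot> inv_arr c) \<cdot> c \<cdot> g \<cdot> inv_arr b = (h \<cdot> g) \<cdot> inv_arr b" using h(1-3) F A d a by simp
    also have "\<dots> = w" unfolding h(4) using w(1) wd A a by simp
    finally show "\<exists>h. h \<in> Arr C \<and> Dom C h = Cod C (c \<cdot> g \<cdot> inv_arr b) \<and> Cod C h = Cod C w \<and>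
        h \<cdot> c \<cdot> g \<cdot> inv_arr b = w"
      using h F A d a by (intro exI[of _ "h \<cdot> inv_arr c"]) auto
  qed (use F A d a in auto)
  then show ?thesis by (rule short_exactI[OF mono])
qed

text \<open>The \<open>\<iota>\<close> and \<open>\<pi>\<close> of \<open>d\<close> are the conjugates of those of \<open>c\<close>. A configuration that agrees with given
  data only up to isomorphism can in this way be made to agree with them exactly.\<close>

lemma config_transport:
  assumes c: "configuration C S I r c" and ext: "\<theta> \<in> extensional (fsets I r)"
    and \<theta>: "\<And>F. F \<in> fsets I r \<Longrightarrow> iso_arr C (\<theta> F)" "\<And>F. F \<in> fsets I r \<Longrightarrow> Dom C (\<theta> F) = cobj c F"
      "\<And>F. F \<in> fsets I r \<Longrightarrow> Cod C (\<theta> F) \<in> S"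
    and null: "Cod C (\<theta> {}) = null C"
  shows "\<exists>d. configuration C S I r d \<and> config_iso C I r c d \<theta>"
proof -
  note c1 = configurationD[OF c]
  have \<theta>A: "\<theta> F \<in> Arr C" if "F \<in> fsets I r" for F by (rule iso_Arr[OF \<theta>(1)[OF that]])
  define d where "d = \<lparr>cobj = (\<lambda>F \<in> fsets I r. Cod C (\<theta> F)),
      cinj = (\<lambda>(A, B) \<in> Gpairs I r. \<theta> B \<cdot> cinj c (A, B) \<cdot> inv_arr (\<theta> A)),
      csurj = (\<lambda>(A, B) \<in> Hpairs I r. \<theta> B \<cdot> csurj c (A, B) \<cdot> inv_arr (\<theta> A))\<rparr>"
  have co: "cobj d F = Cod C (\<theta> F)" if "F \<in> fsets I r" for F using that by (simp add: d_def)
  have ci: "cinj d (A, B) = \<theta> B \<cdot> cinj c (A, B) \<cdot> inv_arr (\<theta> A)" if "(A, B) \<in> Gpairs I r" for A B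
    using that by (simp add: d_def)
  have cs: "csurj d (A, B) = \<theta> B \<cdot> csurj c (A, B) \<cdot> inv_arr (\<theta> A)" if "(A, B) \<in> Hpairs I r" for A B
    using that by (simp add: d_def)
  have se: "short_exact C (cinj d (A, B)) (csurj d (B, B - A))" if AB: "(A, B) \<in> Gpairs I r" for A B
    using short_exact_iso[OF c1(13)[OF AB], of "\<theta> A" "\<theta> B" "\<theta> (B - A)"] AB GpairsD[OF AB] c1 \<theta>
      Gpairs_Diff[OF AB] HpairsD[OF Gpairs_Diff[OF AB]] by (simp add: ci cs)
  have se': "short_exact C (cinj d (A - B, A)) (csurj d (A, B))" if AB: "(A, B) \<in> Hpairs I r" for A B
  proof -
    have "A - (A - B) = B" using HpairsD[OF AB] by blast
    then show ?thesis using se[OF Hpairs_Diff[OF AB]] by simp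
  qed
  have "configuration C S I r d"
  proof (rule configurationI)
    show "cinj d (A, B) \<in> Hom C (cobj d A) (cobj d B)" "mono_arr C (cinj d (A, B))"
      if "(A, B) \<in> Gpairs I r" for A B
      using that GpairsD[OF that] c1 \<theta> \<theta>A short_exactD[OF se[OF that]] by (simp_all add: ci co Hom_def)
    show "csurj d (A, B) \<in> Hom C (cobj d A) (cobj d B)" "epi_arr C (csurj d (A, B))"
      if "(A, B) \<in> Hpairs I r" for A B
      using that HpairsD[OF that] c1 \<theta> \<theta>A short_exactD[OF se'[OF that]] by (simp_all add: cs co Hom_def)
    show "cinj d (F, F) = Ident C (cobj d F)" "csurj d (F, F) = Ident C (cobj d F)" if "F \<in> fsets I r" for F
      using that c1 \<theta> \<theta>A by (simp_all add: ci cs co Gpairs_refl Hpairs_refl)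
    show "cinj d (B, D) \<cdot> cinj d (A, B) = cinj d (A, D)"
      if G: "(A, B) \<in> Gpairs I r" "(B, D) \<in> Gpairs I r" for A B D
    proof -
      have "cinj d (B, D) \<cdot> cinj d (A, B) = \<theta> D \<cdot> (cinj c (B, D) \<cdot> cinj c (A, B)) \<cdot> inv_arr (\<theta> A)"
        using G GpairsD[OF G(1)] GpairsD[OF G(2)] c1 \<theta> \<theta>A by (simp add: ci)
      then show ?thesis using configurationB[OF c G] Gpairs_trans[OF G] by (simp add: ci)
    qed
    show "csurj d (B, D) \<cdot> csurj d (A, B) = csurj d (A, D)"
      if G: "(A, B) \<in> Hpairs I r" "(B, D) \<in> Hpairs I r" for A B D
    proof -
      have "csurj d (B, D) \<cdot> csurj d (A, B) = \<theta> D \<cdot> (csurj c (B, D) \<cdot> csurj c (A, B)) \<cdot> inv_arr (\<theta> A)"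
        using G HpairsD[OF G(1)] HpairsD[OF G(2)] c1 \<theta> \<theta>A by (simp add: cs)
      then show ?thesis using configurationC[OF c G] Hpairs_trans[OF G] by (simp add: cs)
    qed
    show "csurj d (B, D) \<cdot> cinj d (A, B) = cinj d (A \<inter> D, D) \<cdot> csurj d (A, A \<inter> D)"
      if G: "(A, B) \<in> Gpairs I r" "(B, D) \<in> Hpairs I r" for A B D
    proof -
      note G' = GHpairs_Int[OF G]
      have "csurj d (B, D) \<cdot> cinj d (A, B) = \<theta> D \<cdot> (csurj c (B, D) \<cdot> cinj c (A, B)) \<cdot> inv_arr (\<theta> A)"
        using G GpairsD[OF G(1)] HpairsD[OF G(2)] c1 \<theta> \<theta>A by (simp add: ci cs)
      also have "\<dots> = \<theta> D \<cdot> (cinj c (A \<inter> D, D) \<cdot> csurj c (A, A \<inter> D)) \<cdot> inv_arr (\<theta> A)"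
        by (simp only: configurationD'[OF c G])
      also have "\<dots> = cinj d (A \<inter> D, D) \<cdot> csurj d (A, A \<inter> D)"
        using G' GpairsD[OF G'(1)] HpairsD[OF G'(2)] c1 \<theta> \<theta>A by (simp add: ci cs)
      finally show ?thesis .
    qed
    show "cobj d F \<in> S" if "F \<in> fsets I r" for F using that \<theta> by (simp add: co)
  qed (use null se in \<open>auto simp: d_def\<close>)
  moreover have "config_morphism C I r c d \<theta>"
  proof (rule config_morphismI[OF ext])
    show "\<theta> F \<in> Hom C (cobj c F) (cobj d F)" if "F \<in> fsets I r" for F
      using that \<theta> \<theta>A by (simp add: co Hom_def)
    show "\<theta> B \<cdot> cinj c (A, B) = cinj d (A, B) \<cdot> \<theta> A" if AB: "(A, B) \<in> Gpairs I r" for A B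
      using AB GpairsD[OF AB] c1 \<theta> \<theta>A by (simp add: ci)
    show "\<theta> B \<cdot> csurj c (A, B) = csurj d (A, B) \<cdot> \<theta> A" if AB: "(A, B) \<in> Hpairs I r" for A B
      using AB HpairsD[OF AB] c1 \<theta> \<theta>A by (simp add: cs)
  qed
  ultimately show ?thesis using \<theta>(1) by (auto simp: config_iso_def)
qed

end

section \<open>Adding a maximal element to a poset\<close>

text \<open>The relation may be defined on more than \<open>I\<close>, so that it need not be changed when \<open>I\<close> is
  replaced by a subset.\<close>

locale top_point =
  fixes I :: "'i set" and r :: "'i rel" and k :: 'i
  assumes r_refl: "\<And>i. i \<in> I \<Longrightarrow> (i, i) \<in> r" and trans_r: "trans r" and point: "k \<in> I"
    and top: "\<And>i. i \<in> I \<Longrightarrow> (k, i) \<in> r \<Longrightarrow> i = k"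
begin

definition "J = I - {k}"
definition "N = {i \<in> J. (i, k) \<in> r}"
definition "M = insert k N"

lemma r_trans: "(x, y) \<in> r \<Longrightarrow> (y, z) \<in> r \<Longrightarrow> (x, z) \<in> r"
  using trans_r by (rule transD)

lemma M_eq: "M = {i \<in> I. (i, k) \<in> r}" and N_eq: "N = {i \<in> I. (i, k) \<in> r} - {k}"
  using point r_refl by (auto simp: M_def N_def J_def)

lemma J_fset: "J \<in> fsets I r"
  using top by (intro fsetsI) (auto simp: J_def)

lemma fsets_J: "fsets J r = {F \<in> fsets I r. k \<notin> F}"
  using fsetsD(1) unfolding fsets_sub[OF J_fset] by (auto simp: J_def)

lemma Gpairs_J: "(A, B) \<in> Gpairs J r \<longleftrightarrow> (A, B) \<in> Gpairs I r \<and> k \<notin> B"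
  using GpairsD(2)[of A B I r] fsetsD(1)[of B I r] unfolding Gpairs_sub[OF J_fset] by (auto simp: J_def)

lemma Hpairs_J: "(A, B) \<in> Hpairs J r \<longleftrightarrow> (A, B) \<in> Hpairs I r \<and> k \<notin> A"
  using HpairsD(1)[of A B I r] fsetsD(1)[of A I r] unfolding Hpairs_sub[OF J_fset] by (auto simp: J_def)

lemma cut_Gpair: assumes "F \<in> fsets I r" shows "(F - {k}, F) \<in> Gpairs I r"
proof -
  have "F - {k} = F \<inter> J" using fsetsD(1)[OF assms] by (auto simp: J_def)
  then have "F - {k} \<in> fsets I r" using fsets_Int[OF assms J_fset] by simp
  then show ?thesis using assms top fsetsD(1)[OF assms] by (intro GpairsI) auto
qed

lemma cut_fset: "F \<in> fsets I r \<Longrightarrow> F - {k} \<in> fsets I r" "F \<in> fsets I r \<Longrightarrow> F - {k} \<in> fsets J r"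
  using GpairsD(1)[OF cut_Gpair] by (auto simp: fsets_J)

lemma cut_Gpairs: assumes "(F, G) \<in> Gpairs I r" shows "(F - {k}, G - {k}) \<in> Gpairs J r"
  using GpairsD[OF assms] cut_fset by (auto intro!: GpairsI)

lemma cut_Hpairs: assumes "(F, G) \<in> Hpairs I r" shows "(F - {k}, G - {k}) \<in> Hpairs J r"
  using HpairsD[OF assms] cut_fset by (auto intro!: HpairsI)

lemma M_fset: "M \<in> fsets I r"
  unfolding M_eq using r_trans by (intro fsetsI) auto

lemma M_cut: "M - {k} = N" "k \<in> M" "k \<notin> N"
  using M_eq N_eq by (auto simp: M_def)

lemma N_fset: "N \<in> fsets J r"
  using cut_fset(2)[OF M_fset] by (simp add: M_cut)

lemma NM_Gpair: "(N, M) \<in> Gpairs I r"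
  using cut_Gpair[OF M_fset] by (simp add: M_cut)

text \<open>By convexity of \<open>F\<close>, elements of \<open>M\<close> above an element of \<open>F\<close> are in \<open>F\<close>, since they lie below
  \<open>k\<close>; and \<open>M\<close> is closed downwards. So there is a map \<open>\<sigma>(M) \<rightarrow> \<sigma>(M \<inter> F) \<rightarrow> \<sigma>(F)\<close>.\<close>

lemma M_Int:
  assumes F: "F \<in> fsets I r" "k \<in> F"
  shows "(M, M \<inter> F) \<in> Hpairs I r" "(M \<inter> F, F) \<in> Gpairs I r"
    "(N, N \<inter> F) \<in> Hpairs J r" "(N \<inter> F, F - {k}) \<in> Gpairs J r"
proof -
  show H: "(M, M \<inter> F) \<in> Hpairs I r"
    using M_fset fsets_Int[OF M_fset F(1)] F
    by (intro HpairsI) (auto simp: M_eq intro: fsetsD(2)[OF F(1) _ F(2)])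
  show G: "(M \<inter> F, F) \<in> Gpairs I r"
    using fsets_Int[OF M_fset F(1)] F fsetsD(1)[OF F(1)] r_trans by (intro GpairsI) (auto simp: M_eq)
  have "M \<inter> F - {k} = N \<inter> F" using M_cut by auto
  then show "(N, N \<inter> F) \<in> Hpairs J r" "(N \<inter> F, F - {k}) \<in> Gpairs J r"
    using cut_Hpairs[OF H] cut_Gpairs[OF G] by (simp_all add: M_cut)
qed

lemma M_Int_Gpairs: "(F, G) \<in> Gpairs I r \<Longrightarrow> k \<in> F \<Longrightarrow> M \<inter> G = M \<inter> F"
  using GpairsD[of F G I r] by (auto simp: M_eq)

lemma M_Int_Hpairs: "(F, G) \<in> Hpairs I r \<Longrightarrow> k \<in> F \<Longrightarrow> k \<notin> G \<Longrightarrow> M \<inter> G = {}"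
  using HpairsD[of F G I r] by (auto simp: M_eq)

end

locale exact_top_point = exact_category C S + top_point I r k
  for C :: "('o, 'm) cat" (structure) and S :: "'o set" and I :: "'i set" and r k
begin

definition inc :: "('i, 'o, 'm) config \<Rightarrow> 'i set \<Rightarrow> 'm" where
  "inc c F = cinj c (F - {k}, F)"

text \<open>With \<open>inc\<close> one of the two maps into the pushout. The value \<open>0\<close> in case \<open>k \<notin> F\<close> makes \<open>\<pi>\<close>
  commute with \<open>leg\<close> also when it forgets \<open>k\<close>.\<close>

definition leg :: "('i, 'o, 'm) config \<Rightarrow> 'i set \<Rightarrow> 'm" where
  "leg c F = (if k \<in> F then cinj c (M \<inter> F, F) \<cdot> csurj c (M, M \<inter> F) else Zero C (cobj c M) (cobj c F))"

context
  fixes c :: "('i, 'o, 'm) config"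
  assumes c: "configuration C S I r c"
begin

lemma cobj_Obj: "F \<in> fsets I r \<Longrightarrow> cobj c F \<in> Obj C"
  by (rule config_Obj[OF c])

lemma inc_Arr:
  assumes "F \<in> fsets I r"
  shows "inc c F \<in> Arr C" "Dom C (inc c F) = cobj c (F - {k})" "Cod C (inc c F) = cobj c F"
  using configurationD[OF c] cut_Gpair[OF assms] by (auto simp: inc_def)

lemma inc_Ident: "F \<in> fsets I r \<Longrightarrow> k \<notin> F \<Longrightarrow> inc c F = Ident C (cobj c F)"
  using configurationD(7)[OF c] by (simp add: inc_def)

lemma leg_Arr:
  assumes "F \<in> fsets I r"
  shows "leg c F \<in> Arr C" "Dom C (leg c F) = cobj c M" "Cod C (leg c F) = cobj c F"
  using configurationD[OF c] M_Int[OF assms] cobj_Obj assms M_fset by (auto simp: leg_def)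

lemma leg_M: "leg c M = Ident C (cobj c M)"
  using configurationD[OF c] M_fset cobj_Obj by (simp add: leg_def M_cut)

lemma inj_inc:
  assumes FG: "(F, G) \<in> Gpairs I r"
  shows "cinj c (F, G) \<cdot> inc c F = inc c G \<cdot> cinj c (F - {k}, G - {k})"
proof -
  have "(F - {k}, G - {k}) \<in> Gpairs I r" using cut_Gpairs[OF FG] Gpairs_J by simp
  then show ?thesis
    using configurationB[OF c cut_Gpair[OF GpairsD(1)[OF FG]] FG]
      configurationB[OF c _ cut_Gpair[OF GpairsD(2)[OF FG]], of "F - {k}"] by (simp add: inc_def)
qed

lemma surj_inc:
  assumes FG: "(F, G) \<in> Hpairs I r"
  shows "csurj c (F, G) \<cdot> inc c F = inc c G \<cdot> csurj c (F - {k}, G - {k})"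
proof -
  have "(F - {k}) \<inter> G = G - {k}" using HpairsD(3)[OF FG] by auto
  then show ?thesis
    using configurationD'[OF c cut_Gpair[OF HpairsD(1)[OF FG]] FG] by (simp add: inc_def)
qed

lemma inj_leg:
  assumes FG: "(F, G) \<in> Gpairs I r" and k: "k \<in> F"
  shows "cinj c (F, G) \<cdot> leg c F = leg c G"
proof -
  note f = GpairsD(1-3)[OF FG]
  note e = M_Int_Gpairs[OF FG k] and m = M_Int[OF f(1) k]
  have kG: "k \<in> G" using f k by auto
  have "cinj c (F, G) \<cdot> cinj c (M \<inter> F, F) = cinj c (M \<inter> F, G)" by (rule configurationB[OF c m(2) FG])
  then show ?thesis
    using m k kG FG configurationD[OF c] by (simp add: leg_def e Comp_eq)
qed

text \<open>An upper part \<open>G\<close> of \<open>F\<close> without \<open>k\<close> has no element below \<open>k\<close>; in that case axiom (D) factors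
  the composite through \<open>\<sigma>(\<emptyset>) = 0\<close>.\<close>

lemma surj_leg:
  assumes FG: "(F, G) \<in> Hpairs I r" and k: "k \<in> F"
  shows "csurj c (F, G) \<cdot> leg c F = leg c G"
proof -
  note f = HpairsD(1-3)[OF FG] and d = configurationD[OF c]
  note m = M_Int[OF f(1) k]
  have e: "M \<inter> F \<inter> G = M \<inter> G" using f by auto
  note G = GHpairs_Int[OF m(2) FG, unfolded e]
  have "csurj c (F, G) \<cdot> leg c F = (csurj c (F, G) \<cdot> cinj c (M \<inter> F, F)) \<cdot> csurj c (M, M \<inter> F)"
    using m k FG d by (simp add: leg_def)
  also have "\<dots> = cinj c (M \<inter> G, G) \<cdot> csurj c (M \<inter> F, M \<inter> G) \<cdot> csurj c (M, M \<inter> F)"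
    unfolding configurationD'[OF c m(2) FG, unfolded e] using m G d by simp
  also have "\<dots> = cinj c (M \<inter> G, G) \<cdot> csurj c (M, M \<inter> G)"
    by (simp only: configurationC[OF c m(1) G(2)])
  also have "\<dots> = leg c G"
  proof (cases "k \<in> G")
    case False
    have M0: "M \<inter> G = {}" by (rule M_Int_Hpairs[OF FG k False])
    have H0: "(M, {}) \<in> Hpairs I r" using Hpairs_trans[OF m(1) G(2)] M0 by simp
    have G0: "({}, G) \<in> Gpairs I r" using G(1) M0 by simp
    have "csurj c (M, {}) = Zero C (cobj c M) (null C)"
      using to_null[of "csurj c (M, {})"] d H0 by simp
    then show ?thesis
      using d H0 G0 cobj_Obj[OF M_fset] False M0 by (simp add: leg_def)
  qed (simp add: leg_def)
  finally show ?thesis .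
qed

text \<open>Both rows of the square below have the cokernel \<open>\<sigma>({k})\<close>.\<close>

lemma inc_leg_pushout:
  assumes F: "F \<in> fsets I r" "k \<in> F"
  shows "pushout C (cinj c (N, M)) (cinj c (N \<inter> F, F - {k}) \<cdot> csurj c (N, N \<inter> F)) (inc c F) (leg c F)"
proof (rule pushout_of_same_cokernel)
  note d = configurationD[OF c] and m = M_Int[OF F] and H = Hpairs_J and G = Gpairs_J
  have m3: "(N, N \<inter> F) \<in> Hpairs I r" "(N \<inter> F, F - {k}) \<in> Gpairs I r" using m H G by auto
  have MN: "M - N = {k}" using M_cut by (auto simp: M_def)
  show "short_exact C (cinj c (N, M)) (csurj c (M, {k}))" using d(13)[OF NM_Gpair] by (simp add: MN)
  have Fk: "F - (F - {k}) = {k}" using F by auto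
  show "short_exact C (inc c F) (csurj c (F, {k}))" using d(13)[OF cut_Gpair[OF F(1)]] by (simp add: Fk inc_def)
  have Hk: "(F, {k}) \<in> Hpairs I r" using Gpairs_Diff[OF cut_Gpair[OF F(1)]] by (simp add: Fk)
  have Mk: "(M, {k}) \<in> Hpairs I r" using Gpairs_Diff[OF NM_Gpair] by (simp add: MN)
  have "M \<inter> {k} = {k}" using M_cut by auto
  then have "leg c {k} = csurj c (M, {k})"
    using d Mk HpairsD(2)[OF Mk] by (simp add: leg_def)
  then show "csurj c (F, {k}) \<cdot> leg c F = csurj c (M, {k})" using surj_leg[OF Hk F(2)] by simp
  show "inc c F \<cdot> cinj c (N \<inter> F, F - {k}) \<cdot> csurj c (N, N \<inter> F) = leg c F \<cdot> cinj c (N, M)"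
  proof -
    have e: "N \<inter> (M \<inter> F) = N \<inter> F" by (auto simp: M_def)
    have NF: "(N \<inter> F, M \<inter> F) \<in> Gpairs I r"
      using GHpairs_Int(1)[OF NM_Gpair m(1)] by (simp add: e)
    have "leg c F \<cdot> cinj c (N, M) = cinj c (M \<inter> F, F) \<cdot> csurj c (M, M \<inter> F) \<cdot> cinj c (N, M)"
      using d m NM_Gpair F by (simp add: leg_def)
    also have "\<dots> = cinj c (M \<inter> F, F) \<cdot> cinj c (N \<inter> F, M \<inter> F) \<cdot> csurj c (N, N \<inter> F)"
      by (simp only: configurationD'[OF c NM_Gpair m(1)] e)
    also have "\<dots> = cinj c (N \<inter> F, F) \<cdot> csurj c (N, N \<inter> F)"
      using Comp_eq[OF configurationB[OF c NF m(2)]] d NF m m3 by simp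
    also have "\<dots> = inc c F \<cdot> cinj c (N \<inter> F, F - {k}) \<cdot> csurj c (N, N \<inter> F)"
      using Comp_eq[OF configurationB[OF c m3(2) cut_Gpair[OF F(1)]]] d m3 cut_Gpair[OF F(1)]
      by (simp add: inc_def)
    finally show ?thesis by simp
  qed
qed (use F M_Int[OF F] Hpairs_J Gpairs_J NM_Gpair configurationD[OF c] inc_Arr[OF F(1)] leg_Arr[OF F(1)] in auto)

lemma inc_leg_joint_epi:
  assumes F: "F \<in> fsets I r" and h: "h \<in> Arr C" "h' \<in> Arr C" "Dom C h = cobj c F" "Dom C h' = cobj c F"
    "Cod C h = Cod C h'" and "h \<cdot> inc c F = h' \<cdot> inc c F" "k \<in> F \<Longrightarrow> h \<cdot> leg c F = h' \<cdot> leg c F"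
  shows "h = h'"
proof (cases "k \<in> F")
  case True
  show ?thesis
    by (rule pushout_joint_epi[OF inc_leg_pushout[OF F True]]) (use assms True inc_Arr[OF F] in auto)
next
  case False
  then show ?thesis using assms inc_Ident[OF F False] by simp
qed

end

text \<open>Existence and uniqueness come from the pushout property of \<open>\<sigma>(F)\<close> in the source; the
  squares commute because they do so after composition with the two maps into the pushout.\<close>

theorem ex1_extend_morphism:
  assumes c: "configuration C S I r c" and d: "configuration C S I r d"
    and b: "config_morphism C J r (subconfig J r c) (subconfig J r d) b"
    and e: "e \<in> Hom C (cobj c M) (cobj d M)" and eb: "e \<cdot> cinj c (N, M) = cinj d (N, M) \<cdot> b N"
  shows "\<exists>!\<eta>. config_morphism C I r c d \<eta> \<and> subconfig_map J r \<eta> = b \<and> \<eta> M = e"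
proof -
  note cd = configurationD[OF c] and dd = configurationD[OF d]
  note eA = HomD[OF e]
  have bF: "b F \<in> Arr C" "Dom C (b F) = cobj c F" "Cod C (b F) = cobj d F" if "F \<in> fsets J r" for F
    using config_morphismD[OF b] that by (auto simp: subconfig_reindex)
  have bG: "b B \<cdot> cinj c (A, B) = cinj d (A, B) \<cdot> b A" if "(A, B) \<in> Gpairs J r" for A B
    using config_morphismD(5)[OF b] that by (auto simp: subconfig_reindex)
  have bH: "b B \<cdot> csurj c (A, B) = csurj d (A, B) \<cdot> b A" if "(A, B) \<in> Hpairs J r" for A B
    using config_morphismD(6)[OF b] that by (auto simp: subconfig_reindex)
  define P where "P F h \<longleftrightarrow> h \<in> Arr C \<and> Dom C h = cobj c F \<and> Cod C h = cobj d F \<and>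
      h \<cdot> inc c F = inc d F \<cdot> b (F - {k}) \<and> h \<cdot> leg c F = leg d F \<cdot> e" for F h
  have PD: "h \<in> Arr C" "Dom C h = cobj c F" "Cod C h = cobj d F"
      "h \<cdot> inc c F = inc d F \<cdot> b (F - {k})" "h \<cdot> leg c F = leg d F \<cdot> e" if "P F h" for F h
    using that by (auto simp: P_def)
  have P_unique: "h = h'" if "F \<in> fsets I r" "P F h" "P F h'" for F h h'
    by (rule inc_leg_joint_epi[OF c that(1)]) (use PD[OF that(2)] PD[OF that(3)] in auto)
  have P_ex: "\<exists>h. P F h" if F: "F \<in> fsets I r" for F
  proof (cases "k \<in> F")
    case True
    note m = M_Int[OF F True]
    have mI: "(N, N \<inter> F) \<in> Hpairs I r" "(N \<inter> F, F - {k}) \<in> Gpairs I r" using m Hpairs_J Gpairs_J by auto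
    note bb = bF[OF cut_fset(2)[OF F]] bF[OF N_fset] bF[OF GpairsD(1)[OF m(4)]]
    define vc where "vc = cinj c (N \<inter> F, F - {k}) \<cdot> csurj c (N, N \<inter> F)"
    define vd where "vd = cinj d (N \<inter> F, F - {k}) \<cdot> csurj d (N, N \<inter> F)"
    have v: "b (F - {k}) \<cdot> vc = vd \<cdot> b N"
      unfolding vc_def vd_def
      by (rule square_paste[OF bH[OF m(3)] bG[OF m(4)]]) (use bb cd dd mI in auto)
    note poc = inc_leg_pushout[OF c F True, folded vc_def] and pod = inc_leg_pushout[OF d F True, folded vd_def]
    note pc = pushoutD[OF poc] and pd = pushoutD[OF pod]
    note A = inc_Arr[OF c F] inc_Arr[OF d F] leg_Arr[OF c F] leg_Arr[OF d F] NM_Gpair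
    have vA: "Dom C vc = cobj c N" "Cod C vc = cobj c (F - {k})" "Dom C vd = cobj d N" "Cod C vd = cobj d (F - {k})"
      using cd dd mI by (auto simp: vc_def vd_def)
    have "(inc d F \<cdot> b (F - {k})) \<cdot> vc = inc d F \<cdot> vd \<cdot> b N" using bb A pc vA v by simp
    also have "\<dots> = (leg d F \<cdot> cinj d (N, M)) \<cdot> b N"
      using Comp_eq[OF pd(9)] bb A pd vA dd by simp
    also have "\<dots> = leg d F \<cdot> cinj d (N, M) \<cdot> b N" using bb A dd by simp
    also have "\<dots> = (leg d F \<cdot> e) \<cdot> cinj c (N, M)" using eb[symmetric] A dd cd eA by simp
    finally have eq: "(inc d F \<cdot> b (F - {k})) \<cdot> vc = (leg d F \<cdot> e) \<cdot> cinj c (N, M)" .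
    obtain h where "h \<in> Arr C" "Dom C h = Cod C (inc c F)" "Cod C h = Cod C (inc d F \<cdot> b (F - {k}))"
      "h \<cdot> inc c F = inc d F \<cdot> b (F - {k})" "h \<cdot> leg c F = leg d F \<cdot> e"
      by (rule pushout_factor[OF poc _ _ _ _ _ eq]) (use A eA bb vA cd in auto)
    then have "P F h" using A bb by (simp add: P_def)
    then show ?thesis ..
  next
    case False
    have FJ: "F \<in> fsets J r" using F False by (simp add: fsets_J)
    have "P F (b F)"
      using bF[OF FJ] False inc_Ident[OF c F False] inc_Ident[OF d F False] eA cobj_Obj[OF c] cobj_Obj[OF d] F M_fset
      by (simp add: P_def leg_def)
    then show ?thesis ..
  qed
  define \<eta> where "\<eta> = (\<lambda>F \<in> fsets I r. SOME h. P F h)"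
  have \<eta>P: "P F (\<eta> F)" if "F \<in> fsets I r" for F
    using someI_ex[OF P_ex[OF that]] that by (simp add: \<eta>_def)
  note \<eta>D = PD[OF \<eta>P]
  have mor: "config_morphism C I r c d \<eta>"
  proof (rule config_morphismI)
    show "\<eta> F \<in> Hom C (cobj c F) (cobj d F)" if "F \<in> fsets I r" for F
      using \<eta>D[OF that] by (simp add: Hom_def)
    have square: "\<eta> B \<cdot> x = y \<cdot> \<eta> A"
      if f: "A \<in> fsets I r" "B \<in> fsets I r"
        and x: "x \<in> Hom C (cobj c A) (cobj c B)" "x' \<in> Hom C (cobj c (A - {k})) (cobj c (B - {k}))"
        and y: "y \<in> Hom C (cobj d A) (cobj d B)" "y' \<in> Hom C (cobj d (A - {k})) (cobj d (B - {k}))"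
        and i: "x \<cdot> inc c A = inc c B \<cdot> x'" "y \<cdot> inc d A = inc d B \<cdot> y'"
        and b': "b (B - {k}) \<cdot> x' = y' \<cdot> b (A - {k})"
        and l: "k \<in> A \<Longrightarrow> x \<cdot> leg c A = leg c B" "k \<in> A \<Longrightarrow> y \<cdot> leg d A = leg d B" for A B x x' y y'
    proof -
      note X = \<eta>D(1-3)[OF f(1)] \<eta>D(1-3)[OF f(2)] bF[OF cut_fset(2)[OF f(1)]] bF[OF cut_fset(2)[OF f(2)]]
        inc_Arr[OF c f(1)] inc_Arr[OF d f(1)] inc_Arr[OF c f(2)] inc_Arr[OF d f(2)]
        leg_Arr[OF c f(1)] leg_Arr[OF d f(1)] leg_Arr[OF c f(2)] leg_Arr[OF d f(2)]
        HomD[OF x(1)] HomD[OF x(2)] HomD[OF y(1)] HomD[OF y(2)] eA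
      show ?thesis
      proof (rule inc_leg_joint_epi[OF c f(1)])
        have "(\<eta> B \<cdot> x) \<cdot> inc c A = \<eta> B \<cdot> inc c B \<cdot> x'" using X i(1) by simp
        also have "\<dots> = (inc d B \<cdot> y') \<cdot> b (A - {k})"
          by (rule square_paste[OF b' \<eta>D(4)[OF f(2)]]) (use X in simp_all)
        also have "\<dots> = y \<cdot> inc d A \<cdot> b (A - {k})" unfolding i(2)[symmetric] using X by simp
        also have "\<dots> = (y \<cdot> \<eta> A) \<cdot> inc c A" unfolding \<eta>D(4)[OF f(1), symmetric] using X by simp
        finally show "(\<eta> B \<cdot> x) \<cdot> inc c A = (y \<cdot> \<eta> A) \<cdot> inc c A" .
        assume k: "k \<in> A"
        have "(\<eta> B \<cdot> x) \<cdot> leg c A = \<eta> B \<cdot> leg c B" using X l(1)[OF k] by simp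
        also have "\<dots> = (y \<cdot> leg d A) \<cdot> e" unfolding l(2)[OF k] by (rule \<eta>D(5)[OF f(2)])
        also have "\<dots> = (y \<cdot> \<eta> A) \<cdot> leg c A" using X \<eta>D(5)[OF f(1)] by simp
        finally show "(\<eta> B \<cdot> x) \<cdot> leg c A = (y \<cdot> \<eta> A) \<cdot> leg c A" .
      qed (use X in auto)
    qed
    show "\<eta> B \<cdot> cinj c (A, B) = cinj d (A, B) \<cdot> \<eta> A" if AB: "(A, B) \<in> Gpairs I r" for A B
    proof -
      note g = cut_Gpairs[OF AB]
      have gI: "(A - {k}, B - {k}) \<in> Gpairs I r" using g Gpairs_J by simp
      show ?thesis
        by (rule square[OF GpairsD(1,2)[OF AB] _ _ _ _ inj_inc[OF c AB] inj_inc[OF d AB] bG[OF g]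
            inj_leg[OF c AB] inj_leg[OF d AB]]) (use AB gI cd dd in \<open>auto simp: Hom_def\<close>)
    qed
    show "\<eta> B \<cdot> csurj c (A, B) = csurj d (A, B) \<cdot> \<eta> A" if AB: "(A, B) \<in> Hpairs I r" for A B
    proof -
      note g = cut_Hpairs[OF AB]
      have gI: "(A - {k}, B - {k}) \<in> Hpairs I r" using g Hpairs_J by simp
      show ?thesis
        by (rule square[OF HpairsD(1,2)[OF AB] _ _ _ _ surj_inc[OF c AB] surj_inc[OF d AB] bH[OF g]
            surj_leg[OF c AB] surj_leg[OF d AB]]) (use AB gI cd dd in \<open>auto simp: Hom_def\<close>)
    qed
  qed (simp add: \<eta>_def)
  have \<eta>b: "\<eta> F = b F" if "F \<in> fsets J r" for F
  proof -
    have F: "F \<in> fsets I r" "k \<notin> F" using that by (auto simp: fsets_J)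
    show ?thesis
      using \<eta>D[OF F(1)] F(2) inc_Ident[OF c F] inc_Ident[OF d F] bF[OF that] by simp
  qed
  have "subconfig_map J r \<eta> = b"
    using extensional_arb[OF config_morphismD(1)[OF b]] \<eta>b
    by (auto simp: subconfig_map_def restrict_def fun_eq_iff)
  moreover have "\<eta> M = e"
    using \<eta>D[OF M_fset] leg_M[OF c] leg_M[OF d] eA by simp
  moreover have "\<eta>' = \<eta>" if \<eta>': "config_morphism C I r c d \<eta>'" "subconfig_map J r \<eta>' = b" "\<eta>' M = e" for \<eta>'
  proof (rule extensionalityI[OF config_morphismD(1)[OF \<eta>'(1)] config_morphismD(1)[OF mor]])
    fix F assume F: "F \<in> fsets I r"
    note x = config_morphismD[OF \<eta>'(1)]
    have "b (F - {k}) = \<eta>' (F - {k})"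
      using cut_fset(2)[OF F] by (simp flip: \<eta>'(2) add: subconfig_map_def)
    then have 1: "\<eta>' F \<cdot> inc c F = inc d F \<cdot> b (F - {k})" using x(5)[OF cut_Gpair[OF F]] by (simp add: inc_def)
    have 2: "\<eta>' F \<cdot> leg c F = leg d F \<cdot> e"
    proof (cases "k \<in> F")
      case True
      note m = M_Int[OF F True]
      have "\<eta>' F \<cdot> cinj c (M \<inter> F, F) \<cdot> csurj c (M, M \<inter> F) = (cinj d (M \<inter> F, F) \<cdot> csurj d (M, M \<inter> F)) \<cdot> \<eta>' M"
        by (rule square_paste[OF x(6)[OF m(1)] x(5)[OF m(2)]])
          (use x(2-4) m F M_fset GpairsD(1)[OF m(2)] cd dd in auto)
      then show ?thesis using True by (simp add: leg_def \<eta>'(3))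
    qed (use x(2-4)[OF F] eA cobj_Obj[OF c] cobj_Obj[OF d] F M_fset in \<open>simp add: leg_def\<close>)
    have "P F (\<eta>' F)" using x(2-4)[OF F] 1 2 by (simp add: P_def)
    then show "\<eta>' F = \<eta> F" using P_unique[OF F] \<eta>P[OF F] by blast
  qed
  ultimately show ?thesis using mor by blast
qed

end

subsection \<open>Construction of an extension\<close>

lemma (in category) pushout_along_Ident:
  assumes po: "pushout C f (Ident C X) i u" and X: "X \<in> Obj C"
  shows "iso_arr C u"
proof -
  note p = pushoutD(1,3-8)[OF po]
  have f: "Dom C f = X" "Dom C i = X" using pushoutD(5,7)[OF po] X by auto
  have i: "i = u \<cdot> f" using pushoutD(9)[OF po] p f by simp
  obtain h where h: "h \<in> Arr C" "Dom C h = Cod C i" "Cod C h = Cod C f" "h \<cdot> u = Ident C (Cod C f)"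
    by (rule pushout_factor[OF po, of f "Ident C (Cod C f)"]) (use p(1) f X in auto)
  have hu: "Cod C u = Dom C h" "Dom C u = Cod C f" "u \<in> Arr C" using p h(2) by auto
  have "u \<cdot> h = Ident C (Cod C u)"
  proof (rule pushout_joint_epi[OF po])
    have "u \<cdot> h \<cdot> u \<cdot> f = u \<cdot> f" using Comp_eq[OF h(4)] hu h(1) p(1) by simp
    then show "(u \<cdot> h) \<cdot> i = Ident C (Cod C u) \<cdot> i" unfolding i using hu h(1,3) p(1) by simp
    show "(u \<cdot> h) \<cdot> u = Ident C (Cod C u) \<cdot> u" using hu h(1,3,4) by simp
  qed (use p h(1-3) hu in auto)
  then show ?thesis using hu h by (intro iso_arrI[of u h]) auto
qed

text \<open>A configuration \<open>c'\<close> on \<open>J\<close> is to be extended to \<open>I\<close> by means of a short exact sequence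
  \<open>0 \<rightarrow> \<sigma>'(N) \<rightarrow> E \<rightarrow> Q \<rightarrow> 0\<close> with maps \<open>f\<close> and \<open>g\<close>. The object \<open>Cod C (i F)\<close> will be \<open>\<sigma>(F)\<close>. If
  \<open>k \<in> F\<close> it is a chosen pushout of \<open>f\<close>, with cokernel map \<open>p F\<close>; otherwise the identity and zero
  maps let the same formulas describe \<open>\<iota>\<close> and \<open>\<pi>\<close> in all cases.\<close>

locale point_extension = exact_top_point C S I r k
  for C :: "('o, 'm) cat" (structure) and S :: "'o set" and I :: "'i set" and r k +
  fixes c' :: "('i, 'o, 'm) config" and f g :: 'm and i u p :: "'i set \<Rightarrow> 'm"
  assumes c': "configuration C S J r c'" and fg: "short_exact C f g"
    and Dom_f: "Dom C f = cobj c' N" and Cod_g: "Cod C g \<in> S"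
    and glue: "\<And>F. F \<in> fsets I r \<Longrightarrow> k \<in> F \<Longrightarrow>
      pushout C f (cinj c' (N \<inter> F, F - {k}) \<cdot> csurj c' (N, N \<inter> F)) (i F) (u F) \<and>
      short_exact C (i F) (p F) \<and> Cod C (p F) = Cod C g \<and> p F \<cdot> u F = g"
    and no_glue: "\<And>F. F \<in> fsets I r \<Longrightarrow> k \<notin> F \<Longrightarrow>
      i F = Ident C (cobj c' F) \<and> u F = Zero C (Cod C f) (cobj c' F)"
begin

text \<open>The map along which \<open>f\<close> is pushed out, hence attaching \<open>E\<close> to \<open>\<sigma>'(F - {k})\<close>.\<close>

definition att :: "'i set \<Rightarrow> 'm" where
  "att F = cinj c' (N \<inter> F, F - {k}) \<cdot> csurj c' (N, N \<inter> F)"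

lemmas cD = configurationD[OF c'] and fgD = short_exactD[OF fg]

lemma c'_Obj: "F \<in> fsets J r \<Longrightarrow> cobj c' F \<in> Obj C"
  by (rule config_Obj[OF c'])

lemma att_Arr:
  assumes "F \<in> fsets I r" "k \<in> F"
  shows "att F \<in> Arr C" "Dom C (att F) = cobj c' N" "Cod C (att F) = cobj c' (F - {k})"
  using cD M_Int[OF assms] by (auto simp: att_def)

lemma po: "F \<in> fsets I r \<Longrightarrow> k \<in> F \<Longrightarrow> pushout C f (att F) (i F) (u F)"
  using glue unfolding att_def by blast

lemma pD:
  assumes "F \<in> fsets I r" "k \<in> F"
  shows "short_exact C (i F) (p F)" "Cod C (p F) = Cod C g" "p F \<cdot> u F = g"
  using glue[OF assms] by auto

text \<open>The object \<open>\<sigma>(F)\<close> belongs to the exact category as an extension of \<open>Q\<close> by \<open>\<sigma>'(F - {k})\<close>.\<close>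

lemma iu_Arr:
  assumes F: "F \<in> fsets I r"
  shows "i F \<in> Arr C" "Dom C (i F) = cobj c' (F - {k})" "u F \<in> Arr C" "Dom C (u F) = Cod C f"
    "Cod C (u F) = Cod C (i F)" "Cod C (i F) \<in> Obj C" "Cod C (i F) \<in> S" "mono_arr C (i F)"
proof -
  have "i F \<in> Arr C \<and> Dom C (i F) = cobj c' (F - {k}) \<and> u F \<in> Arr C \<and> Dom C (u F) = Cod C f \<and>
      Cod C (u F) = Cod C (i F) \<and> Cod C (i F) \<in> S \<and> mono_arr C (i F)"
  proof (cases "k \<in> F")
    case True
    note P = pushoutD[OF po[OF F True]] and q = pD[OF F True]
    note Q = short_exactD[OF q(1)]
    have "Dom C (i F) = cobj c' (F - {k})" using P att_Arr[OF F True] by simp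
    moreover have "Cod C (i F) \<in> S"
      using S_extension[OF q(1)] cD(1) cut_fset(2)[OF F] calculation q(2) Cod_g by simp
    ultimately show ?thesis using P Q by simp
  next
    case False
    have FJ: "F \<in> fsets J r" using F False fsets_J by simp
    show ?thesis
      using no_glue[OF F False] c'_Obj[OF FJ] cD(1)[OF FJ] fgD False
      by (simp add: iso_mono iso_Ident)
  qed
  then show "i F \<in> Arr C" "Dom C (i F) = cobj c' (F - {k})" "u F \<in> Arr C" "Dom C (u F) = Cod C f"
    "Cod C (u F) = Cod C (i F)" "Cod C (i F) \<in> Obj C" "Cod C (i F) \<in> S" "mono_arr C (i F)"
    by auto
qed

lemma joint_epi:
  assumes F: "F \<in> fsets I r" and h: "h \<in> Arr C" "h' \<in> Arr C" "Dom C h = Cod C (i F)" "Dom C h' = Cod C (i F)"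
    "Cod C h = Cod C h'" and "h \<cdot> i F = h' \<cdot> i F" "k \<in> F \<Longrightarrow> h \<cdot> u F = h' \<cdot> u F"
  shows "h = h'"
proof (cases "k \<in> F")
  case True
  show ?thesis by (rule pushout_joint_epi[OF po[OF F True]]) (use assms True in auto)
next
  case False
  have FJ: "F \<in> fsets J r" using F False fsets_J by simp
  show ?thesis using assms no_glue[OF F False] c'_Obj[OF FJ] by simp
qed

lemma factor:
  assumes F: "F \<in> fsets I r" and s: "s \<in> Arr C" "Dom C s = cobj c' (F - {k})"
    and t: "k \<in> F \<Longrightarrow> t \<in> Arr C" "k \<in> F \<Longrightarrow> Dom C t = Cod C f" "k \<in> F \<Longrightarrow> Cod C t = Cod C s"
      "k \<in> F \<Longrightarrow> s \<cdot> att F = t \<cdot> f"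
  shows "\<exists>h. h \<in> Arr C \<and> Dom C h = Cod C (i F) \<and> Cod C h = Cod C s \<and> h \<cdot> i F = s \<and> (k \<in> F \<longrightarrow> h \<cdot> u F = t)"
proof (cases "k \<in> F")
  case True
  obtain h where "h \<in> Arr C" "Dom C h = Cod C (i F)" "Cod C h = Cod C s" "h \<cdot> i F = s" "h \<cdot> u F = t"
    by (rule pushout_factor[OF po[OF F True], of s t]) (use s t True att_Arr[OF F True] in auto)
  then show ?thesis by blast
next
  case False
  have FJ: "F \<in> fsets J r" using F False fsets_J by simp
  show ?thesis using False no_glue[OF F False] s c'_Obj[OF FJ] by (intro exI[of _ s]) simp
qed

lemma i_att: "F \<in> fsets I r \<Longrightarrow> k \<in> F \<Longrightarrow> i F \<cdot> att F = u F \<cdot> f"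
  using pushoutD(9)[OF po] by simp

text \<open>A map between the \<open>\<sigma>'(F - {k})\<close> is admissible if it respects the attaching maps. It then has
  a unique lift to the pushouts, and lifts compose; the axioms for the extension follow from those
  for \<open>c'\<close> in this way.\<close>

definition admissible :: "'i set \<Rightarrow> 'i set \<Rightarrow> 'm \<Rightarrow> bool" where
  "admissible F G m \<longleftrightarrow> m \<in> Hom C (cobj c' (F - {k})) (cobj c' (G - {k})) \<and>
     (k \<in> F \<longrightarrow> m \<cdot> att F = (if k \<in> G then att G else Zero C (cobj c' N) (cobj c' G)))"

definition lifts :: "'i set \<Rightarrow> 'i set \<Rightarrow> 'm \<Rightarrow> 'm \<Rightarrow> bool" where
  "lifts F G m h \<longleftrightarrow> h \<in> Hom C (Cod C (i F)) (Cod C (i G)) \<and> h \<cdot> i F = i G \<cdot> m \<and> (k \<in> F \<longrightarrow> h \<cdot> u F = u G)"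

definition lift :: "'i set \<Rightarrow> 'i set \<Rightarrow> 'm \<Rightarrow> 'm" where
  "lift F G m = (SOME h. lifts F G m h)"

lemma lifts_lift:
  assumes F: "F \<in> fsets I r" and G: "G \<in> fsets I r" and m: "admissible F G m"
  shows "lifts F G m (lift F G m)"
proof -
  note X = iu_Arr[OF G]
  have mA: "m \<in> Arr C" "Dom C m = cobj c' (F - {k})" "Cod C m = cobj c' (G - {k})"
    and ma: "k \<in> F \<Longrightarrow> m \<cdot> att F = (if k \<in> G then att G else Zero C (cobj c' N) (cobj c' G))"
    using m by (auto simp: admissible_def Hom_def)
  have "\<exists>h. h \<in> Arr C \<and> Dom C h = Cod C (i F) \<and> Cod C h = Cod C (i G \<cdot> m) \<and> h \<cdot> i F = i G \<cdot> m \<and>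
      (k \<in> F \<longrightarrow> h \<cdot> u F = u G)"
  proof (rule factor[OF F])
    assume k: "k \<in> F"
    show "(i G \<cdot> m) \<cdot> att F = u G \<cdot> f"
    proof (cases "k \<in> G")
      case True
      then show ?thesis using ma[OF k] i_att[OF G True] X att_Arr[OF F k] mA by simp
    next
      case False
      have GJ: "G \<in> fsets J r" using G False fsets_J by simp
      show ?thesis
        using ma[OF k] False no_glue[OF G False] X att_Arr[OF F k] mA c'_Obj[OF GJ] c'_Obj[OF N_fset] fgD Dom_f
        by simp
    qed
  qed (use X mA in auto)
  then have "\<exists>h. lifts F G m h" using X mA by (simp add: lifts_def Hom_def)
  then show ?thesis unfolding lift_def by (rule someI_ex)
qed

lemma lifts_unique: "F \<in> fsets I r \<Longrightarrow> lifts F G m h \<Longrightarrow> lifts F G m h' \<Longrightarrow> h = h'"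
  by (rule joint_epi[of F]) (auto simp: lifts_def Hom_def)

lemma lifts_Comp:
  assumes F: "A \<in> fsets I r" "B \<in> fsets I r" "D \<in> fsets I r"
    and m: "admissible A B m" "admissible B D m'" and h: "lifts A B m h" "lifts B D m' h'"
    and k: "k \<in> A \<Longrightarrow> k \<notin> B \<Longrightarrow> k \<notin> D"
  shows "lifts A D (m' \<cdot> m) (h' \<cdot> h)"
proof -
  note X = iu_Arr[OF F(1)] iu_Arr[OF F(2)] iu_Arr[OF F(3)]
  have M: "m \<in> Arr C" "Dom C m = cobj c' (A - {k})" "Cod C m = cobj c' (B - {k})"
    "m' \<in> Arr C" "Dom C m' = cobj c' (B - {k})" "Cod C m' = cobj c' (D - {k})"
    using m by (auto simp: admissible_def Hom_def)
  have H: "h \<in> Arr C" "Dom C h = Cod C (i A)" "Cod C h = Cod C (i B)" "h \<cdot> i A = i B \<cdot> m" "k \<in> A \<Longrightarrow> h \<cdot> u A = u B"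
    "h' \<in> Arr C" "Dom C h' = Cod C (i B)" "Cod C h' = Cod C (i D)" "h' \<cdot> i B = i D \<cdot> m'" "k \<in> B \<Longrightarrow> h' \<cdot> u B = u D"
    using h by (auto simp: lifts_def Hom_def)
  have "(h' \<cdot> h) \<cdot> i A = i D \<cdot> m' \<cdot> m" using X M H(1-4,6-8) Comp_eq[OF H(9)] by simp
  moreover have "(h' \<cdot> h) \<cdot> u A = u D" if kA: "k \<in> A"
  proof (cases "k \<in> B")
    case True
    then show ?thesis using X H(1-3,5-8,10) kA by simp
  next
    case False
    have J: "B \<in> fsets J r" "D \<in> fsets J r" using F False k[OF kA False] fsets_J by auto
    show ?thesis
      using X H(1-3,5-8) kA no_glue[OF F(2) False] no_glue[OF F(3) k[OF kA False]] c'_Obj[OF J(1)] c'_Obj[OF J(2)] fgD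
      by simp
  qed
  ultimately show ?thesis using H(1-3,6-8) by (simp add: lifts_def Hom_def)
qed

lemma lifts_Ident:
  assumes F: "F \<in> fsets I r"
  shows "lifts F F (Ident C (cobj c' (F - {k}))) (Ident C (Cod C (i F)))"
  using iu_Arr[OF F] c'_Obj[OF cut_fset(2)[OF F]] by (simp add: lifts_def Hom_def)

lemma admissible_inj:
  assumes FG: "(F, G) \<in> Gpairs I r"
  shows "admissible F G (cinj c' (F - {k}, G - {k}))"
proof -
  note f = GpairsD(1-3)[OF FG] and g = cut_Gpairs[OF FG]
  have "cinj c' (F - {k}, G - {k}) \<cdot> att F = att G" if k: "k \<in> F"
  proof -
    note m = M_Int[OF f(1) k]
    have e: "N \<inter> G = N \<inter> F" using M_Int_Gpairs[OF FG k] M_cut(1) by auto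
    have "cinj c' (F - {k}, G - {k}) \<cdot> att F =
        (cinj c' (F - {k}, G - {k}) \<cdot> cinj c' (N \<inter> F, F - {k})) \<cdot> csurj c' (N, N \<inter> F)"
      using cD m g by (simp add: att_def)
    then show ?thesis using configurationB[OF c' m(4) g] by (simp add: att_def e)
  qed
  then show ?thesis using f(3) cD(3-5)[OF g] by (auto simp: admissible_def Hom_def)
qed

lemma admissible_surj:
  assumes FG: "(F, G) \<in> Hpairs I r"
  shows "admissible F G (csurj c' (F - {k}, G - {k}))"
proof -
  note f = HpairsD(1-3)[OF FG] and g = cut_Hpairs[OF FG]
  have "csurj c' (F - {k}, G - {k}) \<cdot> att F = (if k \<in> G then att G else Zero C (cobj c' N) (cobj c' G))"
    if k: "k \<in> F"
  proof -
    note m = M_Int[OF f(1) k]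
    have e: "N \<inter> F \<inter> (G - {k}) = N \<inter> G" using f M_cut by auto
    note G = GHpairs_Int[OF m(4) g, unfolded e]
    have "csurj c' (F - {k}, G - {k}) \<cdot> att F =
        (csurj c' (F - {k}, G - {k}) \<cdot> cinj c' (N \<inter> F, F - {k})) \<cdot> csurj c' (N, N \<inter> F)"
      using cD m g by (simp add: att_def)
    also have "\<dots> = cinj c' (N \<inter> G, G - {k}) \<cdot> csurj c' (N \<inter> F, N \<inter> G) \<cdot> csurj c' (N, N \<inter> F)"
      unfolding configurationD'[OF c' m(4) g, unfolded e] using m G cD by simp
    also have "\<dots> = cinj c' (N \<inter> G, G - {k}) \<cdot> csurj c' (N, N \<inter> G)"
      by (simp only: configurationC[OF c' m(3) G(2)])
    also have "\<dots> = (if k \<in> G then att G else Zero C (cobj c' N) (cobj c' G))"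
    proof (cases "k \<in> G")
      case False
      \<comment> \<open>An upper part of \<open>F\<close> without \<open>k\<close> has no element below \<open>k\<close>, so the map factors through \<open>0\<close>.\<close>
      have M0: "N \<inter> G = {}" using M_Int_Hpairs[OF FG k False] M_cut(1) by auto
      have H0: "(N, {}) \<in> Hpairs J r" using Hpairs_trans[OF m(3) G(2)] M0 by simp
      have G0: "({}, G) \<in> Gpairs J r" using G(1) M0 False by simp
      have "csurj c' (N, {}) = Zero C (cobj c' N) (null C)"
        using to_null[of "csurj c' (N, {})"] cD H0 by simp
      then show ?thesis using cD H0 G0 c'_Obj[OF N_fset] False M0 by simp
    qed (simp add: att_def)
    finally show ?thesis .
  qed
  then show ?thesis using cD(8-10)[OF g] by (simp add: admissible_def Hom_def)
qed

definition Inj :: "'i set \<Rightarrow> 'i set \<Rightarrow> 'm" where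
  "Inj F G = lift F G (cinj c' (F - {k}, G - {k}))"

definition Surj :: "'i set \<Rightarrow> 'i set \<Rightarrow> 'm" where
  "Surj F G = lift F G (csurj c' (F - {k}, G - {k}))"

lemma lifts_Inj: "(F, G) \<in> Gpairs I r \<Longrightarrow> lifts F G (cinj c' (F - {k}, G - {k})) (Inj F G)"
  unfolding Inj_def by (blast intro: lifts_lift admissible_inj GpairsD)

lemma lifts_Surj: "(F, G) \<in> Hpairs I r \<Longrightarrow> lifts F G (csurj c' (F - {k}, G - {k})) (Surj F G)"
  unfolding Surj_def by (blast intro: lifts_lift admissible_surj HpairsD)

lemma Inj:
  assumes FG: "(F, G) \<in> Gpairs I r"
  shows "Inj F G \<in> Arr C" "Dom C (Inj F G) = Cod C (i F)" "Cod C (Inj F G) = Cod C (i G)"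
    "Inj F G \<cdot> i F = i G \<cdot> cinj c' (F - {k}, G - {k})" "k \<in> F \<Longrightarrow> Inj F G \<cdot> u F = u G"
  using lifts_Inj[OF FG] by (auto simp: lifts_def Hom_def)

lemma Surj:
  assumes FG: "(F, G) \<in> Hpairs I r"
  shows "Surj F G \<in> Arr C" "Dom C (Surj F G) = Cod C (i F)" "Cod C (Surj F G) = Cod C (i G)"
    "Surj F G \<cdot> i F = i G \<cdot> csurj c' (F - {k}, G - {k})" "Surj F G \<cdot> u F = u G"
proof -
  note fs = HpairsD(1-3)[OF FG] and l = lifts_Surj[OF FG]
  then show 1: "Surj F G \<in> Arr C" "Dom C (Surj F G) = Cod C (i F)" "Cod C (Surj F G) = Cod C (i G)"
    "Surj F G \<cdot> i F = i G \<cdot> csurj c' (F - {k}, G - {k})" by (auto simp: lifts_def Hom_def)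
  show "Surj F G \<cdot> u F = u G"
  proof (cases "k \<in> F")
    case False
    have kG: "k \<notin> G" using fs(3) False by auto
    have J: "F \<in> fsets J r" "G \<in> fsets J r" using fs False kG fsets_J by auto
    show ?thesis
      using no_glue[OF fs(1) False] no_glue[OF fs(2) kG] 1(1-3) c'_Obj[OF J(1)] c'_Obj[OF J(2)] fgD by simp
  qed (use l in \<open>simp add: lifts_def\<close>)
qed

lemma Inj_self: assumes F: "F \<in> fsets I r" shows "Inj F F = Ident C (Cod C (i F))"
  using lifts_unique[OF F lifts_Inj[OF Gpairs_refl[OF F]]] lifts_Ident[OF F] cD(7) cut_fset(2)[OF F] by simp

lemma Surj_self: assumes F: "F \<in> fsets I r" shows "Surj F F = Ident C (Cod C (i F))"
  using lifts_unique[OF F lifts_Surj[OF Hpairs_refl[OF F]]] lifts_Ident[OF F] cD(12) cut_fset(2)[OF F] by simp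

lemma Inj_Inj:
  assumes AB: "(A, B) \<in> Gpairs I r" and BD: "(B, D) \<in> Gpairs I r"
  shows "Inj B D \<cdot> Inj A B = Inj A D"
proof (rule lifts_unique[OF GpairsD(1)[OF AB] _ lifts_Inj[OF Gpairs_trans[OF assms]]])
  show "lifts A D (cinj c' (A - {k}, D - {k})) (Inj B D \<cdot> Inj A B)"
    unfolding configurationB[OF c' cut_Gpairs[OF AB] cut_Gpairs[OF BD], symmetric]
    using GpairsD(1-3)[OF AB] GpairsD(1-2)[OF BD]
    by (intro lifts_Comp[OF _ _ _ admissible_inj[OF AB] admissible_inj[OF BD] lifts_Inj[OF AB] lifts_Inj[OF BD]]) auto
qed

lemma Surj_Surj:
  assumes AB: "(A, B) \<in> Hpairs I r" and BD: "(B, D) \<in> Hpairs I r"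
  shows "Surj B D \<cdot> Surj A B = Surj A D"
proof (rule lifts_unique[OF HpairsD(1)[OF AB] _ lifts_Surj[OF Hpairs_trans[OF assms]]])
  show "lifts A D (csurj c' (A - {k}, D - {k})) (Surj B D \<cdot> Surj A B)"
    unfolding configurationC[OF c' cut_Hpairs[OF AB] cut_Hpairs[OF BD], symmetric]
    using HpairsD(1-2)[OF AB] HpairsD(1-3)[OF BD]
    by (intro lifts_Comp[OF _ _ _ admissible_surj[OF AB] admissible_surj[OF BD] lifts_Surj[OF AB] lifts_Surj[OF BD]]) auto
qed

lemma Surj_Inj:
  assumes AB: "(A, B) \<in> Gpairs I r" and BD: "(B, D) \<in> Hpairs I r"
  shows "Surj B D \<cdot> Inj A B = Inj (A \<inter> D) D \<cdot> Surj A (A \<inter> D)"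
proof (rule lifts_unique[OF GpairsD(1)[OF AB]])
  note G = GHpairs_Int[OF assms]
  have e: "(A - {k}) \<inter> (D - {k}) = A \<inter> D - {k}" by auto
  show "lifts A D (csurj c' (B - {k}, D - {k}) \<cdot> cinj c' (A - {k}, B - {k})) (Surj B D \<cdot> Inj A B)"
    using GpairsD(1-3)[OF AB] HpairsD(1-2)[OF BD]
    by (intro lifts_Comp[OF _ _ _ admissible_inj[OF AB] admissible_surj[OF BD] lifts_Inj[OF AB] lifts_Surj[OF BD]]) auto
  show "lifts A D (csurj c' (B - {k}, D - {k}) \<cdot> cinj c' (A - {k}, B - {k})) (Inj (A \<inter> D) D \<cdot> Surj A (A \<inter> D))"
    unfolding configurationD'[OF c' cut_Gpairs[OF AB] cut_Hpairs[OF BD], unfolded e]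
    using GpairsD(1-2)[OF G(1)] GpairsD(1)[OF AB]
    by (intro lifts_Comp[OF _ _ _ admissible_surj[OF G(2)] admissible_inj[OF G(1)] lifts_Surj[OF G(2)] lifts_Inj[OF G(1)]]) auto
qed

text \<open>If \<open>k \<in> A\<close> then \<open>\<sigma>(A)\<close> and \<open>\<sigma>(B)\<close> are extensions of the same object, and a \<open>w\<close> killed by
  \<open>\<iota>(A, B)\<close> is killed by the map to that object.\<close>

lemma Inj_mono:
  assumes AB: "(A, B) \<in> Gpairs I r"
  shows "mono_arr C (Inj A B)"
proof (cases "k \<in> A")
  case False
  note fs = GpairsD(1,2)[OF AB] and g = cut_Gpairs[OF AB]
  have "A \<in> fsets J r" using fs False fsets_J by simp
  then have "Inj A B = i B \<cdot> cinj c' (A - {k}, B - {k})"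
    using Inj[OF AB] no_glue[OF fs(1) False] c'_Obj by simp
  then show ?thesis
    using mono_Comp[OF cD(6)[OF g] iu_Arr(8)[OF fs(2)]] cD(5)[OF g] iu_Arr[OF fs(2)] by simp
next
  case True
  note fs = GpairsD(1-3)[OF AB] and g = cut_Gpairs[OF AB]
  have kB: "k \<in> B" using fs(3) True by auto
  note X = iu_Arr[OF fs(1)] iu_Arr[OF fs(2)] Inj(1-3)[OF AB] cD(3-5)[OF g]
  note pA = pD[OF fs(1) True] and pB = pD[OF fs(2) kB]
  note PA = short_exactD[OF pA(1)] and PB = short_exactD[OF pB(1)]
  have pp: "p B \<cdot> Inj A B = p A"
  proof (rule joint_epi[OF fs(1)])
    have "(p B \<cdot> Inj A B) \<cdot> i A = p B \<cdot> i B \<cdot> cinj c' (A - {k}, B - {k})"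
      using Inj(4)[OF AB] X PB by simp
    also have "\<dots> = p A \<cdot> i A" using X PA PB Comp_eq[OF PB(4)] pA(2) pB(2) fgD(2) by simp
    finally show "(p B \<cdot> Inj A B) \<cdot> i A = p A \<cdot> i A" .
    show "(p B \<cdot> Inj A B) \<cdot> u A = p A \<cdot> u A" using Inj(5)[OF AB True] X PB pA(3) pB(3) by simp
  qed (use X PA PB pA pB in auto)
  show ?thesis
  proof (rule mono_arrI[OF Inj(1)[OF AB]])
    fix w assume w: "w \<in> Arr C" "Cod C w = Dom C (Inj A B)" "Inj A B \<cdot> w = Zero C (Dom C w) (Cod C (Inj A B))"
    have "p A \<cdot> w = p B \<cdot> Inj A B \<cdot> w" using Comp_eq[OF pp] w(1,2) X PB by simp
    also have "\<dots> = Zero C (Dom C w) (Cod C (p A))" using w(1,2) X PB pA pB by (simp add: w(3))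
    finally obtain t where t: "t \<in> Arr C" "Dom C t = Dom C w" "Cod C t = Dom C (i A)" "i A \<cdot> t = w"
      using kernel_factor[OF PA(7), of w] w X PA by auto
    have tA: "Cod C t = cobj c' (A - {k})" using t X by simp
    have m: "mono_arr C (i B \<cdot> cinj c' (A - {k}, B - {k}))"
      using mono_Comp[OF cD(6)[OF g] iu_Arr(8)[OF fs(2)]] X by simp
    have "(i B \<cdot> cinj c' (A - {k}, B - {k})) \<cdot> t = Inj A B \<cdot> i A \<cdot> t"
      unfolding Inj(4)[OF AB, symmetric] using X t tA by simp
    also have "\<dots> = (i B \<cdot> cinj c' (A - {k}, B - {k})) \<cdot> Zero C (Dom C t) (Cod C t)"
      unfolding t(4) w(3) using X t(1-3) tA w(1) c'_Obj[OF cut_fset(2)[OF fs(1)]] by simp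
    finally have "t = Zero C (Dom C t) (Cod C t)"
      by - (rule mono_arrD[OF m]; use X t(1-3) tA w(1) c'_Obj[OF cut_fset(2)[OF fs(1)]] in auto)
    then have "w = i A \<cdot> Zero C (Dom C w) (cobj c' (A - {k}))" using t tA by metis
    then show "w = Zero C (Dom C w) (Cod C w)" using w(1,2) X c'_Obj[OF cut_fset(2)[OF fs(1)]] by simp
  qed
qed

lemma Surj_epi:
  assumes AB: "(A, B) \<in> Hpairs I r"
  shows "epi_arr C (Surj A B)"
  unfolding epi_arr_def
proof (intro conjI allI ballI impI Surj(1)[OF AB])
  note fs = HpairsD(1-3)[OF AB] and g = cut_Hpairs[OF AB]
  note X = iu_Arr[OF fs(1)] iu_Arr[OF fs(2)] Surj(1-3)[OF AB] cD(8-10)[OF g]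
  fix Z h h' assume h: "h \<in> Hom C (Cod C (Surj A B)) Z" "h' \<in> Hom C (Cod C (Surj A B)) Z"
    and e: "h \<cdot> Surj A B = h' \<cdot> Surj A B"
  note H = HomD[OF h(1)] HomD[OF h(2)]
  show "h = h'"
  proof (rule joint_epi[OF fs(2)])
    have "(h \<cdot> i B) \<cdot> csurj c' (A - {k}, B - {k}) = (h \<cdot> Surj A B) \<cdot> i A"
      using X H Surj(4)[OF AB] by simp
    also have "\<dots> = (h' \<cdot> i B) \<cdot> csurj c' (A - {k}, B - {k})" unfolding e using X H Surj(4)[OF AB] by simp
    finally show "h \<cdot> i B = h' \<cdot> i B" by - (rule epi_arrD[OF cD(11)[OF g]]; use X H in auto)
    have "h \<cdot> u B = (h \<cdot> Surj A B) \<cdot> u A" using X H Surj(5)[OF AB] by simp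
    also have "\<dots> = h' \<cdot> u B" unfolding e using X H Surj(5)[OF AB] by simp
    finally show "h \<cdot> u B = h' \<cdot> u B" .
  qed (use X H in auto)
qed

text \<open>Let \<open>D = B - A\<close> and let \<open>w\<close> on \<open>\<sigma>(B)\<close> vanish on \<open>\<sigma>(A)\<close>. On \<open>\<sigma>'(B - {k})\<close> it factors through
  \<open>\<sigma>'(D - {k})\<close>. If \<open>k \<in> D\<close>, this and \<open>w \<cdot> u B\<close> induce the factorisation through \<open>\<sigma>(D)\<close>; if \<open>k \<in> A\<close>,
  then \<open>w \<cdot> u B = w \<cdot> \<iota>(A, B) \<cdot> u A = 0\<close>, and the first factorisation suffices.\<close>

lemma Surj_cokernel:
  assumes AB: "(A, B) \<in> Gpairs I r"
  shows "is_cokernel C (Surj B (B - A)) (Inj A B)"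
proof -
  define D where "D = B - A"
  have BD: "(B, D) \<in> Hpairs I r" unfolding D_def by (rule Gpairs_Diff[OF AB])
  note fs = GpairsD(1,2)[OF AB] HpairsD(2)[OF BD] and g = cut_Gpairs[OF AB] cut_Hpairs[OF BD]
  note X = iu_Arr[OF fs(1)] iu_Arr[OF fs(2)] iu_Arr[OF fs(3)] Inj(1-3)[OF AB] Surj(1-3)[OF BD]
    cD(3-5)[OF g(1)] cD(8-10)[OF g(2)]
  have kD: "k \<in> D \<longleftrightarrow> k \<in> B \<and> k \<notin> A" by (auto simp: D_def)
  have Dk: "B - {k} - (A - {k}) = D - {k}" by (auto simp: D_def)
  note se = short_exactD[OF cD(13)[OF g(1), unfolded Dk]]
  have "is_cokernel C (Surj B D) (Inj A B)"
  proof (rule is_cokernelI[OF Inj(1)[OF AB] Surj_epi[OF BD]])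
    have AD: "A \<inter> D = {}" by (auto simp: D_def)
    note G = GHpairs_Int[OF AB BD, unfolded AD]
    have 0: "i {} = Ident C (null C)" using no_glue[of "{}"] cD(2) by simp
    have "Surj A {} = Zero C (Cod C (i A)) (null C)"
      using to_null[OF Surj(1)[OF G(2)]] Surj[OF G(2)] 0 by simp
    then show "Surj B D \<cdot> Inj A B = Zero C (Dom C (Inj A B)) (Cod C (Surj B D))"
      using Surj_Inj[OF AB BD, unfolded AD] Inj[OF G(1)] 0 X by simp
    fix w assume w: "w \<in> Arr C" "Dom C w = Cod C (Inj A B)" "w \<cdot> Inj A B = Zero C (Dom C (Inj A B)) (Cod C w)"
    have wB: "Dom C w = Cod C (i B)" using w X by simp
    have "(w \<cdot> i B) \<cdot> cinj c' (A - {k}, B - {k}) = (w \<cdot> Inj A B) \<cdot> i A"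
      using X w(1) wB Inj(4)[OF AB] by simp
    also have "\<dots> = Zero C (cobj c' (A - {k})) (Cod C (w \<cdot> i B))" unfolding w(3) using X w(1) wB by simp
    finally obtain h' where h': "h' \<in> Arr C" "Dom C h' = cobj c' (D - {k})" "Cod C h' = Cod C w"
        "h' \<cdot> csurj c' (B - {k}, D - {k}) = w \<cdot> i B"
      using cokernel_factor[OF se(8), of "w \<cdot> i B"] X w(1) wB by auto
    have "\<exists>h. h \<in> Arr C \<and> Dom C h = Cod C (i D) \<and> Cod C h = Cod C h' \<and> h \<cdot> i D = h' \<and>
        (k \<in> D \<longrightarrow> h \<cdot> u D = w \<cdot> u B)"
    proof (rule factor[OF fs(3) h'(1,2)])
      assume k: "k \<in> D"
      then have kB: "k \<in> B" by (simp add: kD)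
      note a = att_Arr[OF fs(2) kB] att_Arr[OF fs(3) k]
      have "h' \<cdot> att D = (h' \<cdot> csurj c' (B - {k}, D - {k})) \<cdot> att B"
        using admissible_surj[OF BD] kB k h'(1-3) X a by (simp add: admissible_def)
      also have "\<dots> = (w \<cdot> u B) \<cdot> f" unfolding h'(4) using X w(1) wB a i_att[OF fs(2) kB] fgD(1) by simp
      finally show "h' \<cdot> att D = (w \<cdot> u B) \<cdot> f" .
    qed (use X w(1) wB h' in auto)
    then obtain h where h: "h \<in> Arr C" "Dom C h = Cod C (i D)" "Cod C h = Cod C w" "h \<cdot> i D = h'"
        "k \<in> D \<Longrightarrow> h \<cdot> u D = w \<cdot> u B" using h' by auto
    have "h \<cdot> Surj B D = w"
    proof (rule joint_epi[OF fs(2)])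
      have "(h \<cdot> Surj B D) \<cdot> i B = (h \<cdot> i D) \<cdot> csurj c' (B - {k}, D - {k})" using h(1-3) X Surj(4)[OF BD] by simp
      then show "(h \<cdot> Surj B D) \<cdot> i B = w \<cdot> i B" using h(4) h'(4) by simp
      show "(h \<cdot> Surj B D) \<cdot> u B = w \<cdot> u B" if kB: "k \<in> B"
      proof (cases "k \<in> A")
        case True
        have kD': "k \<notin> D" using True kD by simp
        have DJ: "D \<in> fsets J r" using fs(3) kD' fsets_J by simp
        have "(h \<cdot> Surj B D) \<cdot> u B = Zero C (Cod C f) (Cod C w)"
          using h X Surj(5)[OF BD] no_glue[OF fs(3) kD'] c'_Obj[OF DJ] fgD by simp
        moreover have "w \<cdot> u B = (w \<cdot> Inj A B) \<cdot> u A" using w(1) wB X Inj(5)[OF AB True] by simp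
        then have "w \<cdot> u B = Zero C (Cod C f) (Cod C w)" unfolding w(3) using w(1) X by simp
        ultimately show ?thesis by simp
      next
        case False
        then show ?thesis using h X Surj(5)[OF BD] kB kD by simp
      qed
    qed (use h w(1) wB X in auto)
    then show "\<exists>h. h \<in> Arr C \<and> Dom C h = Cod C (Surj B D) \<and> Cod C h = Cod C w \<and> h \<cdot> Surj B D = w"
      using h X by auto
  qed (use X in auto)
  then show ?thesis by (simp add: D_def)
qed

definition ext_config :: "('i, 'o, 'm) config" where
  "ext_config = \<lparr>cobj = (\<lambda>F \<in> fsets I r. Cod C (i F)), cinj = (\<lambda>(A, B) \<in> Gpairs I r. Inj A B),
     csurj = (\<lambda>(A, B) \<in> Hpairs I r. Surj A B)\<rparr>"

lemma ext_config_simps: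
  "F \<in> fsets I r \<Longrightarrow> cobj ext_config F = Cod C (i F)"
  "(A, B) \<in> Gpairs I r \<Longrightarrow> cinj ext_config (A, B) = Inj A B"
  "(A, B) \<in> Hpairs I r \<Longrightarrow> csurj ext_config (A, B) = Surj A B"
  by (simp_all add: ext_config_def)

lemma configuration_ext_config: "configuration C S I r ext_config"
proof (rule configurationI)
  show "cobj ext_config {} = null C"
    using no_glue[of "{}"] cD(2) by (simp add: ext_config_simps)
  show "cinj ext_config (A, B) \<in> Hom C (cobj ext_config A) (cobj ext_config B)" "mono_arr C (cinj ext_config (A, B))"
    "short_exact C (cinj ext_config (A, B)) (csurj ext_config (B, B - A))"
    if "(A, B) \<in> Gpairs I r" for A B
    using that Inj[OF that] GpairsD[OF that] Gpairs_Diff[OF that]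
      Inj_mono[OF that] short_exactI[OF Inj_mono[OF that] Surj_cokernel[OF that]]
    by (simp_all add: ext_config_simps Hom_def)
  show "csurj ext_config (A, B) \<in> Hom C (cobj ext_config A) (cobj ext_config B)" "epi_arr C (csurj ext_config (A, B))"
    if "(A, B) \<in> Hpairs I r" for A B
    using that Surj[OF that] HpairsD[OF that] Surj_epi[OF that] by (simp_all add: ext_config_simps Hom_def)
  show "csurj ext_config (B, D) \<cdot> cinj ext_config (A, B) =
      cinj ext_config (A \<inter> D, D) \<cdot> csurj ext_config (A, A \<inter> D)"
    if "(A, B) \<in> Gpairs I r" "(B, D) \<in> Hpairs I r" for A B D
    using that GHpairs_Int[OF that] Surj_Inj[OF that] by (simp add: ext_config_simps)
  show "cinj ext_config (B, D) \<cdot> cinj ext_config (A, B) = cinj ext_config (A, D)"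
    if "(A, B) \<in> Gpairs I r" "(B, D) \<in> Gpairs I r" for A B D
    using that Gpairs_trans[OF that] Inj_Inj[OF that] by (simp add: ext_config_simps)
  show "csurj ext_config (B, D) \<cdot> csurj ext_config (A, B) = csurj ext_config (A, D)"
    if "(A, B) \<in> Hpairs I r" "(B, D) \<in> Hpairs I r" for A B D
    using that Hpairs_trans[OF that] Surj_Surj[OF that] by (simp add: ext_config_simps)
qed (auto simp: ext_config_simps iu_Arr Inj_self Surj_self Gpairs_refl Hpairs_refl, simp_all add: ext_config_def)

lemma subconfig_ext_config: "subconfig J r ext_config = c'"
proof -
  note e = configuration_ext[OF c']
  have Id: "i F = Ident C (cobj c' F)" "cobj c' F \<in> Obj C" if "F \<in> fsets J r" for F
    using no_glue[of F] c'_Obj[OF that] that by (auto simp: fsets_J)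
  have "restrict (cobj ext_config) (fsets J r) = cobj c'"
    by (rule extensionalityI[OF _ e(1)]) (use Id in \<open>auto simp: fsets_J ext_config_simps\<close>)
  moreover have "restrict (cinj ext_config) (Gpairs J r) = cinj c'"
  proof (rule extensionalityI[OF _ e(2)], simp, safe)
    fix A B assume AB: "(A, B) \<in> Gpairs J r"
    have AB': "(A, B) \<in> Gpairs I r" "k \<notin> B" using AB Gpairs_J by auto
    have k: "A - {k} = A" "B - {k} = B" using AB'(2) GpairsD(3)[OF AB] by auto
    have "Inj A B \<cdot> i A = i B \<cdot> cinj c' (A, B)" using Inj(4)[OF AB'(1)] by (simp add: k)
    then show "restrict (cinj ext_config) (Gpairs J r) (A, B) = cinj c' (A, B)"
      using AB AB' Id[OF GpairsD(1)[OF AB]] Id[OF GpairsD(2)[OF AB]] cD(3-5)[OF AB] Inj(1-3)[OF AB'(1)]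
      by (simp add: ext_config_simps)
  qed
  moreover have "restrict (csurj ext_config) (Hpairs J r) = csurj c'"
  proof (rule extensionalityI[OF _ e(3)], simp, safe)
    fix A B assume AB: "(A, B) \<in> Hpairs J r"
    have AB': "(A, B) \<in> Hpairs I r" "k \<notin> A" using AB Hpairs_J by auto
    have k: "A - {k} = A" "B - {k} = B" using AB'(2) HpairsD(3)[OF AB] by auto
    have "Surj A B \<cdot> i A = i B \<cdot> csurj c' (A, B)" using Surj(4)[OF AB'(1)] by (simp add: k)
    then show "restrict (csurj ext_config) (Hpairs J r) (A, B) = csurj c' (A, B)"
      using AB AB' Id[OF HpairsD(1)[OF AB]] Id[OF HpairsD(2)[OF AB]] cD(8-10)[OF AB] Surj(1-3)[OF AB'(1)]
      by (simp add: ext_config_simps)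
  qed
  ultimately show ?thesis by (simp add: subconfig_def)
qed

lemma att_M: "att M = Ident C (cobj c' N)"
  using M_cut cD N_fset c'_Obj[OF N_fset] by (simp add: att_def Int_absorb2 M_def subset_insertI)

text \<open>The attaching map for \<open>F = M\<close> is the identity, so the pushout is \<open>E\<close> itself.\<close>

lemma u_M: "iso_arr C (u M)" "u M \<cdot> f = cinj ext_config (N, M)"
proof -
  have po: "pushout C f (Ident C (cobj c' N)) (i M) (u M)"
    using po[OF M_fset M_cut(2)] by (simp add: att_M)
  show "iso_arr C (u M)" by (rule pushout_along_Ident[OF po c'_Obj[OF N_fset]])
  have N: "N \<in> fsets I r" "N - {k} = N" using NM_Gpair[THEN GpairsD(1)] M_cut by auto
  have "Inj N M \<cdot> i N = i M \<cdot> Ident C (cobj c' N)"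
    using Inj(4)[OF NM_Gpair] cD(7)[OF N_fset] N by (simp add: M_cut)
  then have "Inj N M = i M \<cdot> Ident C (cobj c' N)"
    using no_glue[OF N(1) M_cut(3)] Inj(1-3)[OF NM_Gpair] c'_Obj[OF N_fset] by simp
  then show "u M \<cdot> f = cinj ext_config (N, M)"
    using pushoutD(9)[OF po] NM_Gpair by (simp add: ext_config_simps)
qed

end

theorem (in exact_top_point) ex_point_extension:
  assumes c': "configuration C S J r c'" and fg: "short_exact C f g"
    and Dom_f: "Dom C f = cobj c' N" and Cod_g: "Cod C g \<in> S"
  shows "\<exists>c e. configuration C S I r c \<and> subconfig J r c = c' \<and> iso_arr C e \<and>
    e \<in> Hom C (Cod C f) (cobj c M) \<and> e \<cdot> f = cinj c (N, M)"
proof -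
  have "\<exists>i u p. (k \<in> F \<longrightarrow> pushout C f (cinj c' (N \<inter> F, F - {k}) \<cdot> csurj c' (N, N \<inter> F)) i u \<and>
      short_exact C i p \<and> Cod C p = Cod C g \<and> p \<cdot> u = g) \<and>
      (k \<notin> F \<longrightarrow> i = Ident C (cobj c' F) \<and> u = Zero C (Cod C f) (cobj c' F))"
    if F: "F \<in> fsets I r" for F
  proof (cases "k \<in> F")
    case True
    have "cinj c' (N \<inter> F, F - {k}) \<cdot> csurj c' (N, N \<inter> F) \<in> Arr C"
      "Dom C f = Dom C (cinj c' (N \<inter> F, F - {k}) \<cdot> csurj c' (N, N \<inter> F))"
      using configurationD[OF c'] M_Int[OF F True] Dom_f by auto
    from ex_pushout_short_exact[OF fg this] show ?thesis using True by simp
  qed simp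
  then obtain i u p where iup: "\<And>F. F \<in> fsets I r \<Longrightarrow> (k \<in> F \<longrightarrow>
      pushout C f (cinj c' (N \<inter> F, F - {k}) \<cdot> csurj c' (N, N \<inter> F)) (i F) (u F) \<and>
      short_exact C (i F) (p F) \<and> Cod C (p F) = Cod C g \<and> p F \<cdot> u F = g) \<and>
      (k \<notin> F \<longrightarrow> i F = Ident C (cobj c' F) \<and> u F = Zero C (Cod C f) (cobj c' F))"
    by metis
  interpret point_extension C S I r k c' f g i u p
    by unfold_locales (use c' fg Dom_f Cod_g iup in auto)
  have "u M \<in> Hom C (Cod C f) (cobj ext_config M)"
    using iu_Arr[OF M_fset] M_fset by (simp add: Hom_def ext_config_simps)
  then show ?thesis using configuration_ext_config subconfig_ext_config u_M by blast
qed

section \<open>Duality\<close>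

text \<open>A configuration is the same as a configuration in the opposite category over the opposite
  poset, with \<open>\<iota>\<close> and \<open>\<pi>\<close> exchanged. Axioms (B) and (C) are exchanged, (A) and (D) are self-dual.\<close>

definition opp :: "('o, 'm) cat \<Rightarrow> ('o, 'm) cat" where
  "opp C = C\<lparr>Dom := Cod C, Cod := Dom C, Comp := (\<lambda>g f. Comp C f g), Zero := (\<lambda>X Y. Zero C Y X)\<rparr>"

lemma opp_simps [simp]:
  "Obj (opp C) = Obj C" "Arr (opp C) = Arr C" "Dom (opp C) = Cod C" "Cod (opp C) = Dom C"
  "Ident (opp C) = Ident C" "g \<cdot>\<^bsub>opp C\<^esub> f = f \<cdot>\<^bsub>C\<^esub> g" "Plus (opp C) = Plus C"
  "Zero (opp C) X Y = Zero C Y X" "null (opp C) = null C" "opp (opp C) = C"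
  by (simp_all add: opp_def)

lemma Hom_opp [simp]: "Hom (opp C) X Y = Hom C Y X"
  by (auto simp: Hom_def)

lemma mono_arr_opp [simp]: "mono_arr (opp C) f = epi_arr C f"
  and epi_arr_opp [simp]: "epi_arr (opp C) f = mono_arr C f"
  by (simp_all add: mono_arr_def epi_arr_def)

lemma is_kernel_opp [simp]: "is_kernel (opp C) k f = is_cokernel C k f"
  and is_cokernel_opp [simp]: "is_cokernel (opp C) k f = is_kernel C k f"
  unfolding is_kernel_def is_cokernel_def by auto

lemma short_exact_opp [simp]: "short_exact (opp C) f g = short_exact C g f"
  unfolding short_exact_def by auto

lemma direct_sum_opp: assumes "direct_sum C X Y Z" shows "direct_sum (opp C) X Y Z"
proof -
  obtain i j p q where "Z \<in> Obj C" "i \<in> Hom C X Z" "j \<in> Hom C Y Z" "p \<in> Hom C Z X" "q \<in> Hom C Z Y"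
    "p \<cdot>\<^bsub>C\<^esub> i = Ident C X" "q \<cdot>\<^bsub>C\<^esub> j = Ident C Y" "p \<cdot>\<^bsub>C\<^esub> j = Zero C Y X" "q \<cdot>\<^bsub>C\<^esub> i = Zero C X Y"
    "Plus C (i \<cdot>\<^bsub>C\<^esub> p) (j \<cdot>\<^bsub>C\<^esub> q) = Ident C Z"
    using assms unfolding direct_sum_def by blast
  then show ?thesis
    unfolding direct_sum_def
    by (intro conjI bexI[of _ p] bexI[of _ q] bexI[of _ i] bexI[of _ j]) simp_all
qed

lemma Hom_group_opp [simp]: "Hom_group (opp C) X Y = Hom_group C Y X"
  by (simp add: Hom_group_def)

lemma (in exact_category) exact_category_opp: "exact_category (opp C) S"
proof (intro exact_category.intro abelian_category.intro additive_category.intro category.intro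
    exact_category_axioms.intro abelian_category_axioms.intro additive_category_axioms.intro)
  show "Dom (opp C) f \<in> Obj (opp C)" "Cod (opp C) f \<in> Obj (opp C)" if "f \<in> Arr (opp C)" for f
    using that by simp_all
  show "Ident (opp C) X \<in> Hom (opp C) X X" if "X \<in> Obj (opp C)" for X
    using that Id_Hom by simp
  show "g \<cdot>\<^bsub>opp C\<^esub> f \<in> Hom (opp C) X Z" if "f \<in> Hom (opp C) X Y" "g \<in> Hom (opp C) Y Z" for f g X Y Z
    using that Comp_Hom[of g Z Y f X] by simp
  show "f \<cdot>\<^bsub>opp C\<^esub> Ident (opp C) X = f" "Ident (opp C) Y \<cdot>\<^bsub>opp C\<^esub> f = f" if "f \<in> Hom (opp C) X Y" for f X Y
    using that Comp_Id[of f Y X] Id_Comp[of f Y X] by simp_all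
  show "(h \<cdot>\<^bsub>opp C\<^esub> g) \<cdot>\<^bsub>opp C\<^esub> f = h \<cdot>\<^bsub>opp C\<^esub> g \<cdot>\<^bsub>opp C\<^esub> f"
    if "f \<in> Hom (opp C) W X" "g \<in> Hom (opp C) X Y" "h \<in> Hom (opp C) Y Z" for f g h W X Y Z
    using that Comp_assoc[of h Z Y g X f W] by simp
  show "comm_group (Hom_group (opp C) X Y)" if "X \<in> Obj (opp C)" "Y \<in> Obj (opp C)" for X Y
    using Hom_comm_group that by simp
  show "Plus (opp C) g h \<cdot>\<^bsub>opp C\<^esub> f = Plus (opp C) (g \<cdot>\<^bsub>opp C\<^esub> f) (h \<cdot>\<^bsub>opp C\<^esub> f)"
    if "f \<in> Hom (opp C) X Y" "g \<in> Hom (opp C) Y Z" "h \<in> Hom (opp C) Y Z" for f g h X Y Z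
    using that Comp_Plus_right[of g Z Y h f X] by simp
  show "h \<cdot>\<^bsub>opp C\<^esub> Plus (opp C) f g = Plus (opp C) (h \<cdot>\<^bsub>opp C\<^esub> f) (h \<cdot>\<^bsub>opp C\<^esub> g)"
    if "f \<in> Hom (opp C) X Y" "g \<in> Hom (opp C) X Y" "h \<in> Hom (opp C) Y Z" for f g h X Y Z
    using that Comp_Plus_left[of h Z Y f X g] by simp
  show "zero_object (opp C) (null (opp C))"
    using zero_object_null by (simp add: zero_object_def)
  show "\<exists>Z. direct_sum (opp C) X Y Z" if XY: "X \<in> Obj (opp C)" "Y \<in> Obj (opp C)" for X Y
  proof -
    obtain Z where "direct_sum C X Y Z" using ex_direct_sum[of X Y] XY by auto
    from direct_sum_opp[OF this] show ?thesis ..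
  qed
  show "\<exists>k. is_kernel (opp C) k f" "\<exists>k. is_cokernel (opp C) k f" if "f \<in> Arr (opp C)" for f
    using ex_kernel[of f] ex_cokernel[of f] that by simp_all
  show "\<exists>g. is_kernel (opp C) f g" if "mono_arr (opp C) f" for f
    using epi_is_cokernel[of f] that by simp
  show "\<exists>g. is_cokernel (opp C) f g" if "epi_arr (opp C) f" for f
    using mono_is_kernel[of f] that by simp
  show "S \<subseteq> Obj (opp C)" "null (opp C) \<in> S" using S_Obj S_null by simp_all
  show "\<exists>Z\<in>S. direct_sum (opp C) X Y Z" if XY: "X \<in> S" "Y \<in> S" for X Y
  proof -
    obtain Z where "Z \<in> S" "direct_sum C X Y Z" using S_direct_sum[OF XY] by blast
    then show ?thesis by (intro bexI[of _ Z] direct_sum_opp)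
  qed
  show "Cod (opp C) f \<in> S" if "short_exact (opp C) f g" "Dom (opp C) f \<in> S" "Cod (opp C) g \<in> S" for f g
    using S_extension[of g f] short_exactD(3)[of g f] that by simp
qed

lemma fsets_converse [simp]: "fsets I (r\<inverse>) = fsets I r"
  unfolding fsets_def by blast

lemma Gpairs_converse: "(A, B) \<in> Gpairs I (r\<inverse>) \<longleftrightarrow> (B, A) \<in> Hpairs I r"
  and Hpairs_converse: "(A, B) \<in> Hpairs I (r\<inverse>) \<longleftrightarrow> (B, A) \<in> Gpairs I r"
  unfolding Gpairs_def Hpairs_def by auto

definition dual :: "('a, 'o, 'm) config \<Rightarrow> ('a, 'o, 'm) config" where
  "dual c = \<lparr>cobj = cobj c, cinj = (\<lambda>(A, B). csurj c (B, A)), csurj = (\<lambda>(A, B). cinj c (B, A))\<rparr>"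

lemma dual_simps [simp]:
  "cobj (dual c) = cobj c" "cinj (dual c) (A, B) = csurj c (B, A)" "csurj (dual c) (A, B) = cinj c (B, A)"
  "dual (dual c) = c"
  by (simp_all add: dual_def)

lemma configuration_dual:
  assumes c: "configuration C S I r c"
  shows "configuration (opp C) S I (r\<inverse>) (dual c)"
proof (rule configurationI)
  note d = configurationD[OF c] and x = configuration_ext[OF c]
  show "cinj (dual c) \<in> extensional (Gpairs I (r\<inverse>))" "csurj (dual c) \<in> extensional (Hpairs I (r\<inverse>))"
    using x unfolding extensional_def by (auto simp: dual_def Gpairs_converse Hpairs_converse)
  show "short_exact (opp C) (cinj (dual c) (A, B)) (csurj (dual c) (B, B - A))"
    if "(A, B) \<in> Gpairs I (r\<inverse>)" for A B
  proof -
    have "(B, A) \<in> Hpairs I r" "B - (B - A) = A" using that HpairsD(3)[of B A I r] by (auto simp: Gpairs_converse)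
    then show ?thesis using d(13)[OF Hpairs_Diff, of B A] by simp
  qed
  show "csurj (dual c) (B, D) \<cdot>\<^bsub>opp C\<^esub> cinj (dual c) (A, B) =
      cinj (dual c) (A \<inter> D, D) \<cdot>\<^bsub>opp C\<^esub> csurj (dual c) (A, A \<inter> D)"
    if "(A, B) \<in> Gpairs I (r\<inverse>)" "(B, D) \<in> Hpairs I (r\<inverse>)" for A B D
    using that configurationD'[OF c, of D B A] by (simp add: Gpairs_converse Hpairs_converse Int_commute)
qed (use configurationD[OF c] configuration_ext[OF c] configurationB[OF c] configurationC[OF c]
    in \<open>auto simp: Gpairs_converse Hpairs_converse Hom_def\<close>)

lemma config_morphism_dual:
  assumes "config_morphism C I r c d \<eta>"
  shows "config_morphism (opp C) I (r\<inverse>) (dual d) (dual c) \<eta>"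
  using config_morphismD[OF assms]
  by (intro config_morphismI) (auto simp: Gpairs_converse Hpairs_converse Hom_def)

lemma config_morphism_dual_iff:
  "config_morphism (opp C) I (r\<inverse>) (dual d) (dual c) \<eta> \<longleftrightarrow> config_morphism C I r c d \<eta>"
  using config_morphism_dual[of C I r c d \<eta>] config_morphism_dual[of "opp C" I "r\<inverse>" "dual d" "dual c" \<eta>]
  by auto

lemma reindex_dual: "reindex P K (s\<inverse>) (dual c) = dual (reindex P K s c)"
  by (auto simp: reindex_def dual_def fun_eq_iff restrict_def Gpairs_converse Hpairs_converse)

lemma reindex_map_converse: "reindex_map P K (s\<inverse>) = reindex_map P K s"
  by (simp add: reindex_map_def fun_eq_iff)


section \<open>Substituting a configuration\<close>

text \<open>An order-preserving surjection \<open>\<phi> : I \<rightarrow> K\<close> that is an isomorphism away from \<open>L\<close>, so that \<open>I\<close>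
  is \<open>K\<close> with \<open>L\<close> replaced by \<open>\<phi>\<^sup>-\<^sup>1(L)\<close>. The relations may be defined on more than \<open>I\<close> and \<open>K\<close>;
  this makes it easy to pass to subsets.\<close>

locale poset_subst =
  fixes I :: "'i set" and r :: "'i rel" and K :: "'k set" and s :: "'k rel" and \<phi> :: "'i \<Rightarrow> 'k"
    and L :: "'k set"
  assumes refl_r: "\<And>i. i \<in> I \<Longrightarrow> (i, i) \<in> r" and trans_r: "trans r" and antisym_r: "antisym r"
    and refl_s: "\<And>i. i \<in> K \<Longrightarrow> (i, i) \<in> s" and trans_s: "trans s" and antisym_s: "antisym s"
    and surj: "\<phi> ` I = K" and mono: "\<And>i j. i \<in> I \<Longrightarrow> j \<in> I \<Longrightarrow> (i, j) \<in> r \<Longrightarrow> (\<phi> i, \<phi> j) \<in> s"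
    and L_fset: "L \<in> fsets K s"
    and below: "\<And>i x. i \<in> I \<Longrightarrow> x \<in> I \<Longrightarrow> \<phi> x \<notin> L \<Longrightarrow> (\<phi> i, \<phi> x) \<in> s \<Longrightarrow> (i, x) \<in> r"
    and above: "\<And>i x. i \<in> I \<Longrightarrow> x \<in> I \<Longrightarrow> \<phi> x \<notin> L \<Longrightarrow> (\<phi> x, \<phi> i) \<in> s \<Longrightarrow> (x, i) \<in> r"
begin

abbreviation pre :: "'k set \<Rightarrow> 'i set" where
  "pre A \<equiv> \<phi> -` A \<inter> I"

lemma inj_off_L: "i \<in> I \<Longrightarrow> x \<in> I \<Longrightarrow> \<phi> x \<notin> L \<Longrightarrow> \<phi> i = \<phi> x \<Longrightarrow> i = x"
  using below[of i x] above[of i x] refl_s[of "\<phi> x"] surj antisymD[OF antisym_r] by auto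

lemma fset_map_pre: "fset_map pre K s I r"
  using surj mono by (intro fset_map_vimage) auto

lemma poset_subst_converse: "poset_subst I (r\<inverse>) K (s\<inverse>) \<phi> L"
  using refl_r trans_r antisym_r refl_s trans_s antisym_s surj mono L_fset below above
  by unfold_locales auto

end

lemma (in exact_category) config_isoI:
  assumes c: "configuration C S I r c" "configuration C S I r d"
    and m: "config_morphism C I r c d \<alpha>" "config_morphism C I r d c \<beta>"
    and e: "config_Comp C I r \<beta> \<alpha> = config_Id C I r c" "config_Comp C I r \<alpha> \<beta> = config_Id C I r d"
  shows "config_iso C I r c d \<alpha>"
  unfolding config_iso_def
proof (intro conjI ballI)
  fix F assume F: "F \<in> fsets I r"
  note a = config_morphismD[OF m(1)] and b = config_morphismD[OF m(2)]
  have "\<beta> F \<cdot> \<alpha> F = Ident C (cobj c F)" "\<alpha> F \<cdot> \<beta> F = Ident C (cobj d F)"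
    using fun_cong[OF e(1), of F] fun_cong[OF e(2), of F] F by (simp_all add: config_Comp_def config_Id_def)
  then show "iso_arr C (\<alpha> F)" using a(2-4)[OF F] b(2-4)[OF F] by (intro iso_arrI[of _ "\<beta> F"]) simp_all
qed (rule m(1))

lemma (in exact_category) config_Id_morphism:
  "configuration C S I r c \<Longrightarrow> config_morphism C I r c c (config_Id C I r c)"
  by (rule config_isoD(1)[OF config_iso_Id])

context exact_top_point
begin

lemma endomorphism_eq_Id:
  assumes c: "configuration C S I r c" and \<eta>: "config_morphism C I r c c \<eta>"
    and J: "subconfig_map J r \<eta> = config_Id C J r (subconfig J r c)" and M: "\<eta> M = Ident C (cobj c M)"
  shows "\<eta> = config_Id C I r c"
proof -
  let ?id = "config_Id C J r (subconfig J r c)"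
  note sub = fset_map_sub[OF J_fset]
  have c1: "configuration C S J r (subconfig J r c)"
    unfolding subconfig_reindex by (rule configuration_reindex[OF c sub])
  have "Ident C (cobj c M) \<in> Hom C (cobj c M) (cobj c M)"
    "Ident C (cobj c M) \<cdot> cinj c (N, M) = cinj c (N, M) \<cdot> ?id N"
    using config_Obj[OF c M_fset] configurationD[OF c] NM_Gpair N_fset
    by (simp_all add: Hom_def config_Id_def subconfig_reindex)
  note ex1 = ex1_extend_morphism[OF c c config_Id_morphism[OF c1] this]
  have "subconfig_map J r (config_Id C I r c) = ?id" "config_Id C I r c M = Ident C (cobj c M)"
    using M_fset by (simp_all add: subconfig_map_reindex subconfig_reindex reindex_map_Id[OF sub])
      (simp add: config_Id_def)
  then show ?thesis using ex1 \<eta> J M config_Id_morphism[OF c] by blast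
qed

lemma extend_iso:
  assumes c: "configuration C S I r c" and d: "configuration C S I r d"
    and b: "config_iso C J r (subconfig J r c) (subconfig J r d) b"
    and e: "iso_arr C e" "e \<in> Hom C (cobj c M) (cobj d M)" and eb: "e \<cdot> cinj c (N, M) = cinj d (N, M) \<cdot> b N"
  shows "\<exists>\<eta>. config_iso C I r c d \<eta> \<and> subconfig_map J r \<eta> = b \<and> \<eta> M = e"
proof -
  note sub = fset_map_sub[OF J_fset] and eA = HomD[OF e(2)]
  note c1 = configuration_reindex[OF c sub, folded subconfig_reindex]
    and d1 = configuration_reindex[OF d sub, folded subconfig_reindex]
  note inv = config_iso_inv[OF c1 d1 b]
  obtain \<eta> where \<eta>: "config_morphism C I r c d \<eta>" "subconfig_map J r \<eta> = b" "\<eta> M = e"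
    using ex1_extend_morphism[OF c d config_isoD(1)[OF b] e(2) eb] by blast
  have bN: "b N \<in> Arr C" "Dom C (b N) = cobj c N" "Cod C (b N) = cobj d N" "iso_arr C (b N)"
    using config_morphismD(2-4)[OF config_isoD(1)[OF b] N_fset] config_isoD(2)[OF b N_fset] N_fset
    by (simp_all add: subconfig_reindex)
  have "inv_arr e \<cdot> cinj d (N, M) = cinj c (N, M) \<cdot> inv_arr (b N)"
    by (rule inv_arr_square[OF bN(4) e(1)])
      (use bN eA configurationD[OF c] configurationD[OF d] NM_Gpair eb in auto)
  then obtain \<zeta> where \<zeta>: "config_morphism C I r d c \<zeta>" "subconfig_map J r \<zeta> = config_inv J r b" "\<zeta> M = inv_arr e"
    using ex1_extend_morphism[OF d c config_isoD(1)[OF inv(1)], of "inv_arr e"] e(1) eA N_fset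
    by (auto simp: Hom_def config_inv_def)
  have comp: "subconfig_map J r (config_Comp C I r \<beta> \<alpha>) = config_Comp C J r (subconfig_map J r \<beta>) (subconfig_map J r \<alpha>)"
    "config_Comp C I r \<beta> \<alpha> M = \<beta> M \<cdot> \<alpha> M" for \<alpha> \<beta>
    using M_fset by (simp_all add: subconfig_map_reindex reindex_map_Comp[OF sub]) (simp add: config_Comp_def)
  have "config_Comp C I r \<zeta> \<eta> = config_Id C I r c"
    by (rule endomorphism_eq_Id[OF c config_morphism_Comp[OF c d c \<eta>(1) \<zeta>(1)]])
      (use e(1) eA in \<open>simp_all add: comp \<eta> \<zeta> inv\<close>)
  moreover have "config_Comp C I r \<eta> \<zeta> = config_Id C I r d"
    by (rule endomorphism_eq_Id[OF d config_morphism_Comp[OF d c d \<zeta>(1) \<eta>(1)]])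
      (use e(1) eA in \<open>simp_all add: comp \<eta> \<zeta> inv\<close>)
  ultimately have "config_iso C I r c d \<eta>" by (rule config_isoI[OF c d \<eta>(1) \<zeta>(1)])
  then show ?thesis using \<eta> by blast
qed

end

text \<open>What is proved at every stage of the chain from \<open>L\<close> to \<open>K\<close>. Uniqueness is stated for
  morphisms instead of isomorphisms. The statement then is self-dual, and it contains the functoriality
  from which invertibility follows.\<close>

definition has_substitution :: "('o, 'm) cat \<Rightarrow> 'o set \<Rightarrow> 'i set \<Rightarrow> 'i rel \<Rightarrow> 'k set \<Rightarrow> 'k rel \<Rightarrow>
    ('i \<Rightarrow> 'k) \<Rightarrow> 'k set \<Rightarrow> bool" where
  "has_substitution C S I r K s \<phi> L \<longleftrightarrow>
     (\<forall>c' ct. configuration C S (\<phi> -` L \<inter> I) r c' \<and> configuration C S K s ct \<and>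
        quotconfig I \<phi> L s c' = subconfig L s ct \<longrightarrow>
        (\<exists>c. configuration C S I r c \<and> subconfig (\<phi> -` L \<inter> I) r c = c' \<and> quotconfig I \<phi> K s c = ct)) \<and>
     (\<forall>c d b \<gamma>. configuration C S I r c \<and> configuration C S I r d \<and>
        config_morphism C (\<phi> -` L \<inter> I) r (subconfig (\<phi> -` L \<inter> I) r c) (subconfig (\<phi> -` L \<inter> I) r d) b \<and>
        config_morphism C K s (quotconfig I \<phi> K s c) (quotconfig I \<phi> K s d) \<gamma> \<and>
        quotconfig_map I \<phi> L s b = subconfig_map L s \<gamma> \<longrightarrow>
        (\<exists>!\<eta>. config_morphism C I r c d \<eta> \<and> subconfig_map (\<phi> -` L \<inter> I) r \<eta> = b \<and>
           quotconfig_map I \<phi> K s \<eta> = \<gamma>))"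

lemma has_substitution_config:
  assumes "has_substitution C S I r K s \<phi> L" "configuration C S (\<phi> -` L \<inter> I) r c'"
    "configuration C S K s ct" "quotconfig I \<phi> L s c' = subconfig L s ct"
  obtains c where "configuration C S I r c" "subconfig (\<phi> -` L \<inter> I) r c = c'" "quotconfig I \<phi> K s c = ct"
  using assms unfolding has_substitution_def by blast

lemma has_substitution_morphism:
  assumes "has_substitution C S I r K s \<phi> L" "configuration C S I r c" "configuration C S I r d"
    "config_morphism C (\<phi> -` L \<inter> I) r (subconfig (\<phi> -` L \<inter> I) r c) (subconfig (\<phi> -` L \<inter> I) r d) b"
    "config_morphism C K s (quotconfig I \<phi> K s c) (quotconfig I \<phi> K s d) \<gamma>"
    "quotconfig_map I \<phi> L s b = subconfig_map L s \<gamma>"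
  shows "\<exists>!\<eta>. config_morphism C I r c d \<eta> \<and> subconfig_map (\<phi> -` L \<inter> I) r \<eta> = b \<and>
    quotconfig_map I \<phi> K s \<eta> = \<gamma>"
  using assms(1)[unfolded has_substitution_def, THEN conjunct2, rule_format, of c d b \<gamma>] assms(2-) by blast

lemma subconfig_map_eq [simp]: "F \<in> fsets J r \<Longrightarrow> subconfig_map J r \<alpha> F = \<alpha> F"
  and subconfig_eq [simp]: "F \<in> fsets J r \<Longrightarrow> cobj (subconfig J r c) F = cobj c F"
  and quotconfig_map_eq [simp]: "A \<in> fsets K s \<Longrightarrow> quotconfig_map I \<phi> K s \<alpha> A = \<alpha> (\<phi> -` A \<inter> I)"
  and quotconfig_eq [simp]: "A \<in> fsets K s \<Longrightarrow> cobj (quotconfig I \<phi> K s c) A = cobj c (\<phi> -` A \<inter> I)"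
  by (simp_all add: subconfig_map_reindex subconfig_reindex quotconfig_map_reindex quotconfig_reindex)

context poset_subst
begin

lemma image_pre: "A \<subseteq> K \<Longrightarrow> \<phi> ` pre A = A"
  using surj by auto

lemma fset_map_pre_sub:
  assumes A: "A \<in> fsets K s"
  shows "fset_map pre A s (pre A) r"
proof -
  have "pre A \<in> fsets I r" by (rule fset_mapD(1)[OF fset_map_pre A])
  then show ?thesis
    unfolding fset_map_def fsets_sub[OF A] fsets_sub[OF \<open>pre A \<in> fsets I r\<close>] Gpairs_sub[OF A]
      Gpairs_sub[OF \<open>pre A \<in> fsets I r\<close>] Hpairs_sub[OF A] Hpairs_sub[OF \<open>pre A \<in> fsets I r\<close>]
    using fset_mapD[OF fset_map_pre] by auto
qed

lemma sub_quot:
  assumes A: "A \<in> fsets K s"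
  shows "quotconfig I \<phi> A s (subconfig (pre A) r c) = subconfig A s (quotconfig I \<phi> K s c)"
    "quotconfig_map I \<phi> A s (subconfig_map (pre A) r \<alpha>) = subconfig_map A s (quotconfig_map I \<phi> K s \<alpha>)"
  by (simp_all add: subconfig_reindex quotconfig_reindex subconfig_map_reindex quotconfig_map_reindex
      reindex_reindex[OF fset_map_pre_sub[OF A]] reindex_reindex[OF fset_map_sub[OF A]])

lemma poset_subst_sub:
  assumes A: "A \<in> fsets K s" and LA: "L \<subseteq> A"
  shows "poset_subst (pre A) r A s \<phi> L"
proof unfold_locales
  show "\<phi> ` pre A = A" using image_pre fsetsD(1)[OF A] by auto
  show "L \<in> fsets A s" using L_fset LA by (simp add: fsets_sub[OF A])
qed (use refl_r trans_r antisym_r refl_s trans_s antisym_s mono below above fsetsD(1)[OF A] in auto)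

lemma poset_subst_larger:
  assumes A: "A \<in> fsets K s" and LA: "L \<subseteq> A"
  shows "poset_subst I r K s \<phi> A"
proof unfold_locales
  show "A \<in> fsets K s" by (rule A)
  show "(i, x) \<in> r" if "i \<in> I" "x \<in> I" "\<phi> x \<notin> A" "(\<phi> i, \<phi> x) \<in> s" for i x
    using below that LA by blast
  show "(x, i) \<in> r" if "i \<in> I" "x \<in> I" "\<phi> x \<notin> A" "(\<phi> x, \<phi> i) \<in> s" for i x
    using above that LA by blast
qed (use refl_r trans_r antisym_r refl_s trans_s antisym_s surj mono in auto)

end

subsection \<open>One new maximal element\<close>

locale top_step = exact_category C S + poset_subst I r K s \<phi> L
  for C :: "('o, 'm) cat" (structure) and S :: "'o set" and I :: "'i set" and r and K :: "'k set"
    and s and \<phi> and L +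
  fixes x :: 'i
  assumes x: "x \<in> I" and K_eq: "K = insert (\<phi> x) L" and x_L: "\<phi> x \<notin> L"
    and x_top: "\<And>l. l \<in> K \<Longrightarrow> (\<phi> x, l) \<in> s \<Longrightarrow> l = \<phi> x"
begin

sublocale up: exact_top_point C S I r x
proof unfold_locales
  show "i = x" if "i \<in> I" "(x, i) \<in> r" for i
    using inj_off_L[OF that(1) x x_L] x_top[of "\<phi> i"] mono[OF x that] surj that(1) by auto
qed (use refl_r trans_r x in auto)

sublocale dn: exact_top_point C S K s "\<phi> x"
  by unfold_locales (use refl_s trans_s x surj x_top in auto)

lemma dn_J: "dn.J = L"
  unfolding dn.J_def using x_L K_eq by auto

lemma up_J: "up.J = pre L"
  using inj_off_L[OF _ x x_L] surj K_eq x_L by (auto simp: up.J_def)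

text \<open>Outside \<open>L\<close> the map \<open>\<phi>\<close> reflects the order.\<close>

lemma pre_MN: "pre dn.M = up.M" "pre dn.N = up.N"
proof -
  have *: "(\<phi> i, \<phi> x) \<in> s \<longleftrightarrow> (i, x) \<in> r" if "i \<in> I" for i
    using below[OF that x x_L] mono[OF that x] by auto
  have "\<phi> i = \<phi> x \<longleftrightarrow> i = x" if "i \<in> I" for i using inj_off_L[OF that x x_L] by auto
  then show "pre dn.M = up.M" "pre dn.N = up.N"
    using * surj by (auto simp: dn.M_eq up.M_eq dn.N_eq up.N_eq)
qed

lemma MN: "dn.M \<in> fsets K s" "dn.N \<in> fsets L s" "dn.N \<in> fsets K s" "(dn.N, dn.M) \<in> Gpairs K s"
  "up.M \<in> fsets I r" "up.N \<in> fsets (pre L) r" "up.N \<in> fsets I r" "(up.N, up.M) \<in> Gpairs I r"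
  using dn.M_fset dn.N_fset dn.NM_Gpair up.M_fset up.N_fset up.NM_Gpair
    GpairsD(1)[OF dn.NM_Gpair] GpairsD(1)[OF up.NM_Gpair] by (simp_all add: dn_J up_J)

lemma quot_NM: "cinj (quotconfig I \<phi> K s c) (dn.N, dn.M) = cinj c (up.N, up.M)"
  using MN by (simp add: quotconfig_reindex pre_MN)

lemma preL_fset: "pre L \<in> fsets I r"
  by (rule fset_mapD(1)[OF fset_map_pre L_fset])

text \<open>Extend \<open>c'\<close> by the short exact sequence that \<open>ct\<close> has on \<open>M\<close>. The quotient of the result agrees with
  \<open>ct\<close> on \<open>L\<close> and, up to the isomorphism \<open>e\<close>, on \<open>M\<close>, so there is an isomorphism \<open>\<theta>\<close> between them that
  is the identity on \<open>L\<close>. Transport along \<open>\<theta>\<close>, extended by identities to the f-sets that are not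
  preimages, changes the quotient to \<open>ct\<close> and leaves the subconfiguration unchanged.\<close>

lemma substitute_config:
  assumes c': "configuration C S (pre L) r c'" and ct: "configuration C S K s ct"
    and eq: "quotconfig I \<phi> L s c' = subconfig L s ct"
  shows "\<exists>c. configuration C S I r c \<and> subconfig (pre L) r c = c' \<and> quotconfig I \<phi> K s c = ct"
proof -
  note t = configurationD[OF ct]
  define f where "f = cinj ct (dn.N, dn.M)"
  define g where "g = csurj ct (dn.M, dn.M - dn.N)"
  have fg: "short_exact C f g" unfolding f_def g_def by (rule t(13)[OF MN(4)])
  have f: "f \<in> Arr C" "Dom C f = cobj ct dn.N" "Cod C f = cobj ct dn.M"
    unfolding f_def using t MN by auto
  have eq_obj: "cobj ct A = cobj c' (pre A)" if "A \<in> fsets L s" for A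
    using arg_cong[OF eq, of "\<lambda>c. cobj c A"] that by simp
  have "Cod C g \<in> S" unfolding g_def using t Gpairs_Diff[OF MN(4)] HpairsD(2) by metis
  then obtain c e where c: "configuration C S I r c" "subconfig (pre L) r c = c'"
    and e: "iso_arr C e" "e \<in> Hom C (Cod C f) (cobj c up.M)" "e \<cdot> f = cinj c (up.N, up.M)"
    using up.ex_point_extension[unfolded up_J, OF c' fg] f eq_obj[OF MN(2)] pre_MN by auto
  define d where "d = quotconfig I \<phi> K s c"
  have d: "configuration C S K s d"
    unfolding d_def quotconfig_reindex by (rule configuration_reindex[OF c(1) fset_map_pre])
  have Ld: "subconfig L s d = subconfig L s ct"
    using sub_quot(1)[OF L_fset, of c] c(2) eq by (simp add: d_def)
  have Lct: "configuration C S L s (subconfig L s ct)"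
    unfolding subconfig_reindex by (rule configuration_reindex[OF ct fset_map_sub[OF L_fset]])
  let ?id = "config_Id C L s (subconfig L s ct)"
  note eA = HomD[OF e(2)] and dD = configurationD[OF d]
  have "inv_arr e \<cdot> cinj d (dn.N, dn.M) = f"
    using e eA f by (simp add: d_def quot_NM flip: e(3))
  then have "inv_arr e \<cdot> cinj d (dn.N, dn.M) = cinj ct (dn.N, dn.M) \<cdot> ?id dn.N"
    using f MN by (simp add: config_Id_def f_def)
  moreover have "inv_arr e \<in> Hom C (cobj d dn.M) (cobj ct dn.M)"
    using e(1) eA f MN by (simp add: Hom_def d_def pre_MN)
  ultimately obtain \<theta> where \<theta>: "config_iso C K s d ct \<theta>" "subconfig_map L s \<theta> = ?id"
    using dn.extend_iso[OF d ct, unfolded dn_J Ld, OF config_iso_Id[OF Lct] iso_inv_arr[OF e(1)]] by blast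
  note \<theta>m = config_morphismD[OF config_isoD(1)[OF \<theta>(1)]]
  \<comment> \<open>A preimage \<open>F = pre A\<close> determines \<open>A\<close> as \<open>\<phi> ` F\<close>, because \<open>\<phi>\<close> is surjective.\<close>
  define \<Theta> where "\<Theta> = (\<lambda>F \<in> fsets I r. if \<phi> ` F \<in> fsets K s \<and> F = pre (\<phi> ` F) then \<theta> (\<phi> ` F)
      else Ident C (cobj c F))"
  have \<Theta>_pre: "\<Theta> (pre A) = \<theta> A" if "A \<in> fsets K s" for A
    using that fset_mapD(1)[OF fset_map_pre that] image_pre[OF fsetsD(1)[OF that]] by (simp add: \<Theta>_def)
  have \<Theta>F: "iso_arr C (\<Theta> F) \<and> Dom C (\<Theta> F) = cobj c F \<and> Cod C (\<Theta> F) \<in> S" if F: "F \<in> fsets I r" for F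
  proof (cases "\<phi> ` F \<in> fsets K s \<and> F = pre (\<phi> ` F)")
    case True
    then have "cobj d (\<phi> ` F) = cobj c F" by (simp add: d_def)
    then show ?thesis
      using True F config_isoD(2)[OF \<theta>(1)] \<theta>m(2-4) t(1) by (simp add: \<Theta>_def)
  next
    case False
    then have "\<Theta> F = Ident C (cobj c F)" using F by (simp only: \<Theta>_def restrict_def if_False if_True)
    then show ?thesis using config_Obj[OF c(1) F] configurationD(1)[OF c(1) F] iso_Ident by simp
  qed
  have "Cod C (\<Theta> {}) = null C" using \<Theta>_pre[of "{}"] \<theta>m(4)[of "{}"] t(2) by simp
  moreover have "\<Theta> \<in> extensional (fsets I r)" by (simp add: \<Theta>_def)
  ultimately obtain c2 where c2: "configuration C S I r c2" "config_iso C I r c c2 \<Theta>"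
    using config_transport[OF c(1), of \<Theta>] \<Theta>F by blast
  have "quotconfig I \<phi> K s c2 = ct"
  proof (rule config_iso_target_unique[OF _ ct _ \<theta>(1)])
    show "configuration C S K s (quotconfig I \<phi> K s c2)"
      unfolding quotconfig_reindex by (rule configuration_reindex[OF c2(1) fset_map_pre])
    have "reindex_map pre K s \<Theta> = \<theta>"
      by (rule extensionalityI[OF _ \<theta>m(1)]) (auto simp: \<Theta>_pre)
    then show "config_iso C K s d (quotconfig I \<phi> K s c2) \<theta>"
      using config_iso_reindex[OF c2(2) fset_map_pre] by (simp add: d_def quotconfig_reindex)
  qed
  moreover have "subconfig (pre L) r c2 = c'"
  proof (rule config_iso_target_unique[OF _ c' _ config_iso_Id[OF c']])
    note sub = fset_map_sub[OF preL_fset]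
    show "configuration C S (pre L) r (subconfig (pre L) r c2)"
      unfolding subconfig_reindex by (rule configuration_reindex[OF c2(1) sub])
    have "reindex_map (\<lambda>A. A) (pre L) r \<Theta> = config_Id C (pre L) r c'"
    proof (rule extensionalityI)
      fix F assume FL: "F \<in> fsets (pre L) r"
      have F: "F \<in> fsets I r" "F \<subseteq> pre L" using FL by (auto simp: fsets_sub[OF preL_fset])
      have obj: "cobj c F = cobj c' F" using FL by (simp flip: c(2))
      have "\<Theta> F = Ident C (cobj c' F)"
      proof (cases "\<phi> ` F \<in> fsets K s \<and> F = pre (\<phi> ` F)")
        case True
        have A: "\<phi> ` F \<in> fsets L s" using True F(2) by (auto simp: fsets_sub[OF L_fset])
        have "\<Theta> F = \<theta> (\<phi> ` F)" using True \<Theta>_pre by metis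
        also have "\<dots> = Ident C (cobj ct (\<phi> ` F))"
          using fun_cong[OF \<theta>(2), of "\<phi> ` F"] A by (simp add: config_Id_def)
        also have "cobj ct (\<phi> ` F) = cobj c' F" using eq_obj[OF A] True by metis
        finally show ?thesis .
      next
        case False
        then show ?thesis using F obj by (simp only: \<Theta>_def restrict_def if_False if_True)
      qed
      then show "reindex_map (\<lambda>A. A) (pre L) r \<Theta> F = config_Id C (pre L) r c' F"
        using FL by (simp add: config_Id_def)
    qed (auto simp: config_Id_def)
    then show "config_iso C (pre L) r c' (subconfig (pre L) r c2) (config_Id C (pre L) r c')"
      using config_iso_reindex[OF c2(2) sub] c(2) by (simp add: subconfig_reindex)
  qed
  ultimately show ?thesis using c2(1) by blast
qed

text \<open>On \<open>I\<close> a morphism is determined by \<open>b\<close> and its component at \<open>M\<close>, which \<open>\<gamma>\<close> prescribes. The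
  induced morphism of quotients is \<open>\<gamma>\<close>, as on \<open>K\<close> too both are determined by their values on \<open>L\<close> and
  at \<open>M\<close>.\<close>

lemma substitute_morphism:
  assumes c: "configuration C S I r c" and d: "configuration C S I r d"
    and b: "config_morphism C (pre L) r (subconfig (pre L) r c) (subconfig (pre L) r d) b"
    and \<gamma>: "config_morphism C K s (quotconfig I \<phi> K s c) (quotconfig I \<phi> K s d) \<gamma>"
    and eq: "quotconfig_map I \<phi> L s b = subconfig_map L s \<gamma>"
  shows "\<exists>!\<eta>. config_morphism C I r c d \<eta> \<and> subconfig_map (pre L) r \<eta> = b \<and> quotconfig_map I \<phi> K s \<eta> = \<gamma>"
proof -
  let ?qc = "quotconfig I \<phi> K s c" and ?qd = "quotconfig I \<phi> K s d"
  have qc: "configuration C S K s ?qc" and qd: "configuration C S K s ?qd"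
    unfolding quotconfig_reindex
    by (rule configuration_reindex[OF c fset_map_pre], rule configuration_reindex[OF d fset_map_pre])
  have \<gamma>M: "\<gamma> dn.M \<in> Hom C (cobj c up.M) (cobj d up.M)"
    using config_morphismD(2-4)[OF \<gamma> MN(1)] MN by (simp add: Hom_def pre_MN)
  have "\<gamma> dn.N = b up.N" using fun_cong[OF eq, of "dn.N"] MN by (simp add: pre_MN)
  then have "\<gamma> dn.M \<cdot> cinj c (up.N, up.M) = cinj d (up.N, up.M) \<cdot> b up.N"
    using config_morphismD(5)[OF \<gamma> MN(4)] by (simp add: quot_NM)
  note ex1 = up.ex1_extend_morphism[OF c d, unfolded up_J, OF b \<gamma>M this]
  then obtain \<eta> where \<eta>: "config_morphism C I r c d \<eta>" "subconfig_map (pre L) r \<eta> = b" "\<eta> up.M = \<gamma> dn.M"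
    by blast
  have q\<eta>: "config_morphism C K s ?qc ?qd (quotconfig_map I \<phi> K s \<eta>)"
    unfolding quotconfig_reindex quotconfig_map_reindex by (rule config_morphism_reindex[OF \<eta>(1) fset_map_pre])
  have L\<gamma>: "config_morphism C dn.J s (subconfig dn.J s ?qc) (subconfig dn.J s ?qd) (subconfig_map L s \<gamma>)"
    unfolding dn_J subconfig_reindex subconfig_map_reindex
    by (rule config_morphism_reindex[OF \<gamma> fset_map_sub[OF L_fset]])
  have "\<gamma> dn.M \<in> Hom C (cobj ?qc dn.M) (cobj ?qd dn.M)"
    "\<gamma> dn.M \<cdot> cinj ?qc (dn.N, dn.M) = cinj ?qd (dn.N, dn.M) \<cdot> subconfig_map L s \<gamma> dn.N"
    using config_morphismD(2-5)[OF \<gamma>] MN by (auto simp: Hom_def)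
  note uniq = dn.ex1_extend_morphism[OF qc qd L\<gamma> this, unfolded dn_J]
  have "subconfig_map L s (quotconfig_map I \<phi> K s \<eta>) = subconfig_map L s \<gamma>"
    using sub_quot(2)[OF L_fset, of \<eta>] \<eta>(2) eq by simp
  moreover have "quotconfig_map I \<phi> K s \<eta> dn.M = \<gamma> dn.M" using \<eta>(3) MN by (simp add: pre_MN)
  ultimately have "quotconfig_map I \<phi> K s \<eta> = \<gamma>" using uniq q\<eta> \<gamma> by blast
  moreover have "\<eta>' up.M = \<gamma> dn.M" if "quotconfig_map I \<phi> K s \<eta>' = \<gamma>" for \<eta>'
    using that MN by (auto simp: pre_MN)
  ultimately show ?thesis using ex1 \<eta> by blast
qed

lemma has_substitution: "has_substitution C S I r K s \<phi> L"
  unfolding has_substitution_def using substitute_config substitute_morphism by blast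

end

subsection \<open>One new minimal element, and the general case\<close>

lemma has_substitution_dual:
  assumes h: "has_substitution (opp C) S I (r\<inverse>) K (s\<inverse>) \<phi> L"
  shows "has_substitution C S I r K s \<phi> L"
  unfolding has_substitution_def
proof (intro conjI allI impI; elim conjE)
  note re = subconfig_reindex quotconfig_reindex subconfig_map_reindex quotconfig_map_reindex
  fix c' ct assume a: "configuration C S (\<phi> -` L \<inter> I) r c'" "configuration C S K s ct"
    "quotconfig I \<phi> L s c' = subconfig L s ct"
  have "quotconfig I \<phi> L (s\<inverse>) (dual c') = subconfig L (s\<inverse>) (dual ct)"
    using a(3) by (simp add: re reindex_dual)
  then obtain c where c: "configuration (opp C) S I (r\<inverse>) c"
      "subconfig (\<phi> -` L \<inter> I) (r\<inverse>) c = dual c'" "quotconfig I \<phi> K (s\<inverse>) c = dual ct"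
    by (rule has_substitution_config[OF h configuration_dual[OF a(1)] configuration_dual[OF a(2)]])
  have "subconfig (\<phi> -` L \<inter> I) r (dual c) = c'" "quotconfig I \<phi> K s (dual c) = ct"
    using reindex_dual[of "\<lambda>A. A" _ "r\<inverse>" c] reindex_dual[of _ K "s\<inverse>" c] c(2,3) by (simp_all add: re)
  then show "\<exists>c. configuration C S I r c \<and> subconfig (\<phi> -` L \<inter> I) r c = c' \<and> quotconfig I \<phi> K s c = ct"
    using configuration_dual[OF c(1)] by (intro exI[of _ "dual c"]) simp
next
  note re = subconfig_reindex quotconfig_reindex subconfig_map_reindex quotconfig_map_reindex
  fix c d b \<gamma> assume a: "configuration C S I r c" "configuration C S I r d"
    "config_morphism C (\<phi> -` L \<inter> I) r (subconfig (\<phi> -` L \<inter> I) r c) (subconfig (\<phi> -` L \<inter> I) r d) b"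
    "config_morphism C K s (quotconfig I \<phi> K s c) (quotconfig I \<phi> K s d) \<gamma>"
    "quotconfig_map I \<phi> L s b = subconfig_map L s \<gamma>"
  have "\<exists>!\<eta>. config_morphism (opp C) I (r\<inverse>) (dual d) (dual c) \<eta> \<and>
      subconfig_map (\<phi> -` L \<inter> I) (r\<inverse>) \<eta> = b \<and> quotconfig_map I \<phi> K (s\<inverse>) \<eta> = \<gamma>"
    by (rule has_substitution_morphism[OF h configuration_dual[OF a(2)] configuration_dual[OF a(1)]])
      (use config_morphism_dual[OF a(3)] config_morphism_dual[OF a(4)] a(5)
        in \<open>simp_all add: re reindex_dual reindex_map_converse\<close>)
  then show "\<exists>!\<eta>. config_morphism C I r c d \<eta> \<and> subconfig_map (\<phi> -` L \<inter> I) r \<eta> = b \<and>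
      quotconfig_map I \<phi> K s \<eta> = \<gamma>"
    by (simp add: config_morphism_dual_iff re reindex_map_converse)
qed

text \<open>First substitute into \<open>A\<close>, then substitute the result into \<open>K\<close>.\<close>

lemma (in poset_subst) has_substitution_trans:
  fixes C :: "('o, 'm) cat"
  assumes A: "A \<in> fsets K s" and LA: "L \<subseteq> A"
    and h1: "has_substitution C S (pre A) r A s \<phi> L" and h2: "has_substitution C S I r K s \<phi> A"
  shows "has_substitution C S I r K s \<phi> L"
  unfolding has_substitution_def
proof (intro conjI allI impI; elim conjE)
  note re = subconfig_reindex quotconfig_reindex subconfig_map_reindex quotconfig_map_reindex
  have preL: "\<phi> -` L \<inter> pre A = pre L" using LA by auto
  have LAf: "L \<in> fsets A s" using L_fset LA by (simp add: fsets_sub[OF A])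
  note h1 = h1[unfolded has_substitution_def preL]
  have preA: "pre A \<in> fsets I r" by (rule fset_mapD(1)[OF fset_map_pre A])
  have preLA: "pre L \<in> fsets (pre A) r"
    using fset_mapD(1)[OF fset_map_pre L_fset] LA by (auto simp: fsets_sub[OF preA])
  have pre': "\<phi> -` B \<inter> pre A = pre B" if "B \<in> fsets B' s" "B' \<subseteq> A" for B B'
    using fsetsD(1)[OF that(1)] that(2) by auto
  have q: "quotconfig (pre A) \<phi> L s = quotconfig I \<phi> L s" "quotconfig_map (pre A) \<phi> L s = quotconfig_map I \<phi> L s"
    "quotconfig (pre A) \<phi> A s = quotconfig I \<phi> A s" "quotconfig_map (pre A) \<phi> A s = quotconfig_map I \<phi> A s"
    unfolding re using pre' LA by (intro reindex_cong; blast)+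
  have ss: "subconfig L s (subconfig A s e) = subconfig L s e" for e :: "('k, 'o, 'm) config"
    unfolding re by (simp add: reindex_reindex(1)[OF fset_map_sub[OF LAf]])
  have ssm: "subconfig_map L s (subconfig_map A s \<alpha>) = subconfig_map L s \<alpha>" for \<alpha> :: "'k set \<Rightarrow> 'm"
    unfolding re by (simp add: reindex_reindex(2)[OF fset_map_sub[OF LAf]])
  have tt: "subconfig (pre L) r (subconfig (pre A) r e) = subconfig (pre L) r e" for e :: "('i, 'o, 'm) config"
    unfolding re by (simp add: reindex_reindex(1)[OF fset_map_sub[OF preLA]])
  have ttm: "subconfig_map (pre L) r (subconfig_map (pre A) r \<alpha>) = subconfig_map (pre L) r \<alpha>" for \<alpha> :: "'i set \<Rightarrow> 'm"
    unfolding re by (simp add: reindex_reindex(2)[OF fset_map_sub[OF preLA]])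
  {
    fix c' ct assume a: "configuration C S (pre L) r c'" "configuration C S K s ct"
      "quotconfig I \<phi> L s c' = subconfig L s ct"
    have "configuration C S A s (subconfig A s ct)"
      unfolding re by (rule configuration_reindex[OF a(2) fset_map_sub[OF A]])
    with a obtain c1 where c1: "configuration C S (pre A) r c1" "subconfig (pre L) r c1 = c'"
        "quotconfig (pre A) \<phi> A s c1 = subconfig A s ct"
      using h1[THEN conjunct1, rule_format, of c' "subconfig A s ct"] by (auto simp: q ss)
    then obtain c where "configuration C S I r c" "subconfig (pre A) r c = c1" "quotconfig I \<phi> K s c = ct"
      using has_substitution_config[OF h2 c1(1) a(2)] by (auto simp: q)
    then show "\<exists>c. configuration C S I r c \<and> subconfig (pre L) r c = c' \<and> quotconfig I \<phi> K s c = ct"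
      using c1(2) tt[of c] by (intro exI[of _ c]) simp
  next
    fix c d b \<gamma> assume a: "configuration C S I r c" "configuration C S I r d"
      "config_morphism C (pre L) r (subconfig (pre L) r c) (subconfig (pre L) r d) b"
      "config_morphism C K s (quotconfig I \<phi> K s c) (quotconfig I \<phi> K s d) \<gamma>"
      "quotconfig_map I \<phi> L s b = subconfig_map L s \<gamma>"
    let ?c = "subconfig (pre A) r c" and ?d = "subconfig (pre A) r d" and ?\<gamma> = "subconfig_map A s \<gamma>"
    have cd: "configuration C S (pre A) r ?c" "configuration C S (pre A) r ?d"
      unfolding re using configuration_reindex[OF _ fset_map_sub[OF preA]] a by blast+
    have \<gamma>: "config_morphism C A s (quotconfig (pre A) \<phi> A s ?c) (quotconfig (pre A) \<phi> A s ?d) ?\<gamma>"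
      unfolding q sub_quot[OF A] using config_morphism_reindex[OF a(4) fset_map_sub[OF A]] by (simp add: re)
    have ex1: "\<exists>!\<beta>. config_morphism C (pre A) r ?c ?d \<beta> \<and> subconfig_map (pre L) r \<beta> = b \<and>
        quotconfig_map (pre A) \<phi> A s \<beta> = ?\<gamma>"
      using h1[THEN conjunct2, rule_format, of ?c ?d b ?\<gamma>] cd \<gamma> a(3,5) by (simp add: tt ss ssm q)
    then obtain \<beta> where \<beta>: "config_morphism C (pre A) r ?c ?d \<beta>" "subconfig_map (pre L) r \<beta> = b"
        "quotconfig_map I \<phi> A s \<beta> = ?\<gamma>" unfolding q by blast
    note ex2 = has_substitution_morphism[OF h2 a(1,2) \<beta>(1) a(4) \<beta>(3)]
    have "subconfig_map (pre A) r \<eta> = \<beta>"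
      if \<eta>: "config_morphism C I r c d \<eta>" "subconfig_map (pre L) r \<eta> = b" "quotconfig_map I \<phi> K s \<eta> = \<gamma>" for \<eta>
    proof -
      have "config_morphism C (pre A) r ?c ?d (subconfig_map (pre A) r \<eta>)"
        unfolding re by (rule config_morphism_reindex[OF \<eta>(1) fset_map_sub[OF preA]])
      moreover have "quotconfig_map I \<phi> A s (subconfig_map (pre A) r \<eta>) = ?\<gamma>"
        by (simp add: sub_quot(2)[OF A] \<eta>(3))
      ultimately show ?thesis using ex1 \<beta> \<eta>(2) ttm unfolding q by metis
    qed
    moreover have "subconfig_map (pre L) r \<eta> = b" if "subconfig_map (pre A) r \<eta> = \<beta>" for \<eta>
      using ttm[of \<eta>] that \<beta>(2) by simp
    ultimately show "\<exists>!\<eta>. config_morphism C I r c d \<eta> \<and> subconfig_map (pre L) r \<eta> = b \<and>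
        quotconfig_map I \<phi> K s \<eta> = \<gamma>"
      using ex2 by (smt (verit))
  }
qed

lemma ex_minimal:
  assumes "finite D" "D \<noteq> {}" "trans s" "antisym s"
  shows "\<exists>m\<in>D. \<forall>y\<in>D. (y, m) \<in> s \<longrightarrow> y = m"
  using assms(1,2)
proof (induction rule: finite_ne_induct)
  case (insert x F)
  then obtain m where m: "m \<in> F" "\<And>y. y \<in> F \<Longrightarrow> (y, m) \<in> s \<Longrightarrow> y = m" by blast
  show ?case
  proof (cases "(x, m) \<in> s")
    case True
    have "y = x" if y: "y \<in> F" "(y, x) \<in> s" for y
      using m(2)[OF y(1) transD[OF assms(3) y(2) True]] y(2) True antisymD[OF assms(4)] by blast
    then show ?thesis by blast
  qed (use m in blast)
qed simp

text \<open>If some element outside \<open>L\<close> lies below \<open>L\<close>, a maximal such element is added, and it is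
  minimal in the enlarged f-set; otherwise a minimal element outside \<open>L\<close> is added, and it is maximal.\<close>

lemma (in poset_subst) ex_next_fset:
  assumes "finite (K - L)" "L \<noteq> K"
  shows "\<exists>k \<in> K - L. insert k L \<in> fsets K s \<and>
    ((\<forall>l \<in> L. (k, l) \<notin> s) \<or> (\<forall>l \<in> L. (l, k) \<notin> s))"
proof (cases "\<exists>k \<in> K - L. \<exists>l \<in> L. (k, l) \<in> s")
  note tr = transD[OF trans_s] and cv = fsetsD[OF L_fset]
  case True
  define D where "D = {k \<in> K - L. \<exists>l \<in> L. (k, l) \<in> s}"
  have "finite D" "D \<noteq> {}" using True finite_subset[OF _ assms(1), of D] by (auto simp: D_def)
  then obtain k where kD: "k \<in> D" and kmax: "\<And>y. y \<in> D \<Longrightarrow> (k, y) \<in> s \<Longrightarrow> y = k"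
    using ex_minimal[of D "s\<inverse>"] trans_s antisym_s by auto
  obtain l where l: "l \<in> L" "(k, l) \<in> s" "k \<in> K" "k \<notin> L" using kD by (auto simp: D_def)
  have bot: "(h, k) \<notin> s" if "h \<in> L" for h using cv(2)[OF that l(1,3) _ l(2)] l(4) by blast
  have "insert k L \<in> fsets K s"
  proof (rule fsetsI)
    fix h i j assume h: "h \<in> insert k L" "j \<in> insert k L" "i \<in> K" "(h, i) \<in> s" "(i, j) \<in> s"
    obtain l' where l': "l' \<in> L" "(i, l') \<in> s" using h(2,5) l tr by blast
    show "i \<in> insert k L"
    proof (cases "h = k")
      case True
      then show ?thesis using kmax[of i] h(3,4) l' by (auto simp: D_def)
    next
      case False
      then show ?thesis using cv(2)[of h l' i] h l' by blast
    qed
  qed (use l cv(1) in auto)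
  then show ?thesis using l bot by blast
next
  note tr = transD[OF trans_s] and cv = fsetsD[OF L_fset]
  case False
  have "K - L \<noteq> {}" using cv(1) assms(2) by blast
  then obtain k where k: "k \<in> K - L" "\<And>y. y \<in> K - L \<Longrightarrow> (y, k) \<in> s \<Longrightarrow> y = k"
    using ex_minimal[OF assms(1) _ trans_s antisym_s] by blast
  have "insert k L \<in> fsets K s"
  proof (rule fsetsI)
    fix h i j assume h: "h \<in> insert k L" "j \<in> insert k L" "i \<in> K" "(h, i) \<in> s" "(i, j) \<in> s"
    show "i \<in> insert k L"
    proof (cases "i \<in> L")
      case iL: False
      then have "j = k" using False h by blast
      then show ?thesis using k(2)[of i] h iL by blast
    qed simp
  qed (use k cv(1) in auto)
  then show ?thesis using k(1) False by blast
qed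

theorem (in exact_category) poset_subst_has_substitution:
  fixes I :: "'i set" and K :: "'k set"
  assumes "poset_subst I r K s \<phi> L" "finite (K - L)"
  shows "has_substitution C S I r K s \<phi> L"
  using assms
proof (induction "card (K - L)" arbitrary: L rule: less_induct)
  case less
  interpret poset_subst I r K s \<phi> L by (rule less.prems)
  show ?case
  proof (cases "L = K")
    case True
    have pre: "pre K = I" using surj by auto
    note re = subconfig_reindex quotconfig_reindex subconfig_map_reindex quotconfig_map_reindex
    have sc: "subconfig J t e = e" if "configuration C S J t e"
      for J :: "'x set" and t and e :: "('x, 'a, 'b) config"
      using configuration_ext[OF that] by (simp add: subconfig_def extensional_restrict)
    have sm: "subconfig_map J t \<alpha> = \<alpha>" if "config_morphism C J t e e' \<alpha>"
      for J :: "'x set" and t and e e' :: "('x, 'a, 'b) config" and \<alpha>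
      using config_morphismD(1)[OF that] by (simp add: subconfig_map_def extensional_restrict)
    show ?thesis
      unfolding has_substitution_def True pre
    proof (intro conjI allI impI; elim conjE)
      fix c' ct assume "configuration C S I r c'" "configuration C S K s ct"
        "quotconfig I \<phi> K s c' = subconfig K s ct"
      then show "\<exists>c. configuration C S I r c \<and> subconfig I r c = c' \<and> quotconfig I \<phi> K s c = ct"
        using sc by metis
    next
      fix c d b \<gamma> assume "configuration C S I r c" "configuration C S I r d"
        "config_morphism C I r (subconfig I r c) (subconfig I r d) b"
        "config_morphism C K s (quotconfig I \<phi> K s c) (quotconfig I \<phi> K s d) \<gamma>"
        "quotconfig_map I \<phi> K s b = subconfig_map K s \<gamma>"
      then show "\<exists>!\<eta>. config_morphism C I r c d \<eta> \<and> subconfig_map I r \<eta> = b \<and> quotconfig_map I \<phi> K s \<eta> = \<gamma>"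
        using sc sm by metis
    qed
  next
    case False
    obtain k where k: "k \<in> K - L" "insert k L \<in> fsets K s"
        "(\<forall>l \<in> L. (k, l) \<notin> s) \<or> (\<forall>l \<in> L. (l, k) \<notin> s)"
      using ex_next_fset[OF less.prems(2) False] by blast
    define A where "A = insert k L"
    have A: "A \<in> fsets K s" "L \<subseteq> A" using k by (auto simp: A_def)
    have "card (K - A) < card (K - L)"
      using k(1) less.prems(2) by (intro psubset_card_mono) (auto simp: A_def)
    then have h2: "has_substitution C S I r K s \<phi> A"
      using less.prems(2) by (intro less.hyps poset_subst_larger[OF A]) (auto intro: finite_subset simp: A_def)
    have sub: "poset_subst (pre A) r A s \<phi> L" by (rule poset_subst_sub[OF A])
    obtain x where x: "x \<in> I" "\<phi> x = k" using k(1) surj by blast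
    have "has_substitution C S (pre A) r A s \<phi> L"
      using k(3)
    proof
      assume top: "\<forall>l \<in> L. (k, l) \<notin> s"
      interpret sub: poset_subst "pre A" r A s \<phi> L by (rule sub)
      interpret top_step C S "pre A" r A s \<phi> L x
        by unfold_locales (use x k(1) top in \<open>auto simp: A_def\<close>)
      show ?thesis by (rule has_substitution)
    next
      assume bot: "\<forall>l \<in> L. (l, k) \<notin> s"
      interpret op: exact_category "opp C" S by (rule exact_category_opp)
      interpret sub: poset_subst "pre A" "r\<inverse>" A "s\<inverse>" \<phi> L by (rule poset_subst.poset_subst_converse[OF sub])
      interpret top_step "opp C" S "pre A" "r\<inverse>" A "s\<inverse>" \<phi> L x
        by unfold_locales (use x k(1) bot in \<open>auto simp: A_def\<close>)
      show ?thesis by (rule has_substitution_dual[OF has_substitution])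
    qed
    then show ?thesis by (rule has_substitution_trans[OF A _ h2])
  qed
qed

section \<open>Canonical isomorphisms and the theorem\<close>

locale substitution = exact_category C S + poset_subst I r K s \<phi> L
  for C :: "('o, 'm) cat" (structure) and S :: "'o set" and I :: "'i set" and r and K :: "'k set"
    and s and \<phi> and L +
  assumes finite_off_L: "finite (K - L)"
begin

lemma substitutes: "has_substitution C S I r K s \<phi> L"
  by (rule poset_subst_has_substitution) (unfold_locales, rule finite_off_L)

lemma preL_fset: "pre L \<in> fsets I r"
  by (rule fset_mapD(1)[OF fset_map_pre L_fset])

lemma sub_configuration: "configuration C S I r c \<Longrightarrow> configuration C S (pre L) r (subconfig (pre L) r c)"
  unfolding subconfig_reindex by (rule configuration_reindex[OF _ fset_map_sub[OF preL_fset]])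

lemma quot_configuration: "configuration C S I r c \<Longrightarrow> configuration C S K s (quotconfig I \<phi> K s c)"
  unfolding quotconfig_reindex by (rule configuration_reindex[OF _ fset_map_pre])

lemma sub_map_Comp: "subconfig_map (pre L) r (config_Comp C I r \<beta> \<alpha>) =
    config_Comp C (pre L) r (subconfig_map (pre L) r \<beta>) (subconfig_map (pre L) r \<alpha>)"
  by (simp add: subconfig_map_reindex reindex_map_Comp[OF fset_map_sub[OF preL_fset]])

lemma quot_map_Comp: "quotconfig_map I \<phi> K s (config_Comp C I r \<beta> \<alpha>) =
    config_Comp C K s (quotconfig_map I \<phi> K s \<beta>) (quotconfig_map I \<phi> K s \<alpha>)"
  by (simp add: quotconfig_map_reindex reindex_map_Comp[OF fset_map_pre])

lemma sub_map_Id: "subconfig_map (pre L) r (config_Id C I r c) = config_Id C (pre L) r (subconfig (pre L) r c)"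
  by (simp add: subconfig_map_reindex subconfig_reindex reindex_map_Id[OF fset_map_sub[OF preL_fset]])

lemma quot_map_Id: "quotconfig_map I \<phi> K s (config_Id C I r c) = config_Id C K s (quotconfig I \<phi> K s c)"
  by (simp add: quotconfig_map_reindex quotconfig_reindex reindex_map_Id[OF fset_map_pre])

lemma compat_eqI:
  assumes "\<And>A. A \<in> fsets L s \<Longrightarrow> b (pre A) = \<gamma> A"
  shows "quotconfig_map I \<phi> L s b = subconfig_map L s \<gamma>"
  using assms by (auto simp: quotconfig_map_def subconfig_map_def fun_eq_iff restrict_def)

lemma compatD:
  "quotconfig_map I \<phi> L s b = subconfig_map L s \<gamma> \<Longrightarrow> A \<in> fsets L s \<Longrightarrow> b (pre A) = \<gamma> A"
  by (drule fun_cong[of _ _ A]) simp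

lemma L_fsets: "A \<in> fsets L s \<Longrightarrow> A \<in> fsets K s" "A \<in> fsets L s \<Longrightarrow> pre A \<in> fsets (pre L) r"
  using fset_mapD(1)[OF fset_map_pre] by (auto simp: fsets_sub[OF L_fset] fsets_sub[OF preL_fset])

lemma endomorphism_eq_Id:
  assumes c: "configuration C S I r c" and \<eta>: "config_morphism C I r c c \<eta>"
    and "subconfig_map (pre L) r \<eta> = config_Id C (pre L) r (subconfig (pre L) r c)"
    and "quotconfig_map I \<phi> K s \<eta> = config_Id C K s (quotconfig I \<phi> K s c)"
  shows "\<eta> = config_Id C I r c"
proof -
  have "quotconfig_map I \<phi> L s (config_Id C (pre L) r (subconfig (pre L) r c)) =
      subconfig_map L s (config_Id C K s (quotconfig I \<phi> K s c))"
    using L_fsets by (intro compat_eqI) (simp add: config_Id_def)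
  from has_substitution_morphism[OF substitutes c c config_Id_morphism[OF sub_configuration[OF c]]
      config_Id_morphism[OF quot_configuration[OF c]] this]
  show ?thesis using assms sub_map_Id[of c] quot_map_Id[of c] config_Id_morphism[OF c] by blast
qed

text \<open>The inverses of \<open>b\<close> and \<open>\<gamma>\<close> have a common extension as well. Its composites with \<open>\<eta>\<close> extend
  identities and are identities by uniqueness.\<close>

lemma ex1_canonical_iso:
  assumes c: "configuration C S I r c" and d: "configuration C S I r d"
    and b: "config_iso C (pre L) r (subconfig (pre L) r c) (subconfig (pre L) r d) b"
    and \<gamma>: "config_iso C K s (quotconfig I \<phi> K s c) (quotconfig I \<phi> K s d) \<gamma>"
    and eq: "quotconfig_map I \<phi> L s b = subconfig_map L s \<gamma>"
  shows "\<exists>!\<eta>. config_iso C I r c d \<eta> \<and> subconfig_map (pre L) r \<eta> = b \<and> quotconfig_map I \<phi> K s \<eta> = \<gamma>"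
proof -
  note sc = sub_configuration[OF c] sub_configuration[OF d] and qc = quot_configuration[OF c] quot_configuration[OF d]
  note ib = config_iso_inv[OF sc b] and i\<gamma> = config_iso_inv[OF qc \<gamma>]
  note ex1 = has_substitution_morphism[OF substitutes c d config_isoD(1)[OF b] config_isoD(1)[OF \<gamma>] eq]
  obtain \<eta> where \<eta>: "config_morphism C I r c d \<eta>" "subconfig_map (pre L) r \<eta> = b" "quotconfig_map I \<phi> K s \<eta> = \<gamma>"
    using ex1 by blast
  have "quotconfig_map I \<phi> L s (config_inv (pre L) r b) = subconfig_map L s (config_inv K s \<gamma>)"
    using L_fsets compatD[OF eq] by (intro compat_eqI) (simp add: config_inv_def)
  from has_substitution_morphism[OF substitutes d c config_isoD(1)[OF ib(1)] config_isoD(1)[OF i\<gamma>(1)] this]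
  obtain \<zeta> where \<zeta>: "config_morphism C I r d c \<zeta>" "subconfig_map (pre L) r \<zeta> = config_inv (pre L) r b"
    "quotconfig_map I \<phi> K s \<zeta> = config_inv K s \<gamma>" by blast
  have "config_Comp C I r \<zeta> \<eta> = config_Id C I r c"
    by (rule endomorphism_eq_Id[OF c config_morphism_Comp[OF c d c \<eta>(1) \<zeta>(1)]])
      (simp_all add: sub_map_Comp quot_map_Comp \<eta> \<zeta> ib i\<gamma>)
  moreover have "config_Comp C I r \<eta> \<zeta> = config_Id C I r d"
    by (rule endomorphism_eq_Id[OF d config_morphism_Comp[OF d c d \<zeta>(1) \<eta>(1)]])
      (simp_all add: sub_map_Comp quot_map_Comp \<eta> \<zeta> ib i\<gamma>)
  ultimately have "config_iso C I r c d \<eta>" by (rule config_isoI[OF c d \<eta>(1) \<zeta>(1)])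
  then show ?thesis using ex1 \<eta> config_isoD(1) by blast
qed

lemma config_Comp_inv_iff:
  assumes x: "configuration C S J t x" and y: "configuration C S J t y" and b: "config_iso C J t x y b"
    and m: "config_morphism C J t z x m" and a: "config_morphism C J t z y a"
  shows "config_Comp C J t b m = a \<longleftrightarrow> m = config_Comp C J t (config_inv J t b) a"
proof
  note bm = config_isoD(1)[OF b] and i = config_iso_inv[OF x y b]
  note im = config_isoD(1)[OF i(1)]
  show "m = config_Comp C J t (config_inv J t b) a" if "config_Comp C J t b m = a"
    using config_Comp_assoc[OF m bm im] that i(2) config_Comp_Id(2)[OF m] by simp
  show "config_Comp C J t b m = a" if "m = config_Comp C J t (config_inv J t b) a"
    using config_Comp_assoc[OF a im bm] that i(3) config_Comp_Id(2)[OF a] by simp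
qed

text \<open>Transport \<open>ct\<close> along \<open>\<alpha>\<close> on the f-sets in \<open>L\<close> and along identities on the others. The result restricts
  on \<open>L\<close> to the quotient of \<open>c'\<close>, so that the untwisted case applies.\<close>

lemma ex_twisted_substitution:
  assumes c': "configuration C S (pre L) r c'" and ct: "configuration C S K s ct"
    and \<alpha>: "config_iso C L s (subconfig L s ct) (quotconfig I \<phi> L s c') \<alpha>"
  shows "\<exists>c \<beta> \<gamma>. configuration C S I r c \<and> config_iso C (pre L) r (subconfig (pre L) r c) c' \<beta> \<and>
    config_iso C K s (quotconfig I \<phi> K s c) ct \<gamma> \<and>
    config_Comp C L s \<alpha> (subconfig_map L s \<gamma>) = quotconfig_map I \<phi> L s \<beta>"
proof -
  note a = config_morphismD[OF config_isoD(1)[OF \<alpha>]]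
  have a': "\<alpha> A \<in> Arr C" "Dom C (\<alpha> A) = cobj ct A" "Cod C (\<alpha> A) = cobj c' (pre A)" "iso_arr C (\<alpha> A)"
    if "A \<in> fsets L s" for A
    using a(2-4)[OF that] config_isoD(2)[OF \<alpha> that] that by simp_all
  define \<theta> where "\<theta> = (\<lambda>A \<in> fsets K s. if A \<in> fsets L s then \<alpha> A else Ident C (cobj ct A))"
  have \<theta>: "iso_arr C (\<theta> A)" "Dom C (\<theta> A) = cobj ct A" "Cod C (\<theta> A) \<in> S" if "A \<in> fsets K s" for A
    using a' iso_Ident config_Obj[OF ct that] configurationD(1)[OF ct that] configurationD(1)[OF c' L_fsets(2)] that
    by (auto simp: \<theta>_def)
  have "Cod C (\<theta> {}) = null C" using a'(3)[of "{}"] configurationD(2)[OF c'] by (simp add: \<theta>_def)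
  then obtain cu where cu: "configuration C S K s cu" "config_iso C K s ct cu \<theta>"
    using config_transport[OF ct, of \<theta>] \<theta> by (auto simp: \<theta>_def)
  have "quotconfig I \<phi> L s c' = subconfig L s cu"
  proof (rule config_iso_target_unique[OF _ _ \<alpha>])
    have "fset_map pre L s (pre L) r" by (rule fset_map_pre_sub[OF L_fset])
    then show "configuration C S L s (quotconfig I \<phi> L s c')"
      unfolding quotconfig_reindex by (rule configuration_reindex[OF c'])
    note sub = fset_map_sub[OF L_fset]
    show "configuration C S L s (subconfig L s cu)"
      unfolding subconfig_reindex by (rule configuration_reindex[OF cu(1) sub])
    have "reindex_map (\<lambda>A. A) L s \<theta> = \<alpha>"
      by (rule extensionalityI[OF _ a(1)]) (auto simp: \<theta>_def L_fsets)
    then show "config_iso C L s (subconfig L s ct) (subconfig L s cu) \<alpha>"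
      using config_iso_reindex[OF cu(2) sub] by (simp add: subconfig_reindex)
  qed
  then obtain c where c: "configuration C S I r c" "subconfig (pre L) r c = c'" "quotconfig I \<phi> K s c = cu"
    by (rule has_substitution_config[OF substitutes c' cu(1)])
  have "config_Comp C L s \<alpha> (subconfig_map L s (config_inv K s \<theta>)) = quotconfig_map I \<phi> L s (config_Id C (pre L) r c')"
    using a' L_fsets by (auto simp: config_Comp_def quotconfig_map_def config_inv_def config_Id_def \<theta>_def fun_eq_iff restrict_def subconfig_map_def)
  then show ?thesis
    using c config_iso_Id[OF c'] config_iso_inv(1)[OF ct cu] by blast
qed

text \<open>The conditions say that \<open>\<eta>\<close> extends \<open>\<beta>'\<^sup>-\<^sup>1 \<cdot> \<beta>\<close> and \<open>\<gamma>'\<^sup>-\<^sup>1 \<cdot> \<gamma>\<close>. These agree on \<open>L\<close>, since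
  \<open>\<beta> = \<alpha> \<cdot> \<gamma>\<close> and \<open>\<beta>' = \<alpha> \<cdot> \<gamma>'\<close> there.\<close>

lemma ex1_twisted_iso:
  assumes c': "configuration C S (pre L) r c'" and ct: "configuration C S K s ct"
    and \<alpha>: "config_iso C L s (subconfig L s ct) (quotconfig I \<phi> L s c') \<alpha>"
    and c: "configuration C S I r c" "config_iso C (pre L) r (subconfig (pre L) r c) c' \<beta>"
      "config_iso C K s (quotconfig I \<phi> K s c) ct \<gamma>"
      "config_Comp C L s \<alpha> (subconfig_map L s \<gamma>) = quotconfig_map I \<phi> L s \<beta>"
    and d: "configuration C S I r d" "config_iso C (pre L) r (subconfig (pre L) r d) c' \<beta>'"
      "config_iso C K s (quotconfig I \<phi> K s d) ct \<gamma>'"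
      "config_Comp C L s \<alpha> (subconfig_map L s \<gamma>') = quotconfig_map I \<phi> L s \<beta>'"
  shows "\<exists>!\<eta>. config_iso C I r c d \<eta> \<and> config_Comp C (pre L) r \<beta>' (subconfig_map (pre L) r \<eta>) = \<beta> \<and>
    config_Comp C K s \<gamma>' (quotconfig_map I \<phi> K s \<eta>) = \<gamma>"
proof -
  note sc = sub_configuration[OF c(1)] sub_configuration[OF d(1)]
    and qc = quot_configuration[OF c(1)] quot_configuration[OF d(1)]
  let ?b = "config_Comp C (pre L) r (config_inv (pre L) r \<beta>') \<beta>"
  let ?g = "config_Comp C K s (config_inv K s \<gamma>') \<gamma>"
  have b: "config_iso C (pre L) r (subconfig (pre L) r c) (subconfig (pre L) r d) ?b"
    by (rule config_iso_Comp[OF sc(1) c' sc(2) c(2) config_iso_inv(1)[OF sc(2) c' d(2)]])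
  have g: "config_iso C K s (quotconfig I \<phi> K s c) (quotconfig I \<phi> K s d) ?g"
    by (rule config_iso_Comp[OF qc(1) ct qc(2) c(3) config_iso_inv(1)[OF qc(2) ct d(3)]])
  have "quotconfig_map I \<phi> L s ?b = subconfig_map L s ?g"
  proof (rule compat_eqI)
    fix A assume A: "A \<in> fsets L s"
    note f = L_fsets[OF A]
    have \<alpha>A: "\<alpha> A \<in> Arr C" "Dom C (\<alpha> A) = cobj ct A"
      using config_morphismD(2,3)[OF config_isoD(1)[OF \<alpha>] A] A by simp_all
    have e: "\<alpha> A \<cdot> \<gamma> A = \<beta> (pre A)" "\<alpha> A \<cdot> \<gamma>' A = \<beta>' (pre A)"
      using fun_cong[OF c(4), of A] fun_cong[OF d(4), of A] A by (simp_all add: config_Comp_def)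
    have qA: "cobj (quotconfig I \<phi> K s c) A = cobj c (pre A)" "cobj (quotconfig I \<phi> K s d) A = cobj d (pre A)"
      using f(1) by simp_all
    have sA: "cobj (subconfig (pre L) r d) (pre A) = cobj d (pre A)" using f(2) by simp
    note G = config_morphismD(2-4)[OF config_isoD(1)[OF c(3)] f(1), unfolded qA]
    note G' = config_morphismD(2-4)[OF config_isoD(1)[OF d(3)] f(1), unfolded qA]
    note B' = config_morphismD(2-4)[OF config_isoD(1)[OF d(2)] f(2), unfolded sA]
    note i\<gamma> = config_isoD(2)[OF d(3) f(1)] and i\<beta> = config_isoD(2)[OF d(2) f(2)]
    have "\<beta> (pre A) = \<alpha> A \<cdot> \<gamma>' A \<cdot> inv_arr (\<gamma>' A) \<cdot> \<gamma> A"
      using \<alpha>A G G' i\<gamma> by (simp flip: e(1))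
    also have "\<dots> = \<beta>' (pre A) \<cdot> inv_arr (\<gamma>' A) \<cdot> \<gamma> A"
      by (rule Comp_eq[OF e(2)]) (use \<alpha>A G G' i\<gamma> in simp_all)
    finally have "inv_arr (\<beta>' (pre A)) \<cdot> \<beta> (pre A) = inv_arr (\<gamma>' A) \<cdot> \<gamma> A"
      using B' G G' i\<gamma> i\<beta> by simp
    then show "?b (pre A) = ?g A" using f by (simp add: config_Comp_def config_inv_def)
  qed
  from ex1_canonical_iso[OF c(1) d(1) b g this]
  have ex1: "\<exists>!\<eta>. config_iso C I r c d \<eta> \<and> subconfig_map (pre L) r \<eta> = ?b \<and> quotconfig_map I \<phi> K s \<eta> = ?g" .
  have "config_Comp C (pre L) r \<beta>' (subconfig_map (pre L) r \<eta>) = \<beta> \<longleftrightarrow> subconfig_map (pre L) r \<eta> = ?b"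
    "config_Comp C K s \<gamma>' (quotconfig_map I \<phi> K s \<eta>) = \<gamma> \<longleftrightarrow> quotconfig_map I \<phi> K s \<eta> = ?g"
    if "config_iso C I r c d \<eta>" for \<eta>
  proof -
    have s: "config_morphism C (pre L) r (subconfig (pre L) r c) (subconfig (pre L) r d) (subconfig_map (pre L) r \<eta>)"
      unfolding subconfig_reindex subconfig_map_reindex
      by (rule config_morphism_reindex[OF config_isoD(1)[OF that] fset_map_sub[OF preL_fset]])
    have q: "config_morphism C K s (quotconfig I \<phi> K s c) (quotconfig I \<phi> K s d) (quotconfig_map I \<phi> K s \<eta>)"
      unfolding quotconfig_reindex quotconfig_map_reindex
      by (rule config_morphism_reindex[OF config_isoD(1)[OF that] fset_map_pre])
    show "config_Comp C (pre L) r \<beta>' (subconfig_map (pre L) r \<eta>) = \<beta> \<longleftrightarrow> subconfig_map (pre L) r \<eta> = ?b"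
      by (rule config_Comp_inv_iff[OF sc(2) c' d(2) s config_isoD(1)[OF c(2)]])
    show "config_Comp C K s \<gamma>' (quotconfig_map I \<phi> K s \<eta>) = \<gamma> \<longleftrightarrow> quotconfig_map I \<phi> K s \<eta> = ?g"
      by (rule config_Comp_inv_iff[OF qc(2) ct d(3) q config_isoD(1)[OF c(3)]])
  qed
  then have "(config_iso C I r c d \<eta> \<and> config_Comp C (pre L) r \<beta>' (subconfig_map (pre L) r \<eta>) = \<beta> \<and>
      config_Comp C K s \<gamma>' (quotconfig_map I \<phi> K s \<eta>) = \<gamma>) \<longleftrightarrow>
      (config_iso C I r c d \<eta> \<and> subconfig_map (pre L) r \<eta> = ?b \<and> quotconfig_map I \<phi> K s \<eta> = ?g)" for \<eta>
    by blast
  then show ?thesis using ex1 by simp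
qed

end

lemma poset_subst_subst_le:
  assumes leJ: "partial_order_on J leJ" and leK: "partial_order_on K leK"
    and L: "L \<in> fsets K leK" and disj: "J \<inter> (K - L) = {}" and surj: "\<psi> ` J = L"
    and mono: "\<And>i j. i \<in> J \<Longrightarrow> j \<in> J \<Longrightarrow> (i, j) \<in> leJ \<Longrightarrow> (\<psi> i, \<psi> j) \<in> leK"
  shows "poset_subst (J \<union> (K - L)) (subst_le J leJ K leK L \<psi>) K leK (subst_map J \<psi>) L"
proof -
  note po = partial_order_onD[OF partial_order_on_subst_le[OF leJ leK L disj surj mono]]
  note poK = partial_order_onD[OF leK]
  show ?thesis
  proof unfold_locales
    show "(subst_map J \<psi> i, subst_map J \<psi> j) \<in> leK" if "(i, j) \<in> subst_le J leJ K leK L \<psi>" for i j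
      by (rule subst_map_mono[OF leJ leK L disj surj mono that])
    fix i x assume i: "i \<in> J \<union> (K - L)" and x: "x \<in> J \<union> (K - L)" and "subst_map J \<psi> x \<notin> L"
    then have "x \<in> K - L" "x \<notin> J" using surj by (auto simp: subst_map_def)
    then show "(subst_map J \<psi> i, subst_map J \<psi> x) \<in> leK \<Longrightarrow> (i, x) \<in> subst_le J leJ K leK L \<psi>"
      "(subst_map J \<psi> x, subst_map J \<psi> i) \<in> leK \<Longrightarrow> (x, i) \<in> subst_le J leJ K leK L \<psi>"
      using i by (auto simp: subst_map_def subst_le_def split: if_splits)
  qed (use po poK L subst_map_surj[OF leJ leK L disj surj mono] in \<open>auto simp: refl_on_def\<close>)
qed

theorem theorem5p5:
  fixes C :: "('o, 'm) cat" and S :: "'o set"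
    and J K L I :: "'a set" and leJ leK le :: "'a rel" and \<psi> \<phi> :: "'a \<Rightarrow> 'a"
    and c' ct :: "('a, 'o, 'm) config"
  assumes "exact_category C S"
    and "finite J" and "partial_order_on J leJ"
    and "finite K" and "partial_order_on K leK"
    and "L \<in> fsets K leK"
    and "J \<inter> (K - L) = {}"
    and "\<psi> ` J = L"
    and "\<And>i j. i \<in> J \<Longrightarrow> j \<in> J \<Longrightarrow> (i, j) \<in> leJ \<Longrightarrow> (\<psi> i, \<psi> j) \<in> leK"
    and "I = J \<union> (K - L)"
    and "le = subst_le J leJ K leK L \<psi>"
    and "\<phi> = subst_map J \<psi>"
    and "configuration C S J leJ c'"
    and "configuration C S K leK ct"
  shows
    "(quotconfig J \<psi> L leK c' = subconfig L leK ct \<longrightarrow>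
       (\<exists>c. configuration C S I le c \<and>
          subconfig J leJ c = c' \<and> quotconfig I \<phi> K leK c = ct) \<and>
       (\<forall>c1 c2.
          configuration C S I le c1 \<and>
          subconfig J leJ c1 = c' \<and> quotconfig I \<phi> K leK c1 = ct \<and>
          configuration C S I le c2 \<and>
          subconfig J leJ c2 = c' \<and> quotconfig I \<phi> K leK c2 = ct \<longrightarrow>
          (\<exists>!\<eta>. config_iso C I le c1 c2 \<eta> \<and>
             subconfig_map J leJ \<eta> = config_Id C J leJ c' \<and>
             quotconfig_map I \<phi> K leK \<eta> = config_Id C K leK ct)))
     \<and>
     (\<forall>c. configuration C S I le c \<longrightarrow>
       quotconfig J \<psi> L leK (subconfig J leJ c) = subconfig L leK (quotconfig I \<phi> K leK c))
     \<and>
     (\<forall>\<alpha>. config_iso C L leK (subconfig L leK ct) (quotconfig J \<psi> L leK c') \<alpha> \<longrightarrow>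
       (\<exists>c \<beta> \<gamma>. configuration C S I le c \<and>
          config_iso C J leJ (subconfig J leJ c) c' \<beta> \<and>
          config_iso C K leK (quotconfig I \<phi> K leK c) ct \<gamma> \<and>
          config_Comp C L leK \<alpha> (subconfig_map L leK \<gamma>) = quotconfig_map J \<psi> L leK \<beta>) \<and>
       (\<forall>c1 \<beta>1 \<gamma>1 c2 \<beta>2 \<gamma>2.
          configuration C S I le c1 \<and>
          config_iso C J leJ (subconfig J leJ c1) c' \<beta>1 \<and>
          config_iso C K leK (quotconfig I \<phi> K leK c1) ct \<gamma>1 \<and>
          config_Comp C L leK \<alpha> (subconfig_map L leK \<gamma>1) = quotconfig_map J \<psi> L leK \<beta>1 \<and>
          configuration C S I le c2 \<and>
          config_iso C J leJ (subconfig J leJ c2) c' \<beta>2 \<and>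
          config_iso C K leK (quotconfig I \<phi> K leK c2) ct \<gamma>2 \<and>
          config_Comp C L leK \<alpha> (subconfig_map L leK \<gamma>2) = quotconfig_map J \<psi> L leK \<beta>2 \<longrightarrow>
          (\<exists>!\<eta>. config_iso C I le c1 c2 \<eta> \<and>
             config_Comp C J leJ \<beta>2 (subconfig_map J leJ \<eta>) = \<beta>1 \<and>
             config_Comp C K leK \<gamma>2 (quotconfig_map I \<phi> K leK \<eta>) = \<gamma>1)))"
proof -
  note po = assms(3,5) and L = assms(6) and disj = assms(7) and \<psi>_surj = assms(8) and \<psi>_mono = assms(9)
  interpret exact_category C S by (rule assms(1))
  interpret poset_subst I le K leK \<phi> L
    unfolding assms(10-12) by (rule poset_subst_subst_le[OF po L disj \<psi>_surj \<psi>_mono])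
  interpret substitution C S I le K leK \<phi> L
    by unfold_locales (use assms(4) in simp)
  have LK: "L \<subseteq> K" by (rule fsetsD(1)[OF L])
  have pre_\<psi>: "\<psi> -` A \<inter> J = pre A" if "A \<subseteq> L" for A
    using that disj unfolding assms(10,12) by (auto simp: subst_map_def split: if_splits)
  have "\<psi> -` L \<inter> J = J" using \<psi>_surj by blast
  then have preL: "pre L = J" using pre_\<psi>[of L] by simp
  have le: "leJ \<inter> J \<times> J = le \<inter> J \<times> J"
    using subst_le_restrict[OF po L disj \<psi>_surj \<psi>_mono] assms(11) by blast
  have J: "configuration C S J leJ = configuration C S J le" "config_iso C J leJ = config_iso C J le"
    by (simp_all only: configuration_cong[OF le] config_iso_cong[OF le])
  have sub: "subconfig J leJ = subconfig J le" "subconfig_map J leJ = subconfig_map J le"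
    unfolding subconfig_reindex subconfig_map_reindex by (rule reindex_rel_cong[OF le])+
  have IdComp: "config_Id C J leJ = config_Id C J le" "config_Comp C J leJ = config_Comp C J le"
    unfolding fun_eq_iff config_Id_def config_Comp_def fsets_cong[OF le] by simp_all
  have quot: "quotconfig J \<psi> L leK = quotconfig I \<phi> L leK" "quotconfig_map J \<psi> L leK = quotconfig_map I \<phi> L leK"
    unfolding quotconfig_reindex quotconfig_map_reindex
    by (rule reindex_cong, rule pre_\<psi>, erule fsetsD(1))+
  have c': "configuration C S J le c'" and ct: "configuration C S K leK ct"
    using assms(13,14) by (simp_all add: J)
  show ?thesis
    unfolding J sub IdComp quot
  proof (intro conjI impI allI; (elim conjE)?)
    assume eq: "quotconfig I \<phi> L leK c' = subconfig L leK ct"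
    show "\<exists>c. configuration C S I le c \<and> subconfig J le c = c' \<and> quotconfig I \<phi> K leK c = ct"
      using has_substitution_config[OF substitutes _ ct eq] c' unfolding preL by blast
    fix c1 c2 assume c: "configuration C S I le c1" "subconfig J le c1 = c'" "quotconfig I \<phi> K leK c1 = ct"
      "configuration C S I le c2" "subconfig J le c2 = c'" "quotconfig I \<phi> K leK c2 = ct"
    have "cobj c' (pre A) = cobj ct A" if "A \<in> fsets L leK" for A
      using arg_cong[OF eq, of "\<lambda>c. cobj c A"] that by simp
    then have "quotconfig_map I \<phi> L leK (config_Id C J le c') = subconfig_map L leK (config_Id C K leK ct)"
      using L_fsets by (intro compat_eqI) (simp add: config_Id_def preL)
    then show "\<exists>!\<eta>. config_iso C I le c1 c2 \<eta> \<and> subconfig_map J le \<eta> = config_Id C J le c' \<and>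
        quotconfig_map I \<phi> K leK \<eta> = config_Id C K leK ct"
      using ex1_canonical_iso[OF c(1,4), unfolded preL c] config_iso_Id[OF c'] config_iso_Id[OF ct] by blast
  next
    fix c
    show "quotconfig I \<phi> L leK (subconfig J le c) = subconfig L leK (quotconfig I \<phi> K leK c)"
      using sub_quot(1)[OF L, of c] by (simp add: preL)
  next
    fix \<alpha> assume \<alpha>: "config_iso C L leK (subconfig L leK ct) (quotconfig I \<phi> L leK c') \<alpha>"
    show "\<exists>c \<beta> \<gamma>. configuration C S I le c \<and> config_iso C J le (subconfig J le c) c' \<beta> \<and>
        config_iso C K leK (quotconfig I \<phi> K leK c) ct \<gamma> \<and>
        config_Comp C L leK \<alpha> (subconfig_map L leK \<gamma>) = quotconfig_map I \<phi> L leK \<beta>"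
      by (rule ex_twisted_substitution[unfolded preL, OF c' ct \<alpha>])
    fix c1 \<beta>1 \<gamma>1 c2 \<beta>2 \<gamma>2
    assume "configuration C S I le c1" "config_iso C J le (subconfig J le c1) c' \<beta>1"
      "config_iso C K leK (quotconfig I \<phi> K leK c1) ct \<gamma>1"
      "config_Comp C L leK \<alpha> (subconfig_map L leK \<gamma>1) = quotconfig_map I \<phi> L leK \<beta>1"
      "configuration C S I le c2" "config_iso C J le (subconfig J le c2) c' \<beta>2"
      "config_iso C K leK (quotconfig I \<phi> K leK c2) ct \<gamma>2"
      "config_Comp C L leK \<alpha> (subconfig_map L leK \<gamma>2) = quotconfig_map I \<phi> L leK \<beta>2"
    then show "\<exists>!\<eta>. config_iso C I le c1 c2 \<eta> \<and> config_Comp C J le \<beta>2 (subconfig_map J le \<eta>) = \<beta>1 \<and>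
        config_Comp C K leK \<gamma>2 (quotconfig_map I \<phi> K leK \<eta>) = \<gamma>1"
      by (rule ex1_twisted_iso[unfolded preL, OF c' ct \<alpha>])
  qed
qed

end
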